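(* Let $A$ be a finite alphabet with $r=|A|\ge2$ letters and let $k\ge 2$ be a fixed integer. For the uniform distribution over $k$-tuples of cyclically reduced words of length at most $n$, strict Whitehead minimality is exponentially generic. That is, if $\vec h=(h_1,\dots,h_k)$ is chosen uniformly at random among the $k$-tuples of cyclically reduced words over $\tilde A$ of length at most $n$, and $H=\langle h_1,\dots,h_k\rangle\le F(A)$, then there is a constant $c>0$ such that the probability that $H$ is not strictly Whitehead minimal is $\mathcal{O}(e^{-cn})$ as $n\to\infty$.
   Context: $\tilde A=A\cup\{\bar a\mid a\in A\}$ is the symmetrized alphabet (with $\bar{\bar a}=a$, and $\bar a$ standing for $a^{-1}$); $F(A)$ is the free group on $A$, identified with the set of reduced words over $\tilde A$ (words with no factor $a\bar a$ or $\bar a a$, $a\in A$). A reduced word $u$ is cyclically reduced if $uu$ is reduced. An $A$-graph is a finite directed graph whose edges are labeled by letters of $A$; each $a$-edge from $p$ to $q$ is also regarded as an $\bar a$-labeled transition from $q$ to $p$. It is reduced if it is connected and no two edges with the same label start (resp. end) at the same vertex. The valency of a vertex is its number of incident edge-ends (a loop counts twice). For each finitely generated subgroup $H$ of $F(A)$ there is a unique (up to isomorphism) reduced $A$-graph $\Gamma(H)$ with a distinguished vertex $1$, in which every vertex except possibly $1$ has valency at least 2, and such that $H$ is exactly the set of reduced words labeling a loop from $1$ to $1$; it is the Stallings graph of $H$. $|H|$ denotes the number of vertices of $\Gamma(H)$. $H$ is strictly Whitehead minimal if $|H|<|\varphi(H)|$ for every automorphism $\varphi$ of $F(A)$ that is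 not length preserving, i.e., that is not induced by a permutation of $\tilde A$. In other words, $H$ is the only minimum size representative of its orbit under the automorphism group of $F(A)$, up to a permutation of the letters (that is, up to a relabeling of the edges of its Stallings graph).
   Formalization: Since conjugating H by a letter leaving vertex 1 never increases |H|, strict inequality is required only for automorphisms not length preserving up to an inner automorphism; for all automorphisms only |H| ≤ |φ(H)| is required. *)

theory Defs
  imports "HOL-Algebra.Bij" "HOL-Algebra.Generated_Groups" "HOL-Probability.Probability"
    "HOL-Library.Landau_Symbols"
begin

section \<open>The free group on the alphabet \<open>'a\<close>, as the group of reduced words\<close>

text \<open>\<open>(a, True)\<close> is the letter \<open>a\<close> and \<open>(a, False)\<close> is its formal inverse.\<close>

type_synonym 'a letter = "'a \<times> bool"
type_synonym 'a word = "'a letter list"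

fun bar :: "'a letter \<Rightarrow> 'a letter" where
  "bar (a, b) = (a, \<not> b)"

definition reduced_word :: "'a word \<Rightarrow> bool" where
  "reduced_word = successively (\<lambda>x y. y \<noteq> bar x)"

definition cyclically_reduced :: "'a word \<Rightarrow> bool" where
  "cyclically_reduced u \<longleftrightarrow> reduced_word u \<and> reduced_word (u @ u)"

text \<open>\<open>push x u\<close> is the reduced form of \<open>x # u\<close> when \<open>u\<close> is already reduced.\<close>

fun push :: "'a letter \<Rightarrow> 'a word \<Rightarrow> 'a word" where
  "push x [] = [x]"
| "push x (y # u) = (if y = bar x then u else x # y # u)"

definition reduce :: "'a word \<Rightarrow> 'a word" where
  "reduce w = foldr push w []"

definition free_group :: "'a word monoid" where
  "free_group = \<lparr>carrier = {w. reduced_word w}, monoid.mult = (\<lambda>u v. reduce (u @ v)), one = []\<rparr>"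

lemma bar_bar [simp]: "bar (bar x) = x"
  by (cases x) simp

lemma bar_neq [simp]: "bar x \<noteq> x"
  by (cases x) simp

lemma reduced_Nil [simp]: "reduced_word []"
  by (simp add: reduced_word_def)

lemma reduced_push: "reduced_word u \<Longrightarrow> reduced_word (push x u)"
  by (cases u) (auto simp: reduced_word_def successively_Cons)

lemma reduced_foldr: "reduced_word u \<Longrightarrow> reduced_word (foldr push w u)"
  by (induction w) (auto intro: reduced_push)

lemma push_bar:
  assumes "reduced_word u"
  shows "push x (push (bar x) u) = u"
proof (cases u)
  case (Cons y w)
  with assms show ?thesis by (cases w) (auto simp: reduced_word_def)
qed simp

lemma push_reduced: "reduced_word (x # u) \<Longrightarrow> push x u = x # u"
  by (cases u) (auto simp: reduced_word_def)

lemma reduce_reduced: "reduced_word u \<Longrightarrow> reduce u = u"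
proof (induction u)
  case (Cons x u)
  then have "reduced_word u" by (auto simp: reduced_word_def successively_Cons)
  with Cons show ?case by (simp add: reduce_def push_reduced)
qed (simp add: reduce_def)

lemma reduced_reduce: "reduced_word (reduce w)"
  unfolding reduce_def by (rule reduced_foldr) (simp add: reduced_word_def)

lemma foldr_push:
  assumes "reduced_word u" "reduced_word v"
  shows "foldr push (push x v) u = push x (foldr push v u)"
proof (cases v)
  case (Cons y w)
  have "reduced_word (foldr push w u)" by (rule reduced_foldr) fact
  with Cons show ?thesis by (auto simp: push_bar)
qed simp

lemma foldr_reduce: "reduced_word u \<Longrightarrow> foldr push (reduce w) u = foldr push w u"
proof (induction w)
  case (Cons x w)
  have "reduce (x # w) = push x (reduce w)" by (simp add: reduce_def)
  with Cons show ?case by (simp add: foldr_push reduced_reduce)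
qed (simp add: reduce_def)

lemma reduce_append: "reduce (u @ v) = foldr push u (reduce v)"
  by (simp add: reduce_def)

lemma reduced_rev_bar: "reduced_word w \<Longrightarrow> reduced_word (rev (map bar w))"
  unfolding reduced_word_def successively_rev successively_map
  by (erule successively_mono) (metis bar_bar)

lemma inverse_word: "reduced_word u \<Longrightarrow> foldr push (rev (map bar w)) (foldr push w u) = u"
proof (induction w arbitrary: u)
  case (Cons x w)
  have "push (bar x) (push x (foldr push w u)) = foldr push w u"
    using push_bar[of "foldr push w u" "bar x"] Cons.prems by (simp add: reduced_foldr)
  with Cons show ?case by simp
qed simp

lemma group_free_group: "group (free_group :: 'a word monoid)"
proof (rule groupI)
  fix x y z :: "'a word"
  assume "x \<in> carrier free_group" "y \<in> carrier free_group" "z \<in> carrier free_group"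
  then show "x \<otimes>\<^bsub>free_group\<^esub> y \<otimes>\<^bsub>free_group\<^esub> z
      = x \<otimes>\<^bsub>free_group\<^esub> (y \<otimes>\<^bsub>free_group\<^esub> z)"
    by (simp add: free_group_def reduce_append reduced_reduce reduce_reduced)
       (metis foldr_append foldr_reduce reduce_append reduce_reduced reduced_reduce)
next
  fix x :: "'a word"
  assume x: "x \<in> carrier free_group"
  have "reduce (rev (map bar x) @ x) = []"
    using inverse_word[of "[]" x] by (simp add: reduce_def reduced_word_def)
  moreover have "reduced_word (rev (map bar x))"
    using x by (auto simp: free_group_def intro: reduced_rev_bar)
  ultimately show "\<exists>y\<in>carrier free_group. y \<otimes>\<^bsub>free_group\<^esub> x = \<one>\<^bsub>free_group\<^esub>"
    by (auto simp: free_group_def)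
qed (auto simp: free_group_def reduced_reduce reduce_reduced)

section \<open>Stallings graphs\<close>

text \<open>
  Since an \<open>A\<close>-graph is finite, its vertices may be taken to be natural numbers. Edges form a
  set of triples (source, label, target); two edges sharing all three would be excluded anyway in a
  reduced \<open>A\<close>-graph.
\<close>

record 'a agraph =
  verts :: "nat set"
  edges :: "(nat \<times> 'a \<times> nat) set"

definition is_agraph :: "'a agraph \<Rightarrow> bool" where
  "is_agraph G \<longleftrightarrow> finite (verts G) \<and> finite (edges G) \<and>
     (\<forall>(p, a, q) \<in> edges G. p \<in> verts G \<and> q \<in> verts G)"

fun transition :: "'a agraph \<Rightarrow> nat \<Rightarrow> 'a letter \<Rightarrow> nat \<Rightarrow> bool" where
  "transition G p (a, b) q = (if b then (p, a, q) \<in> edges G else (q, a, p) \<in> edges G)"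

fun walk :: "'a agraph \<Rightarrow> nat \<Rightarrow> 'a word \<Rightarrow> nat \<Rightarrow> bool" where
  "walk G p [] q = (p = q)"
| "walk G p (x # w) q = (\<exists>m. transition G p x m \<and> walk G m w q)"

definition reduced_agraph :: "'a agraph \<Rightarrow> bool" where
  "reduced_agraph G \<longleftrightarrow> is_agraph G \<and>
     (\<forall>p \<in> verts G. \<forall>q \<in> verts G. \<exists>w. walk G p w q) \<and>
     (\<forall>p a q q'. (p, a, q) \<in> edges G \<and> (p, a, q') \<in> edges G \<longrightarrow> q = q') \<and>
     (\<forall>p p' a q. (p, a, q) \<in> edges G \<and> (p', a, q) \<in> edges G \<longrightarrow> p = p')"

definition valency :: "'a agraph \<Rightarrow> nat \<Rightarrow> nat" where
  "valency G v = card {(p, a, q) \<in> edges G. p = v} + card {(p, a, q) \<in> edges G. q = v}"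

definition stallings_graph :: "'a word set \<Rightarrow> 'a agraph \<Rightarrow> nat \<Rightarrow> bool" where
  "stallings_graph H G v0 \<longleftrightarrow> reduced_agraph G \<and> v0 \<in> verts G \<and>
     (\<forall>v \<in> verts G. v \<noteq> v0 \<longrightarrow> 2 \<le> valency G v) \<and>
     H = {w. reduced_word w \<and> walk G v0 w v0}"

text \<open>
  The size of a finitely generated subgroup, written \<open>|H|\<close> in the literature. The description is
  meaningful because the Stallings graph of \<open>H\<close> exists and is unique up to isomorphism.
\<close>

definition subgroup_size :: "'a word set \<Rightarrow> nat" where
  "subgroup_size H = (THE n. \<exists>G v0. stallings_graph H G v0 \<and> n = card (verts G))"

section \<open>Strict Whitehead minimality\<close>

definition length_preserving :: "('a word \<Rightarrow> 'a word) \<Rightarrow> bool" where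
  "length_preserving \<phi> \<longleftrightarrow> (\<forall>w \<in> carrier free_group. length (\<phi> w) = length w)"

definition length_preserving_upto_inner :: "('a word \<Rightarrow> 'a word) \<Rightarrow> bool" where
  "length_preserving_upto_inner \<phi> \<longleftrightarrow> (\<exists>g \<in> carrier free_group.
     length_preserving (\<lambda>w. g \<otimes>\<^bsub>free_group\<^esub> \<phi> w \<otimes>\<^bsub>free_group\<^esub> inv\<^bsub>free_group\<^esub> g))"

text \<open>
  \<open>H\<close> is, up to relabeling and conjugation, the only minimum size representative of its orbit under
  the automorphism group. The usual wording asks for strict inequality for every automorphism that
  is not length preserving. It tacitly disregards inner automorphisms: if \<open>H\<close> is nontrivial and
  \<open>x\<close> labels a transition from \<open>v0\<close> to \<open>p\<close> in the Stallings graph of \<open>H\<close>, then conjugating \<open>H\<close> so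
  that the distinguished vertex moves to \<open>p\<close> never increases the size, although no such conjugation
  is length preserving on a free group of rank at least 2 (and if \<open>H\<close> is trivial, every automorphism
  fixes it). Hence no subgroup would be strictly Whitehead minimal if inner automorphisms counted.
  For these only the weak inequality of the first conjunct is required.
\<close>

definition strictly_whitehead_minimal :: "'a word set \<Rightarrow> bool" where
  "strictly_whitehead_minimal H \<longleftrightarrow>
     (\<forall>\<phi> \<in> auto free_group. subgroup_size H \<le> subgroup_size (\<phi> ` H)) \<and>
     (\<forall>\<phi> \<in> auto free_group. \<not> length_preserving_upto_inner \<phi> \<longrightarrow>
        subgroup_size H < subgroup_size (\<phi> ` H))"

section \<open>The distribution\<close>

definition cyclically_reduced_tuples :: "nat \<Rightarrow> nat \<Rightarrow> 'a word list set" where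
  "cyclically_reduced_tuples k n =
     {hs. length hs = k \<and> (\<forall>h \<in> set hs. cyclically_reduced h \<and> length h \<le> n)}"

end

theory Submission
  imports Defs "HOL-Library.Sublist"
begin

text \<open>
  Only the \<open>H\<close>-cosets in \<open>F(A)\<close> matter: the edges labelled \<open>a\<close> in the core of \<open>\<Gamma>(H)\<close> are the cosets
  that meet both the half-tree \<open>branch a\<close> and its complement in infinite sets. An automorphism pulls the
  half-trees back to almost invariant sets \<open>U\<close>, so the size of the image of \<open>H\<close> is governed by the
  number of cosets split by such sets. This number is submodular in \<open>U\<close> and invariant under translation,
  complement and finite changes. Uncrossing \<open>U\<close> with half-trees shows that every nontrivial \<open>U\<close> which is not
  almost equal to a half-tree splits many more cosets than any half-tree does, as soon as finitely many
  inequalities hold at a single vertex. If all pulled back sets are half-trees, the automorphism is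
  a permutation of the letters up to an inner automorphism. For random generators the vertex inequalities
  hold with exponentially high probability, by a large deviation estimate for the turns of a random
  reduced word and because distinct generators have short common prefixes.
\<close>


section \<open>The free group as a type\<close>

text \<open>\<open>subgroup_size\<close> counts vertices, while cuts count edges. Euler
  characteristic links the two: a Stallings graph whose group is generated by \<open>card B\<close>
  elements has at most \<open>card B\<close> more edges than vertices, and a graph in which every
  vertex has two infinite directions has at least as many edges as vertices. So the size surely
  grows once the number of edges grows by more than \<open>card B\<close>, whence the margin
  \<open>card B + 1\<close>. The lower bound for cuts holds for every almost invariant set, hence
  for all automorphisms at once; no factorization into Whitehead automorphisms is required. Such
  sets are controlled only up to finite sets, which forces splitting to be defined by infinite
  intersections and so to ignore a finite tail leading to the distinguished vertex. Cyclically
  reduced generators create no such tail, so nothing is lost for \<open>H\<close> itself. The gap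
  between cuts has a probabilistic source: a random turn is separated by a single letter with
  frequency \<open>1 / r\<close>, and strictly more often by every \<open>S\<close> with
  \<open>2 \<le> card S \<le> 2 r - 2\<close>.\<close>

typedef 'a fg = "{w :: 'a word. reduced_word w}"
  morphisms rep Fg
  by (rule exI[of _ "[]"]) simp

setup_lifting type_definition_fg

definition inv_word :: "'a word \<Rightarrow> 'a word" where
  "inv_word w = rev (map bar w)"

lemma inv_word_simps [simp]:
  "inv_word [] = []"
  "inv_word (x # w) = inv_word w @ [bar x]"
  "inv_word (u @ v) = inv_word v @ inv_word u"
  "length (inv_word w) = length w"
  "inv_word w = [] \<longleftrightarrow> w = []"
  by (auto simp: inv_word_def)

lemma inv_word_inv_word [simp]: "inv_word (inv_word w) = w"
  by (induction w) auto

lemma hd_inv_word: "w \<noteq> [] \<Longrightarrow> hd (inv_word w) = bar (last w)"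
  by (simp add: inv_word_def hd_rev last_map)

lemma last_inv_word: "w \<noteq> [] \<Longrightarrow> last (inv_word w) = bar (hd w)"
  by (simp add: inv_word_def last_rev hd_map)

lemma bar_inject [simp]: "bar x = bar y \<longleftrightarrow> x = y"
  by (metis bar_bar)

lemma bar_neq' [simp]: "x \<noteq> bar x"
  by (metis bar_neq)

lemma bar_eq_swap: "bar x = y \<longleftrightarrow> x = bar y"
  by auto

lemma reduced_inv_word [simp]: "reduced_word (inv_word w) \<longleftrightarrow> reduced_word w"
proof -
  have "reduced_word w" if "reduced_word (inv_word w)" for w :: "'b word"
    using reduced_rev_bar[OF that] inv_word_inv_word[of w] by (simp add: inv_word_def)
  then show ?thesis using reduced_rev_bar[of w] by (auto simp: inv_word_def)
qed

lemma reduced_append: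
  "reduced_word (u @ v) \<longleftrightarrow> reduced_word u \<and> reduced_word v \<and> (u \<noteq> [] \<longrightarrow> v \<noteq> [] \<longrightarrow> hd v \<noteq> bar (last u))"
  by (auto simp: reduced_word_def successively_append_iff)

lemma reduced_Cons:
  "reduced_word (x # v) \<longleftrightarrow> reduced_word v \<and> (v \<noteq> [] \<longrightarrow> hd v \<noteq> bar x)"
  using reduced_append[of "[x]" v] by (auto simp: reduced_word_def)

lemma reduced_single [simp]: "reduced_word [x]"
  by (simp add: reduced_Cons)

lemma reduced_take: "reduced_word w \<Longrightarrow> reduced_word (take n w)"
  by (metis append_take_drop_id reduced_append)

lemma reduced_drop: "reduced_word w \<Longrightarrow> reduced_word (drop n w)"
  by (metis append_take_drop_id reduced_append)

lemma reduce_reduce_append: "reduce (reduce u @ v) = reduce (u @ v)"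
  by (simp add: reduce_append foldr_reduce reduced_reduce)

lemma reduce_append_reduce: "reduce (u @ reduce v) = reduce (u @ v)"
  by (simp add: reduce_append reduce_reduced reduced_reduce)

lemma reduce_inv_word_append: "reduce (inv_word w @ w) = []"
proof (induction w)
  case (Cons x w)
  have "push (bar x) (push x (reduce w)) = reduce w"
    using push_bar[of "reduce w" "bar x"] by (simp add: reduced_reduce)
  then have "reduce (inv_word (x # w) @ x # w) = reduce (inv_word w @ w)"
    by (simp add: reduce_def)
  with Cons show ?case by simp
qed (simp add: reduce_def)

lemma reduced_rep [simp]: "reduced_word (rep g)"
  using rep by auto

lemma rep_Fg_reduced: "reduced_word w \<Longrightarrow> rep (Fg w) = w"
  by (simp add: Fg_inverse)

text \<open>The class \<open>group_add\<close> does not assume commutativity, so the free group is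
  written additively; \<open>g + gen y\<close> is the neighbour of \<open>g\<close> along
  \<open>y\<close> in the Cayley tree.\<close>

instantiation fg :: (type) group_add
begin

lift_definition zero_fg :: "'a fg" is "[]" by simp
lift_definition plus_fg :: "'a fg \<Rightarrow> 'a fg \<Rightarrow> 'a fg" is "\<lambda>u v. reduce (u @ v)"
  by (simp add: reduced_reduce)
lift_definition uminus_fg :: "'a fg \<Rightarrow> 'a fg" is inv_word by simp
definition minus_fg :: "'a fg \<Rightarrow> 'a fg \<Rightarrow> 'a fg" where "minus_fg g h = g + - h"

instance
proof
  fix a b c :: "'a fg"
  show "a + b + c = a + (b + c)"
    by transfer (simp add: reduce_reduce_append reduce_append_reduce)
  show "0 + a = a" "a + 0 = a"
    by (transfer, simp add: reduce_reduced)+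
  show "- a + a = 0"
    by transfer (rule reduce_inv_word_append)
  show "a + - b = a - b" by (simp add: minus_fg_def)
qed

end

definition el :: "'a word \<Rightarrow> 'a fg" where
  "el w = Fg (reduce w)"

abbreviation gen :: "'a letter \<Rightarrow> 'a fg" where
  "gen x \<equiv> el [x]"

lemma rep_el: "rep (el w) = reduce w"
  by (simp add: el_def rep_Fg_reduced reduced_reduce)

lemma rep_el_reduced: "reduced_word w \<Longrightarrow> rep (el w) = w"
  by (simp add: rep_el reduce_reduced)

lemma el_rep [simp]: "el (rep g) = g"
  by (simp add: el_def reduce_reduced rep_inverse)

lemma rep_plus: "rep (g + h) = reduce (rep g @ rep h)"
  by (rule plus_fg.rep_eq)

lemma rep_uminus: "rep (- g) = inv_word (rep g)"
  by (rule uminus_fg.rep_eq)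

lemma rep_zero [simp]: "rep 0 = []"
  by (rule zero_fg.rep_eq)

lemma rep_eq_Nil [simp]: "rep g = [] \<longleftrightarrow> g = 0"
  by (metis rep_zero rep_inject)

lemma el_append: "el (u @ v) = el u + el v"
  by (simp add: rep_inject[symmetric] rep_plus rep_el reduce_reduce_append reduce_append_reduce)

lemma el_Nil [simp]: "el [] = 0"
  by (simp add: rep_inject[symmetric] rep_el reduce_def)

lemma el_Cons: "el (x # w) = gen x + el w"
  using el_append[of "[x]" w] by simp

lemma el_inv_word: "el (inv_word w) = - el w"
proof -
  have "el (inv_word w) + el w = 0"
    by (simp add: el_append[symmetric] rep_el reduce_inv_word_append flip: rep_eq_Nil)
  then show ?thesis by (simp add: eq_neg_iff_add_eq_0)
qed

lemma gen_bar: "gen (bar x) = - gen x"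
  using el_inv_word[of "[x]"] by simp

lemma rep_gen [simp]: "rep (gen x) = [x]"
  by (simp add: rep_el_reduced)

lemma rep_gen_plus: "rep (gen x + g) = push x (rep g)"
  by (simp add: rep_plus reduce_def[of "_ # _"] reduce_def[symmetric] reduce_reduced)

lemma push_conv: "push x u = (if u \<noteq> [] \<and> hd u = bar x then tl u else x # u)"
  by (cases u) auto

lemma rep_plus_reduced: "reduced_word (rep g @ rep h) \<Longrightarrow> rep (g + h) = rep g @ rep h"
  by (simp add: rep_plus reduce_reduced)

lemma rep_plus_gen:
  "rep (g + gen y) = (if g \<noteq> 0 \<and> last (rep g) = bar y then butlast (rep g) else rep g @ [y])"
proof -
  have "rep (g + gen y) = inv_word (rep (gen (bar y) + - g))"
    by (simp add: gen_bar rep_uminus[symmetric] minus_add)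
  also have "\<dots> = inv_word (push (bar y) (inv_word (rep g)))"
    by (simp only: rep_gen_plus rep_uminus)
  also have "\<dots> = (if g \<noteq> 0 \<and> last (rep g) = bar y then butlast (rep g) else rep g @ [y])"
  proof (cases "rep g" rule: rev_cases)
    case (snoc u z)
    then have "g \<noteq> 0" by auto
    with snoc show ?thesis by (auto simp: push_conv bar_eq_swap)
  qed auto
  finally show ?thesis .
qed

lemma fg_induct [case_names zero gen]:
  assumes "P 0" and "\<And>x g. P g \<Longrightarrow> P (gen x + g)"
  shows "P g"
proof -
  have "P (el w)" for w
  proof (induction w)
    case (Cons x w)
    then show ?case by (subst el_Cons) (rule assms)
  qed (simp add: assms)
  from this[of "rep g"] show ?thesis by simp
qed

section \<open>Branches\<close>

text \<open>In the Cayley tree, \<open>branch x\<close> is the half-tree cut off by the edge from \<open>1\<close> to \<open>x\<close>.\<close>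

definition branch :: "'a letter \<Rightarrow> 'a fg set" where
  "branch x = {g. g \<noteq> 0 \<and> hd (rep g) = x}"

definition branches :: "'a letter set \<Rightarrow> 'a fg set" where
  "branches S = {g. g \<noteq> 0 \<and> hd (rep g) \<in> S}"

text \<open>Edges of the Cayley tree are given by right multiplication with letters, so this left
  multiplication acts on the tree by automorphisms.\<close>

definition translate :: "'a fg \<Rightarrow> 'a fg set \<Rightarrow> 'a fg set" where
  "translate g A = (+) g ` A"

lemma mem_translate: "h \<in> translate g A \<longleftrightarrow> - g + h \<in> A"
proof
  assume "- g + h \<in> A"
  moreover have "h = g + (- g + h)" by (simp flip: add.assoc)
  ultimately show "h \<in> translate g A" unfolding translate_def by blast
qed (auto simp: translate_def simp flip: add.assoc)

lemma translate_translate [simp]: "translate g (translate h A) = translate (g + h) A"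
  by (auto simp: mem_translate minus_add add.assoc[symmetric])

lemma translate_zero [simp]: "translate 0 A = A"
  by (auto simp: mem_translate)

lemma translate_Compl: "translate g (- A) = - translate g A"
  by (auto simp: mem_translate)

lemma translate_Int: "translate g (A \<inter> B) = translate g A \<inter> translate g B"
  by (auto simp: mem_translate)

lemma translate_Diff: "translate g (A - B) = translate g A - translate g B"
  by (auto simp: mem_translate)

lemma finite_translate [simp]: "finite (translate g A) \<longleftrightarrow> finite A"
  unfolding translate_def by (simp add: finite_image_iff inj_on_def)

lemma translate_eq_iff [simp]: "translate g A = translate g B \<longleftrightarrow> A = B"
  by (metis translate_translate translate_zero left_minus)

lemma branch_branches: "branch x = branches {x}"
  by (auto simp: branch_def branches_def)

lemma zero_notin_branches [simp]: "0 \<notin> branches S" "0 \<notin> branch x"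
  by (auto simp: branches_def branch_def)

lemma mem_branch: "g \<in> branch x \<longleftrightarrow> (\<exists>w. rep g = x # w)"
  unfolding branch_def by (cases "rep g") auto

lemma mem_branches: "g \<in> branches S \<longleftrightarrow> (\<exists>x\<in>S. \<exists>w. rep g = x # w)"
  unfolding branches_def by (cases "rep g") auto

lemma mem_branch_rep: "reduced_word (x # w) \<Longrightarrow> el (x # w) \<in> branch x"
  by (simp add: mem_branch rep_el_reduced)

text \<open>Removing the edge from 1 to \<open>x\<close> leaves two sides, and the far side from
  \<open>x\<close> is the half-tree in direction \<open>bar x\<close>. So complements of half-trees
  are translated half-trees.\<close>

lemma Compl_branch: "- branch x = translate (gen x) (branch (bar x))"
proof -
  have "g \<notin> branch x \<longleftrightarrow> - gen x + g \<in> branch (bar x)" for g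
  proof -
    have r: "rep (- gen x + g) = push (bar x) (rep g)"
      by (metis gen_bar rep_gen_plus)
    show ?thesis
    proof (cases "rep g")
      case (Cons y w)
      have "reduced_word (y # w)" using reduced_rep[of g] Cons by simp
      then show ?thesis using r Cons
        by (auto simp: mem_branch reduced_Cons)
    qed (simp only: mem_branch r, simp)
  qed
  note * = this
  show ?thesis by (rule Set.set_eqI) (simp only: Compl_iff mem_translate *)
qed

text \<open>The only edge of the tree joining \<open>branch x\<close> to its complement is the one
  between 1 and \<open>x\<close>.\<close>

lemma branch_step:
  assumes "(g \<in> branch x) \<noteq> (g + gen y \<in> branch x)"
  shows "(g = 0 \<and> y = x) \<or> (g = gen x \<and> y = bar x)"
proof (cases "rep g")
  case Nil
  then have "g = 0" by simp
  then show ?thesis using assms by (auto simp: mem_branch)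
next
  case (Cons z w)
  have *: "rep (g + gen y) = (if last (rep g) = bar y then butlast (rep g) else rep g @ [y])"
    using Cons rep_plus_gen[of g y] by (metis list.distinct(1) rep_eq_Nil)
  show ?thesis
  proof (cases "w = [] \<and> last (rep g) = bar y")
    case True
    then have "rep g = rep (gen z)" "z = bar y" using Cons by auto
    then have "g = gen z" by (simp only: rep_inject)
    with True Cons * assms show ?thesis by (auto simp: mem_branch)
  next
    case False
    have "g \<in> branch x \<longleftrightarrow> z = x" by (simp add: mem_branch Cons)
    moreover have "\<exists>v. rep (g + gen y) = z # v"
      using False unfolding * unfolding Cons by (cases w) auto
    then have "g + gen y \<in> branch x \<longleftrightarrow> z = x" by (auto simp: mem_branch)
    ultimately
    show ?thesis using assms by blast
  qed
qed

section \<open>Sets up to finite differences\<close>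

text \<open>For almost invariant sets this means that they define the same set of ends of the
  tree.\<close>

definition aeq :: "'b set \<Rightarrow> 'b set \<Rightarrow> bool"  (infix "=*" 50) where
  "A =* B \<longleftrightarrow> finite (A - B) \<and> finite (B - A)"

lemma aeq_refl [simp]: "A =* A"
  by (simp add: aeq_def)

lemma aeq_sym: "A =* B \<Longrightarrow> B =* A"
  by (simp add: aeq_def)

lemma aeq_trans: "A =* B \<Longrightarrow> B =* C \<Longrightarrow> A =* C"
proof -
  assume "A =* B" "B =* C"
  then have "finite ((A - B) \<union> (B - C))" "finite ((C - B) \<union> (B - A))"
    by (auto simp: aeq_def)
  moreover have "A - C \<subseteq> (A - B) \<union> (B - C)" "C - A \<subseteq> (C - B) \<union> (B - A)" by auto
  ultimately show "A =* C" unfolding aeq_def by (meson finite_subset)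
qed

lemma aeq_Compl: "A =* B \<Longrightarrow> - A =* - B"
  unfolding aeq_def by (simp add: Diff_eq Int_commute)

lemma aeq_translate: "A =* B \<Longrightarrow> translate g A =* translate g B"
  by (simp add: aeq_def flip: translate_Diff)

lemma aeqI:
  assumes "finite F" "A \<subseteq> F \<union> B" "B \<subseteq> F \<union> A"
  shows "A =* B"
proof -
  have "A - B \<subseteq> F" "B - A \<subseteq> F" using assms by auto
  then show ?thesis using assms(1) unfolding aeq_def by (simp add: finite_subset)
qed

lemma aeqD:
  assumes "A =* B"
  obtains F where "finite F" "A \<subseteq> F \<union> B" "B \<subseteq> F \<union> A"
  using assms that[of "(A - B) \<union> (B - A)"] by (auto simp: aeq_def)

lemma aeq_Int:
  assumes "A =* B"
  shows "C \<inter> A =* C \<inter> B"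
  using assms by (elim aeqD, intro aeqI) auto

lemma aeq_finite:
  assumes "A =* B"
  shows "finite A \<longleftrightarrow> finite B"
  using assms by (metis aeqD finite_UnI finite_subset)

lemma aeq_finite_Int: "A =* B \<Longrightarrow> finite (Y \<inter> A) \<longleftrightarrow> finite (Y \<inter> B)"
  by (intro aeq_finite aeq_Int)

lemma aeq_finite_Diff: "A =* B \<Longrightarrow> finite (Y - A) \<longleftrightarrow> finite (Y - B)"
  using aeq_finite_Int[OF aeq_Compl] by (simp add: Diff_eq)

section \<open>Cosets split by a set\<close>

definition subgrp :: "'a fg set \<Rightarrow> bool" where
  "subgrp K \<longleftrightarrow> 0 \<in> K \<and> (\<forall>g\<in>K. \<forall>h\<in>K. g + h \<in> K) \<and> (\<forall>g\<in>K. - g \<in> K)"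

definition cosets :: "'a fg set \<Rightarrow> 'a fg set set" where
  "cosets K = range (\<lambda>g. translate g K)"

text \<open>
  A coset counts as split by \<open>U\<close> if both parts are infinite, that is, if its limit set meets the
  limit sets of \<open>U\<close> and of \<open>- U\<close>. This is the cut function of a hypergraph, hence submodular.
\<close>

definition Split :: "'a fg set \<Rightarrow> 'a fg set \<Rightarrow> 'a fg set set" where
  "Split K U = {Y \<in> cosets K. infinite (Y \<inter> U) \<and> infinite (Y - U)}"

abbreviation nsplit :: "'a fg set \<Rightarrow> 'a fg set \<Rightarrow> nat" where
  "nsplit K U \<equiv> card (Split K U)"

lemma translate_cosets [simp]: "translate g Y \<in> cosets K \<longleftrightarrow> Y \<in> cosets K"
proof
  assume "translate g Y \<in> cosets K"
  then obtain h where "translate g Y = translate h K" by (auto simp: cosets_def)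
  then have "translate (- g) (translate g Y) = translate (- g + h) K" by simp
  then have "Y = translate (- g + h) K" unfolding translate_translate by simp
  then show "Y \<in> cosets K" by (auto simp: cosets_def)
qed (auto simp: cosets_def)

lemma Split_aeq: "U =* V \<Longrightarrow> Split K U = Split K V"
  by (simp add: Split_def aeq_finite_Int aeq_finite_Diff)

lemma Split_Compl: "Split K (- U) = Split K U"
  by (auto simp: Split_def Diff_eq)

lemma Split_translate: "Split K (translate g U) = translate g ` Split K U"
proof -
  have 1: "translate g Y \<in> Split K (translate g U) \<longleftrightarrow> Y \<in> Split K U" for g Y and U :: "'a fg set"
    by (simp add: Split_def flip: translate_Int translate_Diff)
  have "Y \<in> translate g ` Split K U" if "Y \<in> Split K (translate g U)" for Y
  proof
    show "Y = translate g (translate (- g) Y)" by simp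
    then show "translate (- g) Y \<in> Split K U" using that 1 by metis
  qed
  with 1 show ?thesis by blast
qed

lemma nsplit_translate [simp]: "nsplit K (translate g U) = nsplit K U"
  unfolding Split_translate by (rule card_image) (simp add: inj_on_def)

lemma finite_Split_translate [simp]: "finite (Split K (translate g U)) \<longleftrightarrow> finite (Split K U)"
  unfolding Split_translate by (rule finite_image_iff) (simp add: inj_on_def)

text \<open>A coset split by the union or by the intersection is split by \<open>U\<close> or by
  \<open>W\<close>, and a coset split by both of the former is split by both of the latter. With
  multiplicities counted, this is submodularity.\<close>

lemma Split_Un_Int:
  "Split K (U \<union> W) \<union> Split K (U \<inter> W) \<subseteq> Split K U \<union> Split K W"
  "Split K (U \<union> W) \<inter> Split K (U \<inter> W) \<subseteq> Split K U \<inter> Split K W"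
proof -
  have 1: "Y \<inter> (U \<union> W) = (Y \<inter> U) \<union> (Y \<inter> W)" "Y - U \<inter> W = (Y - U) \<union> (Y - W)" for Y
    by auto
  have 2: "finite (Y - U) \<Longrightarrow> finite (Y - (U \<union> W))" "finite (Y - W) \<Longrightarrow> finite (Y - (U \<union> W))"
    "finite (Y \<inter> U) \<Longrightarrow> finite (Y \<inter> (U \<inter> W))" "finite (Y \<inter> W) \<Longrightarrow> finite (Y \<inter> (U \<inter> W))" for Y
    by (erule finite_subset[rotated], blast)+
  show "Split K (U \<union> W) \<union> Split K (U \<inter> W) \<subseteq> Split K U \<union> Split K W"
    "Split K (U \<union> W) \<inter> Split K (U \<inter> W) \<subseteq> Split K U \<inter> Split K W"
    unfolding Split_def 1 finite_Un using 2 by blast+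
qed

lemma nsplit_submodular:
  assumes "finite (Split K U)" "finite (Split K W)"
  shows "nsplit K (U \<union> W) + nsplit K (U \<inter> W) \<le> nsplit K U + nsplit K W"
proof -
  have fin: "finite (Split K (U \<union> W))" "finite (Split K (U \<inter> W))"
    using Split_Un_Int(1)[of K U W] assms by (meson finite_UnI finite_subset le_sup_iff)+
  have "nsplit K (U \<union> W) + nsplit K (U \<inter> W) =
      card (Split K (U \<union> W) \<union> Split K (U \<inter> W)) + card (Split K (U \<union> W) \<inter> Split K (U \<inter> W))"
    using fin by (rule card_Un_Int)
  also have "\<dots> \<le> card (Split K U \<union> Split K W) + card (Split K U \<inter> Split K W)"
    using assms Split_Un_Int[of K U W] by (intro add_mono card_mono) auto
  also have "\<dots> = nsplit K U + nsplit K W"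
    using assms by (rule card_Un_Int[symmetric])
  finally show ?thesis .
qed

section \<open>Subtrees\<close>

definition subtree :: "'a fg \<Rightarrow> 'a fg set" where
  "subtree v = {g. prefix (rep v) (rep g)}"

definition children :: "'a fg \<Rightarrow> 'a letter set" where
  "children v = {y. v = 0 \<or> y \<noteq> bar (last (rep v))}"

lemma subtree_zero [simp]: "subtree 0 = UNIV"
  by (simp add: subtree_def)

lemma self_subtree [simp]: "v \<in> subtree v"
  by (simp add: subtree_def)

lemma rep_child: "y \<in> children v \<Longrightarrow> rep (v + gen y) = rep v @ [y]"
  by (auto simp: children_def rep_plus_gen bar_eq_swap)

lemma mem_subtree_iff: "g \<in> subtree v \<longleftrightarrow> rep g = rep v @ rep (- v + g)"
proof
  assume "g \<in> subtree v"
  then obtain w where w: "rep g = rep v @ w" by (auto simp: subtree_def prefix_def)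
  then have "reduced_word w" by (metis reduced_rep reduced_append)
  have "g = v + el w" using w el_append[of "rep v" w] by (metis el_rep)
  then have "- v + g = el w" by (simp flip: add.assoc)
  with w show "rep g = rep v @ rep (- v + g)" by (simp add: rep_el_reduced \<open>reduced_word w\<close>)
qed (simp add: subtree_def prefix_def)

lemma subtree_eq: "subtree v = insert v (translate v (branches (children v)))"
proof (rule Set.set_eqI)
  fix g
  show "g \<in> subtree v \<longleftrightarrow> g \<in> insert v (translate v (branches (children v)))"
  proof (cases "g = v")
    case False
    then have ne: "- v + g \<noteq> 0" by (metis add.right_neutral add_minus_cancel)
    then obtain y w where yw: "rep (- v + g) = y # w" by (cases "rep (- v + g)") auto
    have g: "g = v + (- v + g)" by (simp flip: add.assoc)
    have "rep g = rep v @ rep (- v + g) \<longleftrightarrow> reduced_word (rep v @ rep (- v + g))"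
      using g rep_plus_reduced by (metis reduced_rep)
    also have "\<dots> \<longleftrightarrow> y \<in> children v"
      using yw reduced_rep[of v] reduced_rep[of "- v + g"] by (auto simp: reduced_append children_def)
    finally show ?thesis using False ne yw
      by (auto simp: mem_subtree_iff mem_translate mem_branches)
  qed simp
qed

lemma translate_branch_subtree:
  assumes "y \<in> children v"
  shows "translate v (branch y) = subtree (v + gen y)"
proof -
  have "g \<in> translate v (branch y) \<longleftrightarrow> g \<in> subtree (v + gen y)" for g
  proof
    assume "g \<in> translate v (branch y)"
    then obtain w where w: "rep (- v + g) = y # w" by (auto simp: mem_translate mem_branch)
    then have "g \<in> subtree v"
      using assms by (auto simp: subtree_eq mem_translate mem_branches)
    then have "rep g = rep v @ y # w" using w by (simp add: mem_subtree_iff)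
    then show "g \<in> subtree (v + gen y)" using assms by (simp add: subtree_def rep_child)
  next
    assume "g \<in> subtree (v + gen y)"
    then obtain w where w: "rep g = rep v @ y # w"
      using assms by (auto simp: subtree_def rep_child prefix_def)
    then have "g \<in> subtree v" by (simp add: subtree_def prefix_def)
    with w have "rep (- v + g) = y # w" by (simp add: mem_subtree_iff)
    then show "g \<in> translate v (branch y)" by (auto simp: mem_translate mem_branch)
  qed
  then show ?thesis by blast
qed

text \<open>Everything below a vertex other than the root is cut off by the last edge on the way to
  that vertex.\<close>

lemma subtree_eq_translate_branch:
  assumes "v \<noteq> 0"
  obtains u where "subtree v = translate u (branch (last (rep v)))"
proof -
  obtain w x where w: "rep v = w @ [x]" using assms by (cases "rep v" rule: rev_cases) auto
  have red: "reduced_word (w @ [x])" using reduced_rep[of v] w by simp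
  then have rw: "rep (el w) = w" by (simp add: reduced_append rep_el_reduced)
  have v: "v = el w + gen x" using w el_append[of w "[x]"] by (metis el_rep)
  have "x \<in> children (el w)" using red rw
    by (auto simp: children_def reduced_append simp del: rep_eq_Nil simp: rep_eq_Nil[symmetric])
  then show ?thesis using that translate_branch_subtree v w by fastforce
qed

section \<open>Small cuts are half-trees\<close>

text \<open>\<open>mixed U\<close> is the finite tree spanned by the vertices below which \<open>U\<close> is not constant.\<close>

definition mixed :: "'a fg set \<Rightarrow> 'a fg set" where
  "mixed U = {v. infinite (subtree v \<inter> U) \<and> infinite (subtree v - U)}"

lemma mixed_Compl: "mixed (- U) = mixed U"
  by (auto simp: mixed_def Diff_eq)

lemma finite_branches_Int:
  fixes S :: "'a::finite letter set"
  assumes "\<And>y. y \<in> S \<Longrightarrow> finite (translate v (branch y) \<inter> A)"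
  shows "finite (translate v (branches S) \<inter> A)"
proof -
  have "translate v (branches S) \<inter> A = (\<Union>y\<in>S. translate v (branch y) \<inter> A)"
    by (auto simp: mem_translate mem_branches mem_branch)
  moreover have "finite (\<Union>y\<in>S. translate v (branch y) \<inter> A)"
    using assms by (intro finite_UN_I) auto
  ultimately show ?thesis by simp
qed

text \<open>No child of a deepest mixed vertex is mixed, so below each child \<open>U\<close> is
  almost everything or almost nothing. \<open>S\<close> collects the children of the first kind;
  both kinds occur because \<open>v\<close> itself is mixed.\<close>

lemma mixed_leaf:
  fixes U :: "'a::finite fg set"
  assumes v: "v \<in> mixed U" and max: "\<And>w. w \<in> mixed U \<Longrightarrow> length (rep w) \<le> length (rep v)"
  obtains S where "S \<subseteq> children v" "S \<noteq> {}" "S \<noteq> children v"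
    "subtree v \<inter> U =* translate v (branches S)"
    "subtree v - U =* translate v (branches (children v - S))"
proof -
  define S where "S = {y \<in> children v. finite (translate v (branch y) - U)}"
  have notmixed: "v + gen y \<notin> mixed U" if "y \<in> children v" for y
    using max[of "v + gen y"] that by (auto simp: rep_child)
  have fin1: "finite (translate v (branches S) - U)"
    unfolding Diff_eq by (rule finite_branches_Int) (simp add: S_def Diff_eq)
  have fin2: "finite (translate v (branches (children v - S)) \<inter> U)"
  proof (rule finite_branches_Int)
    fix y assume "y \<in> children v - S"
    then show "finite (translate v (branch y) \<inter> U)"
      using notmixed[of y] by (auto simp: S_def mixed_def translate_branch_subtree)
  qed
  have split: "translate v (branches (children v)) =
      translate v (branches S) \<union> translate v (branches (children v - S))"
  proof -
    have "S \<subseteq> children v" unfolding S_def by blast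
    then have "branches (children v) = branches S \<union> branches (children v - S)"
      by (auto simp: branches_def)
    then show ?thesis by (simp add: translate_def image_Un)
  qed
  have sub: "subtree v = insert v (translate v (branches S) \<union> translate v (branches (children v - S)))"
    unfolding subtree_eq[of v] split ..
  have 1: "subtree v \<inter> U =* translate v (branches S)"
    by (rule aeqI[of "insert v ((translate v (branches S) - U) \<union> (translate v (branches (children v - S)) \<inter> U))"])
      (use fin1 fin2 in \<open>auto simp: sub\<close>)
  have 2: "subtree v - U =* translate v (branches (children v - S))"
    by (rule aeqI[of "insert v ((translate v (branches S) - U) \<union> (translate v (branches (children v - S)) \<inter> U))"])
      (use fin1 fin2 in \<open>auto simp: sub\<close>)
  have "branches {} = {}" by (simp add: branches_def)
  then have "S \<noteq> {}" "children v - S \<noteq> {}"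
    using v aeq_finite[OF 1] aeq_finite[OF 2] unfolding mixed_def finite_translate mem_Collect_eq
    by (metis finite.emptyI)+
  moreover from this have "S \<noteq> children v" by blast
  moreover have "S \<subseteq> children v" unfolding S_def by blast
  ultimately show ?thesis using that 1 2 by blast
qed

lemma card_children: "v \<noteq> 0 \<Longrightarrow> card (children v :: 'a::finite letter set) = CARD('a letter) - 1"
proof -
  assume "v \<noteq> 0"
  then have "children v = - {bar (last (rep v))}" by (auto simp: children_def)
  then show ?thesis by (simp add: Compl_eq_Diff_UNIV card_Diff_subset)
qed

text \<open>The sets \<open>branches S\<close> with \<open>2 \<le> card S\<close> and
  \<open>card S + 2 \<le> CARD('a letter)\<close> are the cuts at a vertex that are not half-trees.
  In the last inequality \<open>x\<close> stands for the half-tree used for uncrossing and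
  \<open>y\<close> for the half-tree that the uncrossed set may turn into; \<open>x = y\<close>
  shows that the vertex cuts themselves have size at least \<open>L\<close>.\<close>

locale gap =
  fixes K :: "'a::finite fg set" and L :: nat
  assumes fin: "finite (Split K (branches S))"
  and branch_le: "nsplit K (branch x) \<le> L"
  and gap: "2 \<le> card S \<Longrightarrow> card S + 2 \<le> CARD('a letter) \<Longrightarrow>
    L + nsplit K (branch x) \<le> nsplit K (branches S) + nsplit K (branch y)"
begin

lemma fin_branch: "finite (Split K (branch x))"
  by (simp add: branch_branches fin)

lemma L_le:
  assumes "2 \<le> card S" "card S + 2 \<le> CARD('a letter)"
  shows "L \<le> nsplit K (branches S)"
  using gap[OF assms, of undefined undefined] by simp

text \<open>Submodularity is applied to \<open>U\<close> and the half-tree below \<open>v\<close>.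
  The intersection is almost a vertex cut given by \<open>S\<close>, and the union has fewer mixed
  vertices, so the induction hypothesis applies unless the union is cofinite.\<close>

lemma small_cut_step:
  assumes finU: "finite (Split K U)" and v: "v \<in> mixed U" "v \<noteq> 0"
    and finm: "finite (mixed U)"
    and S: "S \<subseteq> children v" "2 \<le> card S" "S \<noteq> children v"
    and 1: "subtree v \<inter> U =* translate v (branches S)"
    and 2: "subtree v - U =* translate v (branches (children v - S))"
    and IH: "\<And>U'. mixed U' \<subset> mixed U \<Longrightarrow> finite (Split K U') \<Longrightarrow> infinite U' \<Longrightarrow> infinite (- U') \<Longrightarrow>
      (\<exists>g x. U' =* translate g (branch x)) \<or> L \<le> nsplit K U'"
  shows "(\<exists>g x. U =* translate g (branch x)) \<or> L \<le> nsplit K U"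
proof -
  obtain u where W: "subtree v = translate u (branch (last (rep v)))"
    using subtree_eq_translate_branch[OF v(2)] .
  define x where "x = last (rep v)"
  note W = W[folded x_def]
  have finW: "finite (Split K (subtree v))" and cardW: "nsplit K (subtree v) = nsplit K (branch x)"
    unfolding W by (simp_all add: fin_branch)
  have cardI: "nsplit K (U \<inter> subtree v) = nsplit K (branches S)"
    using Split_aeq[OF 1] by (simp add: Int_commute)
  have "card S < card (children v)" using S by (intro psubset_card_mono) auto
  then have cS: "card S + 2 \<le> CARD('a letter)" using card_children[OF v(2)] by simp
  have sm: "nsplit K (U \<union> subtree v) + nsplit K (branches S) \<le> nsplit K U + nsplit K (branch x)"
    using nsplit_submodular[OF finU finW] by (simp add: cardW cardI)
  have infU1: "infinite (U \<union> subtree v)" using v by (auto simp: mixed_def)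
  have finU1: "finite (Split K (U \<union> subtree v))"
    using Split_Un_Int(1)[of K U "subtree v"] finU finW by (meson finite_UnI finite_subset le_sup_iff)
  \<comment> \<open>A new mixed vertex \<open>w\<close> would have to be comparable with
    \<open>v\<close>. Above \<open>v\<close> it sees the infinite part of \<open>U\<close> below
    \<open>v\<close> anyway; below \<open>v\<close> everything already lies in the union.\<close>
  have "mixed (U \<union> subtree v) \<subseteq> mixed U"
  proof
    fix w assume w: "w \<in> mixed (U \<union> subtree v)"
    then have i: "infinite (subtree w \<inter> (U \<union> subtree v))" "infinite (subtree w - (U \<union> subtree v))"
      by (auto simp: mixed_def)
    have "infinite (subtree w - U)"
      using i(2) finite_subset[of "subtree w - (U \<union> subtree v)" "subtree w - U"] by blast
    moreover have "infinite (subtree w \<inter> U)"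
    proof
      assume f: "finite (subtree w \<inter> U)"
      with i(1) have "subtree w \<inter> subtree v \<noteq> {}" by (auto simp: Int_Un_distrib)
      then obtain h where "prefix (rep w) (rep h)" "prefix (rep v) (rep h)" by (auto simp: subtree_def)
      then consider "prefix (rep w) (rep v)" | "prefix (rep v) (rep w)"
        by (meson prefix_same_cases)
      then show False
      proof cases
        case 1
        then have "subtree v \<subseteq> subtree w" by (auto simp: subtree_def intro: prefix_order.trans)
        then have "subtree v \<inter> U \<subseteq> subtree w \<inter> U" by blast
        then have "finite (subtree v \<inter> U)" using f by (rule finite_subset)
        then show False using v(1) by (simp add: mixed_def)
      next
        case 2
        then have "subtree w \<subseteq> subtree v" by (auto simp: subtree_def intro: prefix_order.trans)
        then have "subtree w - (U \<union> subtree v) = {}" by blast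
        then show False using i(2) by (metis finite.emptyI)
      qed
    qed
    ultimately show "w \<in> mixed U" by (simp add: mixed_def)
  qed
  moreover have "v \<notin> mixed (U \<union> subtree v)"
  proof -
    have "subtree v - (U \<union> subtree v) = {}" by blast
    then show ?thesis unfolding mixed_def by (metis (lifting) finite.emptyI mem_Collect_eq)
  qed
  ultimately have less: "mixed (U \<union> subtree v) \<subset> mixed U" using v by blast
  show ?thesis
  proof (cases "finite (- (U \<union> subtree v))")
    case False
    with IH[OF less finU1 infU1] consider
      g y where "U \<union> subtree v =* translate g (branch y)" | "L \<le> nsplit K (U \<union> subtree v)" by blast
    then show ?thesis
    proof cases
      case 1
      then have "nsplit K (U \<union> subtree v) = nsplit K (branch y)"
        using Split_aeq[OF 1] by simp
      then show ?thesis using sm gap[OF S(2) cS, of x y] by linarith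
    next
      case 2
      then show ?thesis using sm L_le[OF S(2) cS] branch_le[of x] by linarith
    qed
  next
    case True
    \<comment> \<open>When the union is cofinite, the complement of \<open>U\<close> lives below
      \<open>v\<close> up to finitely many elements, so it is itself a vertex cut or a half-tree
      there.\<close>
    have "- U =* subtree v - U"
      by (rule aeqI[OF True]) auto
    then have C: "- U =* translate v (branches (children v - S))" using 2 aeq_trans by blast
    have cd: "card (children v - S) = card (children v) - card S"
      using S by (simp add: card_Diff_subset)
    have "card (children v - S) \<noteq> 0" using S by auto
    then consider "card (children v - S) = 1" | "2 \<le> card (children v - S)" by linarith
    then show ?thesis
    proof cases
      case 1
      then obtain y where "children v - S = {y}" by (auto simp: card_1_singleton_iff)
      with C have "- U =* translate v (branch y)" by (simp add: branch_branches)
      then have "U =* - translate v (branch y)" using aeq_Compl by fastforce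
      then have "U =* translate (v + gen y) (branch (bar y))"
        by (simp add: Compl_branch flip: translate_Compl)
      then show ?thesis by blast
    next
      case 2
      have "card (children v - S) + 2 \<le> CARD('a letter)"
        using cd S(2) card_children[OF v(2)] 2 by linarith
      from L_le[OF 2 this] have "L \<le> nsplit K (- U)" using Split_aeq[OF C] by simp
      then show ?thesis by (simp add: Split_Compl)
    qed
  qed
qed

text \<open>Induction on the number of mixed vertices, uncrossing at a deepest one. If that is the
  root, \<open>U\<close> is almost \<open>branches S\<close> and the size of \<open>S\<close>
  decides.\<close>

lemma small_cut:
  assumes "finite (mixed U)" "finite (Split K U)" "infinite U" "infinite (- U)"
    and card: "CARD('a letter) \<ge> 4"
  shows "(\<exists>g x. U =* translate g (branch x)) \<or> L \<le> nsplit K U"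
  using assms(1-4)
proof (induction "card (mixed U)" arbitrary: U rule: less_induct)
  case (less U)
  have IH: "(\<exists>g x. U' =* translate g (branch x)) \<or> L \<le> nsplit K U'"
    if "mixed U' \<subset> mixed U" "finite (Split K U')" "infinite U'" "infinite (- U')" for U'
    using less.hyps[of U'] that less.prems(1) psubset_card_mono[of "mixed U" "mixed U'"]
      finite_subset[of "mixed U'" "mixed U"] by blast
  have z: "0 \<in> mixed U" using less.prems by (auto simp: mixed_def Compl_eq_Diff_UNIV)
  define l where "l = Max ((\<lambda>w. length (rep w)) ` mixed U)"
  have "l \<in> (\<lambda>w. length (rep w)) ` mixed U"
    unfolding l_def using z less.prems(1) by (intro Max_in) auto
  then obtain v where v: "v \<in> mixed U" "length (rep v) = l" by auto
  have max: "length (rep w) \<le> length (rep v)" if "w \<in> mixed U" for w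
    using that less.prems(1) unfolding v(2) l_def by (intro Max_ge) auto
  obtain S where S: "S \<subseteq> children v" "S \<noteq> {}" "S \<noteq> children v"
    and 1: "subtree v \<inter> U =* translate v (branches S)"
    and 2: "subtree v - U =* translate v (branches (children v - S))"
    using mixed_leaf[OF v(1) max] by blast
  have cS: "card S \<noteq> 0" "card (children v - S) \<noteq> 0" using S by (auto simp: card_eq_0_iff)
  have cd: "card (children v - S) = card (children v) - card S" "card S \<le> card (children v)"
    using S by (simp_all add: card_Diff_subset card_mono)
  show ?case
  proof (cases "v = 0")
    case True
    then have ch: "children v = UNIV" by (simp add: children_def)
    from 1 2 True ch have U: "U =* branches S" "- U =* branches (- S)"
      by (simp_all add: Compl_eq_Diff_UNIV)
    consider "card S = 1" | "card (- S) = 1" | "2 \<le> card S" "card S + 2 \<le> CARD('a letter)"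
      using cS cd unfolding ch Compl_eq_Diff_UNIV by linarith
    then show ?thesis
    proof cases
      case 1
      then obtain y where "S = {y}" by (auto simp: card_1_singleton_iff)
      with U have "U =* translate 0 (branch y)" by (simp add: branch_branches)
      then show ?thesis by blast
    next
      case 2
      then obtain y where "- S = {y}" by (auto simp: card_1_singleton_iff)
      with U(2) have "- U =* branch y" by (simp add: branch_branches)
      then have "U =* - branch y" using aeq_Compl by fastforce
      then have "U =* translate (gen y) (branch (bar y))" by (simp only: Compl_branch)
      then show ?thesis by blast
    next
      case 3
      then show ?thesis using L_le[OF 3] Split_aeq[OF U(1)] by simp
    qed
  next
    case False
    show ?thesis
    proof (cases "2 \<le> card S")
      case True
      then show ?thesis
        using small_cut_step[OF less.prems(2) v(1) False less.prems(1) S(1) True S(3) 1 2 IH] by blast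
    next
      \<comment> \<open>With a single child in \<open>S\<close> uncrossing would gain nothing. The
        complement of \<open>U\<close> has the same mixed vertices and the complementary child set,
        which has at least two elements because \<open>v\<close> has at least three
        children.\<close>
      case F: False
      have ge: "2 \<le> card (children v - S)"
        using F cd card_children[OF False] card by linarith
      have 3: "subtree v \<inter> - U =* translate v (branches (children v - S))"
        using 2 by (simp add: Diff_eq)
      have 4: "subtree v - - U =* translate v (branches (children v - (children v - S)))"
        using 1 double_diff[OF S(1) order_refl] by (simp only: Diff_eq double_compl)
      have "(\<exists>g x. - U =* translate g (branch x)) \<or> L \<le> nsplit K (- U)"
      proof (rule small_cut_step[OF _ _ False _ _ ge _ 3 4])
        show "children v - S \<noteq> children v" using S by blast
      qed (use less.prems v IH in \<open>auto simp: Split_Compl mixed_Compl\<close>)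
      then show ?thesis
      proof
        assume "\<exists>g x. - U =* translate g (branch x)"
        then obtain g y where "- U =* translate g (branch y)" by blast
        then have "U =* - translate g (branch y)" using aeq_Compl by fastforce
        then have "U =* translate (g + gen y) (branch (bar y))"
          by (simp add: Compl_branch flip: translate_Compl)
        then show ?thesis by blast
      qed (simp add: Split_Compl)
    qed
  qed
qed

end

section \<open>Almost invariant sets\<close>

definition almost_invariant :: "'a fg set \<Rightarrow> bool" where
  "almost_invariant U \<longleftrightarrow> (\<forall>h. finite {g. (g \<in> U) \<noteq> (g + h \<in> U)})"

text \<open>The boundary for a product is covered by the boundary for its first letter and a
  translate of the boundary for the rest, so finiteness needs checking only on letters.\<close>

lemma almost_invariantI:
  assumes "\<And>x. finite {g. (g \<in> U) \<noteq> (g + gen x \<in> U)}"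
  shows "almost_invariant U"
proof -
  have "finite {g. (g \<in> U) \<noteq> (g + h \<in> U)}" for h
  proof (induction h rule: fg_induct)
    case (gen x h)
    have "{g. (g \<in> U) \<noteq> (g + (gen x + h) \<in> U)} \<subseteq>
        {g. (g \<in> U) \<noteq> (g + gen x \<in> U)} \<union> (\<lambda>g. g + gen x) -` {g. (g \<in> U) \<noteq> (g + h \<in> U)}"
      by (auto simp: add.assoc)
    moreover have "finite ((\<lambda>g. g + gen x) -` {g. (g \<in> U) \<noteq> (g + h \<in> U)})"
      using gen by (intro finite_vimageI) (auto simp: inj_on_def)
    ultimately show ?case using assms[of x] by (meson finite_UnI finite_subset)
  qed simp
  then show ?thesis by (simp add: almost_invariant_def)
qed

lemma almost_invariant_branch: "almost_invariant (branch x)"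
proof (rule almost_invariantI)
  fix y
  have "{g. (g \<in> branch x) \<noteq> (g + gen y \<in> branch x)} \<subseteq> {0, gen x}"
    using branch_step by blast
  then show "finite {g. (g \<in> branch x) \<noteq> (g + gen y \<in> branch x)}" by (rule finite_subset) simp
qed

lemma almost_invariant_Un:
  assumes "almost_invariant U" "almost_invariant V"
  shows "almost_invariant (U \<union> V)"
proof -
  have "{g. (g \<in> U \<union> V) \<noteq> (g + h \<in> U \<union> V)} \<subseteq>
      {g. (g \<in> U) \<noteq> (g + h \<in> U)} \<union> {g. (g \<in> V) \<noteq> (g + h \<in> V)}" for h by auto
  then show ?thesis using assms unfolding almost_invariant_def by (meson finite_UnI finite_subset)
qed

lemma almost_invariant_branches: "almost_invariant (branches (S :: 'a::finite letter set))"
proof -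
  have "finite S" by simp
  then show ?thesis
  proof (induction S)
    case (insert x S)
    have "branches (insert x S) = branch x \<union> branches S" by (auto simp: branches_def branch_def)
    with insert almost_invariant_branch almost_invariant_Un show ?case by metis
  qed (simp add: branches_def almost_invariant_def)
qed

lemma finite_rep_le: "finite {g :: 'a::finite fg. length (rep g) \<le> m}"
proof -
  have "finite {w :: 'a word. length w \<le> m}"
    using finite_lists_length_le[of "UNIV :: 'a letter set" m] by simp
  then have "finite (rep -` {w :: 'a word. length w \<le> m})"
    by (rule finite_vimageI) (simp add: inj_on_def rep_inject)
  then show ?thesis by (simp add: vimage_def)
qed

text \<open>The set \<open>B\<close> of vertices with an edge leaving or entering \<open>U\<close>
  is finite. Below a vertex deeper than all of \<open>B\<close> membership in \<open>U\<close> never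
  changes.\<close>

lemma finite_mixed:
  fixes U :: "'a::finite fg set"
  assumes "almost_invariant U"
  shows "finite (mixed U)"
proof -
  define B where "B = (\<Union>x. {g. (g \<in> U) \<noteq> (g + gen x \<in> U)})"
  have "finite B" using assms by (auto simp: B_def almost_invariant_def)
  define m where "m = Max (insert 0 ((\<lambda>g. length (rep g)) ` B))"
  have m: "length (rep g) \<le> m" if "g \<in> B" for g
    unfolding m_def using that \<open>finite B\<close> by (intro Max_ge) auto
  \<comment> \<open>Every step of the descent from \<open>v\<close> to \<open>g\<close> starts at a
    vertex of length greater than \<open>m\<close>, hence outside \<open>B\<close>.\<close>
  have const: "g \<in> U \<longleftrightarrow> v \<in> U" if "rep g = rep v @ w" "length (rep v) > m" for g v w
    using that(1)
  proof (induction w arbitrary: g rule: rev_induct)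
    case Nil
    then show ?case by (simp add: rep_inject)
  next
    case (snoc y w)
    have "reduced_word (rep v @ w)" using snoc.prems reduced_rep[of g] reduced_append[of "rep v @ w" "[y]"] by simp
    then have r: "rep (el (rep v @ w)) = rep v @ w" by (rule rep_el_reduced)
    have "g = el (rep v @ w) + gen y" using snoc.prems el_append[of "rep v @ w" "[y]"]
      by (metis append_assoc el_rep)
    moreover have "el (rep v @ w) \<notin> B" using m[of "el (rep v @ w)"] r that(2) by auto
    ultimately show ?case using snoc.IH[OF r] unfolding B_def by blast
  qed
  have "mixed U \<subseteq> {g. length (rep g) \<le> m}"
  proof
    fix v assume v: "v \<in> mixed U"
    have "length (rep v) \<le> m"
    proof (rule ccontr)
      assume "\<not> length (rep v) \<le> m"
      then have "\<forall>g\<in>subtree v. g \<in> U \<longleftrightarrow> v \<in> U"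
        using const by (auto simp: subtree_def prefix_def)
      then have "subtree v \<inter> U = {} \<or> subtree v - U = {}" by blast
      then show False using v unfolding mixed_def mem_Collect_eq by (metis finite.emptyI)
    qed
    then show "v \<in> {g. length (rep g) \<le> m}" by simp
  qed
  then show ?thesis using finite_rep_le finite_subset by blast
qed

section \<open>Stallings graphs as graphs of cosets\<close>

text \<open>
  The vertices of the Stallings graph of \<open>K\<close> are the orbits of \<open>K\<close> on the convex hull of \<open>K\<close> in the
  Cayley tree. The orbit of \<open>g\<close> is recorded as the coset \<open>translate (- g) K\<close>, i.e. as \<open>K\<close> seen from \<open>g\<close>.
\<close>

definition core :: "'a fg set \<Rightarrow> 'a fg set set" where
  "core K = {Y \<in> cosets K. 0 \<in> Y \<or> (\<exists>x y. x \<noteq> y \<and> Y \<inter> branch x \<noteq> {} \<and> Y \<inter> branch y \<noteq> {})}"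

lemma cosets_disjoint:
  assumes K: "subgrp K" and "Y \<in> cosets K" "Z \<in> cosets K" "g \<in> Y" "g \<in> Z"
  shows "Y = Z"
proof -
  have *: "W = translate g K" if W: "W \<in> cosets K" "g \<in> W" for W
  proof -
    obtain h where h: "W = translate h K" using W by (auto simp: cosets_def)
    then have "- h + g \<in> K" using W by (simp add: mem_translate)
    then have "- (- h + g) \<in> K" using K by (simp add: subgrp_def)
    moreover have "- (- h + g) = - g + h" by (simp only: minus_add minus_minus)
    ultimately have "- g + h \<in> K" by simp
    have "a \<in> W \<longleftrightarrow> a \<in> translate g K" for a
    proof
      assume "a \<in> W"
      then have "- h + a \<in> K" by (simp add: h mem_translate)
      then have "(- g + h) + (- h + a) \<in> K"
        using K \<open>- g + h \<in> K\<close> by (auto simp: subgrp_def)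
      moreover have "(- g + h) + (- h + a) = - g + a"
        by (simp only: add.assoc add_minus_cancel minus_add_cancel)
      ultimately show "a \<in> translate g K" by (simp add: mem_translate)
    next
      assume "a \<in> translate g K"
      then have "(- h + g) + (- g + a) \<in> K"
        using K \<open>- h + g \<in> K\<close> by (auto simp: subgrp_def mem_translate)
      moreover have "(- h + g) + (- g + a) = - h + a"
        by (simp only: add.assoc add_minus_cancel minus_add_cancel)
      ultimately show "a \<in> W" by (simp add: h mem_translate)
    qed
    then show ?thesis by blast
  qed
  show ?thesis using assms * by metis
qed

lemma subgrp_cosets: "K \<in> cosets K"
  unfolding cosets_def by (metis translate_zero rangeI)

lemma cosets_nonempty: "subgrp K \<Longrightarrow> Y \<in> cosets K \<Longrightarrow> Y \<noteq> {}"
  by (auto simp: cosets_def translate_def subgrp_def)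

lemma coset_zero: "subgrp K \<Longrightarrow> Y \<in> cosets K \<Longrightarrow> 0 \<in> Y \<Longrightarrow> Y = K"
  using cosets_disjoint subgrp_cosets by (metis subgrp_def)

lemma subgrp_core: "subgrp K \<Longrightarrow> K \<in> core K"
  by (simp add: core_def subgrp_cosets) (simp add: subgrp_def)

lemma coset_diff:
  assumes "subgrp K" "Y \<in> cosets K" "a \<in> Y" "b \<in> Y"
  shows "- a + b \<in> K"
proof -
  obtain h where "Y = translate h K" using assms by (auto simp: cosets_def)
  then have "- h + a \<in> K" "- h + b \<in> K" using assms by (auto simp: mem_translate)
  then have "- (- h + a) + (- h + b) \<in> K" using assms(1) by (auto simp: subgrp_def)
  moreover have "- (- h + a) + (- h + b) = - a + b"
    by (simp only: minus_add add.assoc add_minus_cancel minus_minus)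
  ultimately show ?thesis by simp
qed

lemma branch_cases:
  obtains "g = 0" | x where "g \<in> branch x"
  by (auto simp: branch_def)

lemma branch_unique: "g \<in> branch x \<Longrightarrow> g \<in> branch y \<Longrightarrow> x = y"
  by (auto simp: branch_def)

section \<open>Walks in reduced graphs\<close>

lemma transition_bar: "transition G p (bar x) q \<longleftrightarrow> transition G q x p"
  by (cases x) auto

lemma walk_append: "walk G p (u @ v) q \<longleftrightarrow> (\<exists>m. walk G p u m \<and> walk G m v q)"
  by (induction u arbitrary: p) auto

lemma walk_inv_word: "walk G p (inv_word w) q \<longleftrightarrow> walk G q w p"
proof (induction w arbitrary: p q)
  case (Cons x w)
  then show ?case by (auto simp: walk_append transition_bar)
qed auto

locale reduced_graph =
  fixes G :: "'a agraph"
  assumes reduced: "reduced_agraph G"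
begin

lemma transition_det: "transition G p x q \<Longrightarrow> transition G p x q' \<Longrightarrow> q = q'"
  using reduced unfolding reduced_agraph_def
  by (cases "(G, p, x, q)" rule: transition.cases) (simp split: if_splits, blast+)

lemma walk_det: "walk G p w q \<Longrightarrow> walk G p w q' \<Longrightarrow> q = q'"
  by (induction w arbitrary: p) (auto dest: transition_det)

text \<open>After \<open>x\<close>, determinism forces a step \<open>bar x\<close> to return to the
  starting vertex, so cancelling the pair does not move the endpoint.\<close>

lemma walk_push: "walk G p (x # w) q \<Longrightarrow> walk G p (push x w) q"
proof (cases w)
  case (Cons y v)
  assume "walk G p (x # w) q"
  then obtain m n where *: "transition G p x m" "transition G m y n" "walk G n v q"
    using Cons by auto
  show ?thesis
  proof (cases "y = bar x")
    case True
    then have "transition G m y p" using *(1) transition_bar by metis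
    then have "n = p" using *(2) transition_det by blast
    then show ?thesis using * True Cons by simp
  qed (use * Cons in auto)
qed simp

lemma walk_reduce: "walk G p w q \<Longrightarrow> walk G p (reduce w) q"
proof (induction w arbitrary: p)
  case (Cons x w)
  then obtain m where "transition G p x m" "walk G m (reduce w) q" by auto
  then have "walk G p (x # reduce w) q" by auto
  then have "walk G p (push x (reduce w)) q" by (rule walk_push)
  then show ?case by (simp add: reduce_def)
qed (simp add: reduce_def)

definition path :: "nat \<Rightarrow> 'a fg \<Rightarrow> nat \<Rightarrow> bool" where
  "path p g q \<longleftrightarrow> walk G p (rep g) q"

lemma path_zero [simp]: "path p 0 q \<longleftrightarrow> p = q"
  by (simp add: path_def)

lemma path_plus: "path p g q \<Longrightarrow> path q h r \<Longrightarrow> path p (g + h) r"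
  unfolding path_def rep_plus by (rule walk_reduce) (auto simp: walk_append)

lemma path_uminus: "path p g q \<Longrightarrow> path q (- g) p"
  by (simp add: path_def rep_uminus walk_inv_word)

lemma path_det: "path p g q \<Longrightarrow> path p g q' \<Longrightarrow> q = q'"
  unfolding path_def by (rule walk_det)

lemma path_exists: "p \<in> verts G \<Longrightarrow> q \<in> verts G \<Longrightarrow> \<exists>g. path p g q"
  using reduced unfolding reduced_agraph_def path_def by (metis rep_el walk_reduce)

lemma transition_verts:
  assumes "transition G p x q"
  shows "p \<in> verts G \<and> q \<in> verts G"
proof -
  have "p \<in> verts G \<and> q \<in> verts G" if "(p, a, q) \<in> edges G" for p a q
    using that reduced unfolding reduced_agraph_def is_agraph_def by blast
  moreover obtain a b where "x = (a, b)" by (cases x)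
  ultimately show ?thesis using assms by (cases b) auto
qed

lemma walk_verts: "walk G p w q \<Longrightarrow> p \<in> verts G \<Longrightarrow> q \<in> verts G"
  by (induction w arbitrary: p) (auto dest: transition_verts)

text \<open>In a reduced graph one direction accounts for at most one edge-end, and a loop supplies
  two opposite directions. So two edge-ends give a direction other than \<open>y\<close>.\<close>

lemma other_transition:
  assumes "2 \<le> valency G p"
  shows "\<exists>z q. z \<noteq> y \<and> transition G p z q"
proof (rule ccontr)
  assume "\<not> ?thesis"
  then have only: "z = y" if "transition G p z q" for z q using that by blast
  define Out In where "Out = {(p', a, q) \<in> edges G. p' = p}" and "In = {(q, a, p') \<in> edges G. p' = p}"
  obtain a b where y: "y = (a, b)" by (cases y)
  have o: "(a', True) = y" if "(p, a', q) \<in> edges G" for a' q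
    using only[of "(a', True)" q] that by simp
  have i: "(a', False) = y" if "(q, a', p) \<in> edges G" for a' q
    using only[of "(a', False)" q] that by simp
  have det: "(p, a, q) \<in> edges G \<Longrightarrow> (p, a, q') \<in> edges G \<Longrightarrow> q = q'"
    "(q, a, p) \<in> edges G \<Longrightarrow> (q', a, p) \<in> edges G \<Longrightarrow> q = q'" for q q'
    using reduced unfolding reduced_agraph_def by blast+
  have fin: "finite Out" "finite In"
    by (rule finite_subset[of _ "edges G"];
      use reduced in \<open>auto simp: reduced_agraph_def is_agraph_def Out_def In_def\<close>)+
  have Out: "\<exists>q. e = (p, a, q) \<and> (p, a, q) \<in> edges G \<and> b" if "e \<in> Out" for e
    using that o y by (cases e) (auto simp: Out_def)
  have In: "\<exists>q. e = (q, a, p) \<and> (q, a, p) \<in> edges G \<and> \<not> b" if "e \<in> In" for e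
    using that i y by (cases e) (auto simp: In_def)
  have "\<forall>e\<in>Out. \<forall>e'\<in>Out. e = e'"
    using Out det(1) by metis
  moreover have "\<forall>e\<in>In. \<forall>e'\<in>In. e = e'"
    using In det(2) by metis
  ultimately have "card Out \<le> 1" "card In \<le> 1"
    using fin by (simp_all add: card_le_Suc0_iff_eq)
  moreover have "Out = {} \<or> In = {}" using Out In by blast
  ultimately have "card Out + card In \<le> 1" by auto
  with assms show False by (simp add: valency_def Out_def In_def)
qed

end

locale stallings = reduced_graph +
  fixes K :: "'a fg set" and v0 :: nat
  assumes K: "subgrp K" and stal: "stallings_graph (rep ` K) G v0"
begin

lemma v0: "v0 \<in> verts G"
  using stal by (simp add: stallings_graph_def)

lemma mem_K: "g \<in> K \<longleftrightarrow> path v0 g v0"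
proof -
  have "rep ` K = {w. reduced_word w \<and> walk G v0 w v0}" using stal by (simp add: stallings_graph_def)
  moreover have "g \<in> K \<longleftrightarrow> rep g \<in> rep ` K" by (auto simp: rep_inject)
  ultimately show ?thesis by (simp add: path_def)
qed

text \<open>This is the coset that corresponds to \<open>p\<close>: the subgroup as it appears when
  the Cayley tree is based at \<open>p\<close>.\<close>

definition view :: "nat \<Rightarrow> 'a fg set" where
  "view p = {g. path p g v0}"

lemma view_eq: "path p g v0 \<Longrightarrow> view p = translate g K"
proof -
  assume g: "path p g v0"
  have "h \<in> view p \<longleftrightarrow> - g + h \<in> K" for h
  proof
    assume "h \<in> view p"
    then show "- g + h \<in> K" using path_plus[OF path_uminus[OF g]] by (simp add: view_def mem_K)
  next
    assume "- g + h \<in> K"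
    then have "path p (g + (- g + h)) v0" by (intro path_plus[OF g]) (simp add: mem_K)
    then show "h \<in> view p" by (simp add: view_def flip: add.assoc)
  qed
  note * = this
  show ?thesis by (rule Set.set_eqI) (simp only: mem_translate *)
qed

lemma view_cosets: "p \<in> verts G \<Longrightarrow> view p \<in> cosets K"
  using path_exists[OF _ v0, of p] view_eq by (auto simp: cosets_def)

lemma inj_view: "inj_on view (verts G)"
proof
  fix p q assume pq: "p \<in> verts G" "q \<in> verts G" "view p = view q"
  obtain g where "path p g v0" using path_exists[OF pq(1) v0] by blast
  then have "path q g v0" using pq by (auto simp: view_def)
  then show "p = q" using \<open>path p g v0\<close> path_uminus path_det by blast
qed

lemma path_Cons:
  assumes "transition G p z q" "path q h v0" "h \<notin> branch (bar z)"
  shows "path p (gen z + h) v0" "gen z + h \<in> branch z"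
proof -
  show "path p (gen z + h) v0"
    using assms by (intro path_plus) (auto simp: path_def)
  have "rep (gen z + h) = z # rep h"
    using assms(3) unfolding rep_gen_plus push_conv mem_branch by (metis list.exhaust_sel)
  then show "gen z + h \<in> branch z" by (simp add: mem_branch)
qed

text \<open>At a vertex outside the core all reduced walks to \<open>v0\<close> start with the same
  letter. Valency 2 offers a neighbour in another direction, which is again outside the core and
  farther from \<open>v0\<close>; a farthest such vertex is therefore impossible.\<close>

lemma view_core: "p \<in> verts G \<Longrightarrow> view p \<in> core K"
proof (rule ccontr)
  assume p: "p \<in> verts G" "view p \<notin> core K"
  define dist where "dist p = (LEAST n. \<exists>g. path p g v0 \<and> length (rep g) = n)" for p
  define Bad where "Bad = {p \<in> verts G. view p \<notin> core K}"
  have "finite (dist ` Bad)" "dist ` Bad \<noteq> {}"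
    using reduced p by (auto simp: Bad_def reduced_agraph_def is_agraph_def)
  then have "Max (dist ` Bad) \<in> dist ` Bad" "\<And>q. q \<in> Bad \<Longrightarrow> dist q \<le> Max (dist ` Bad)"
    by (simp_all add: Max_in)
  then obtain p where p: "p \<in> Bad" and max: "\<And>q. q \<in> Bad \<Longrightarrow> dist q \<le> dist p"
    by (elim imageE) metis
  have pv: "p \<in> verts G" and nh: "view p \<notin> core K" using p by (auto simp: Bad_def)
  have shortest: "\<exists>g. path q g v0 \<and> length (rep g) = dist q" if "q \<in> verts G" for q
    unfolding dist_def by (rule LeastI_ex) (use path_exists[OF that v0] in auto)
  have le: "dist q \<le> length (rep g)" if "path q g v0" for q g
    unfolding dist_def by (rule Least_le) (use that in auto)
  have "p \<noteq> v0" using nh subgrp_core[OF K] view_eq[of v0 0] by auto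
  obtain g where g: "path p g v0" "length (rep g) = dist p" using shortest[OF pv] by blast
  have "g \<noteq> 0" using g(1) \<open>p \<noteq> v0\<close> by auto
  then obtain y where y: "g \<in> branch y" using branch_cases by metis
  have only: "z = y" if "path p h v0" "h \<in> branch z" for h z
    using nh that y g(1) view_cosets[OF pv] unfolding core_def view_def by blast
  have "2 \<le> valency G p" using stal pv \<open>p \<noteq> v0\<close> by (auto simp: stallings_graph_def)
  then obtain z q where z: "z \<noteq> y" "transition G p z q" using other_transition by blast
  have qv: "q \<in> verts G" using transition_verts z by blast
  \<comment> \<open>A walk from \<open>q\<close> to \<open>v0\<close> that does not return through
    the edge just used would extend to a reduced walk from \<open>p\<close> starting with
    \<open>z\<close>.\<close>
  have behind: "h \<in> branch (bar z)" if "path q h v0" for h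
    using path_Cons[OF z(2) that] only z(1) by blast
  then have "view q \<notin> core K"
    unfolding core_def view_def using branch_unique zero_notin_branches(2) by blast
  then have "q \<in> Bad" using qv by (simp add: Bad_def)
  obtain h where h: "path q h v0" "length (rep h) = dist q" using shortest[OF qv] by blast
  obtain w where w: "rep h = bar z # w" using behind[OF h(1)] by (auto simp: mem_branch)
  have "transition G q (bar z) p" using z(2) by (simp add: transition_bar)
  then have "walk G p w v0" using h(1) transition_det unfolding path_def w walk.simps by metis
  moreover have "reduced_word w" using reduced_rep[of h] w by (simp add: reduced_Cons)
  ultimately have "path p (el w) v0" "length (rep (el w)) < dist q"
    using h(2) w by (simp_all add: path_def rep_el_reduced)
  then have "dist p < dist q" using le by fastforce
  then show False using max[OF \<open>q \<in> Bad\<close>] by simp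
qed

text \<open>For surjectivity, two elements \<open>a\<close> and \<open>b\<close> of a core coset
  with different first letters give the reduced loop spelled by the inverse of \<open>a\<close>
  followed by \<open>b\<close>. The vertex in its middle has the given coset as its view.\<close>

lemma bij_view: "bij_betw view (verts G) (core K)"
proof -
  have "Y \<in> view ` verts G" if Y: "Y \<in> core K" for Y
  proof (cases "0 \<in> Y")
    case True
    then have "Y = K" using Y K coset_zero by (auto simp: core_def)
    then show ?thesis using view_eq[of v0 0] v0 by auto
  next
    case False
    then obtain x y a b where ab: "x \<noteq> y" "a \<in> Y" "a \<in> branch x" "b \<in> Y" "b \<in> branch y"
      and Yc: "Y \<in> cosets K" using Y unfolding core_def by blast
    then have "- a + b \<in> K" using coset_diff[OF K] by blast
    moreover have "rep (- a + b) = inv_word (rep a) @ rep b"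
    proof -
      have "reduced_word (inv_word (rep a) @ rep b)"
        unfolding reduced_append using ab by (auto simp: branch_def last_inv_word)
      then show ?thesis using rep_plus_reduced[of "- a" b] by (simp add: rep_uminus)
    qed
    ultimately obtain p where p: "walk G v0 (inv_word (rep a)) p" "path p b v0"
      by (auto simp: mem_K path_def walk_append)
    then have pv: "p \<in> verts G" using walk_verts v0 by blast
    moreover have "b \<in> view p" using p by (simp add: view_def)
    then have "view p = Y" using cosets_disjoint[OF K view_cosets[OF pv] Yc] ab by blast
    ultimately show ?thesis by blast
  qed
  then show ?thesis using inj_view view_core by (auto simp: bij_betw_def)
qed

end

section \<open>Construction of the Stallings graph from cosets\<close>

definition active :: "'a fg set \<Rightarrow> 'a letter \<Rightarrow> bool" where
  "active Y x \<longleftrightarrow> Y \<inter> branch x \<noteq> {} \<and> Y - branch x \<noteq> {}"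

text \<open>The coset as seen from the neighbour in direction \<open>x\<close>, that is, the
  endpoint of the \<open>x\<close>-transition from \<open>Y\<close>.\<close>

abbreviation step :: "'a letter \<Rightarrow> 'a fg set \<Rightarrow> 'a fg set" where
  "step x Y \<equiv> translate (- gen x) Y"

lemma step_step [simp]: "step (bar x) (step x Y) = Y" "step x (step (bar x) Y) = Y"
  by (simp_all add: gen_bar)

lemma branch_bar: "branch (bar x) = step x (- branch x)"
  by (simp add: Compl_branch)

lemma active_step: "active Y x \<Longrightarrow> active (step x Y) (bar x)"
proof -
  assume *: "active Y x"
  have "step x Y \<inter> branch (bar x) = step x (Y - branch x)"
    "step x Y - branch (bar x) = step x (Y \<inter> branch x)"
    unfolding branch_bar by (auto simp: mem_translate)
  then show ?thesis using * by (auto simp: active_def translate_def)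
qed

lemma active_core:
  assumes "Y \<in> cosets K" "active Y x"
  shows "Y \<in> core K"
proof -
  obtain g h where gh: "g \<in> Y" "g \<in> branch x" "h \<in> Y" "h \<notin> branch x"
    using assms(2) by (auto simp: active_def)
  show ?thesis
  proof (cases h rule: branch_cases)
    case 1
    then show ?thesis using gh assms(1) unfolding core_def by blast
  next
    case (2 y)
    then have "x \<noteq> y" "Y \<inter> branch x \<noteq> {}" "Y \<inter> branch y \<noteq> {}" using gh by auto
    then show ?thesis using assms(1) unfolding core_def by blast
  qed
qed

lemma active_core_step: "Y \<in> cosets K \<Longrightarrow> active Y x \<Longrightarrow> step x Y \<in> core K"
  by (rule active_core[OF _ active_step]) simp_all

text \<open>A core coset is never contained in one branch, so any branch that it meets gives an edge
  of the convex hull.\<close>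

lemma core_active:
  assumes "Y \<in> core K" "g \<in> Y" "g \<in> branch x"
  shows "active Y x"
proof -
  have "Y - branch x \<noteq> {}"
  proof (cases "0 \<in> Y")
    case True
    then have "0 \<in> Y - branch x" by simp
    then show ?thesis by blast
  next
    case False
    then obtain y z a b where "y \<noteq> z" "a \<in> Y" "a \<in> branch y" "b \<in> Y" "b \<in> branch z"
      using assms(1) unfolding core_def by blast
    then have "a \<in> Y - branch x \<or> b \<in> Y - branch x" using branch_unique by (metis DiffI)
    then show ?thesis by blast
  qed
  then show ?thesis using assms by (auto simp: active_def)
qed

lemma valency_ge_2:
  assumes "finite (edges G)" "transition G p x q" "transition G p y q'" "x \<noteq> y"
  shows "2 \<le> valency G p"
proof -
  define Out In where "Out = {(p', a, q) \<in> edges G. p' = p}" and "In = {(q, a, p') \<in> edges G. p' = p}"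
  have fin: "finite Out" "finite In"
    by (rule finite_subset[of _ "edges G"]; use assms(1) in \<open>auto simp: Out_def In_def\<close>)+
  obtain a b a' b' where xy: "x = (a, b)" "y = (a', b')" by (cases x, cases y)
  have two: "2 \<le> card S" if "e \<in> S" "e' \<in> S" "e \<noteq> e'" "finite S" for S and e e' :: "nat \<times> 'a \<times> nat"
    using card_mono[OF that(4), of "{e, e'}"] that by simp
  have one: "1 \<le> card S" if "e \<in> S" "finite S" for S and e :: "nat \<times> 'a \<times> nat"
    using that by (metis One_nat_def Suc_leI card_gt_0_iff empty_iff)
  consider "b" "b'" | "b" "\<not> b'" | "\<not> b" "b'" | "\<not> b" "\<not> b'" by blast
  then have "2 \<le> card Out + card In"
  proof cases
    case 1
    then show ?thesis using assms xy fin two[of "(p, a, q)" Out "(p, a', q')"] by (auto simp: Out_def)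
  next
    case 2
    then show ?thesis using assms xy fin one[of "(p, a, q)" Out] one[of "(q', a', p)" In]
      by (auto simp: Out_def In_def)
  next
    case 3
    then show ?thesis using assms xy fin one[of "(p, a', q')" Out] one[of "(q, a, p)" In]
      by (auto simp: Out_def In_def)
  next
    case 4
    then show ?thesis using assms xy fin two[of "(q, a, p)" In "(q', a', p)"] by (auto simp: In_def)
  qed
  then show ?thesis by (simp add: valency_def Out_def In_def)
qed

text \<open>The Schreier graph of cosets is restricted to the edges with \<open>active Y x\<close>,
  those having elements of the coset on both sides. The injection \<open>f\<close> only names core
  cosets by natural numbers.\<close>

lemma stallings_graph_exists:
  fixes K :: "'a::finite fg set"
  assumes K: "subgrp K" and fin: "finite (core K)"
  shows "\<exists>G v0. stallings_graph (rep ` K) G v0"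
proof -
  obtain f :: "'a fg set \<Rightarrow> nat" where inj: "inj_on f (core K)"
    using finite_imp_inj_to_nat_seg[OF fin] by blast
  define E where "E = {(Y, a). Y \<in> cosets K \<and> active Y (a, True)}"
  define G where "G = \<lparr>verts = f ` core K,
     edges = (\<lambda>(Y, a). (f Y, a, f (step (a, True) Y))) ` E\<rparr>"
  have Esub: "E \<subseteq> core K \<times> UNIV" unfolding E_def using active_core by blast
  then have finE: "finite E" using fin finite_subset by (metis finite_SigmaI finite)
  have edge: "(p, a, q) \<in> edges G \<longleftrightarrow>
      (\<exists>Y\<in>cosets K. active Y (a, True) \<and> p = f Y \<and> q = f (step (a, True) Y))" for p a q
    by (auto simp: G_def E_def)
  have trans: "transition G p x q \<longleftrightarrow>
      (\<exists>Y\<in>cosets K. active Y x \<and> p = f Y \<and> q = f (step x Y))" for p x q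
  proof (cases x)
    case (Pair a b)
    show ?thesis
    proof (cases b)
      case True
      then show ?thesis using Pair edge by simp
    next
      case False
      have x: "bar x = (a, True)" "x = bar (a, True)" using Pair False by simp_all
      have "transition G p x q \<longleftrightarrow> (\<exists>Z\<in>cosets K. active Z (bar x) \<and> q = f Z \<and> p = f (step (bar x) Z))"
        using edge Pair False unfolding x(1) by simp
      also have "\<dots> \<longleftrightarrow> (\<exists>Y\<in>cosets K. active Y x \<and> p = f Y \<and> q = f (step x Y))"
      proof
        assume "\<exists>Z\<in>cosets K. active Z (bar x) \<and> q = f Z \<and> p = f (step (bar x) Z)"
        then obtain Z where "Z \<in> cosets K" "active Z (bar x)" "q = f Z" "p = f (step (bar x) Z)" by blast
        moreover from this have "active (step (bar x) Z) x" using active_step[of Z "bar x"] by simp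
        moreover have "step x (step (bar x) Z) = Z" by (rule step_step)
        moreover have "step (bar x) Z \<in> cosets K" using \<open>Z \<in> cosets K\<close> by (rule translate_cosets[THEN iffD2])
        ultimately show "\<exists>Y\<in>cosets K. active Y x \<and> p = f Y \<and> q = f (step x Y)" by metis
      next
        assume "\<exists>Y\<in>cosets K. active Y x \<and> p = f Y \<and> q = f (step x Y)"
        then obtain Y where "Y \<in> cosets K" "active Y x" "p = f Y" "q = f (step x Y)" by blast
        moreover from this have "active (step x Y) (bar x)" using active_step[of Y x] by simp
        moreover have "step (bar x) (step x Y) = Y" by (rule step_step)
        moreover have "step x Y \<in> cosets K" using \<open>Y \<in> cosets K\<close> by (rule translate_cosets[THEN iffD2])
        ultimately show "\<exists>Z\<in>cosets K. active Z (bar x) \<and> q = f Z \<and> p = f (step (bar x) Z)" by metis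
      qed
      finally show ?thesis .
    qed
  qed
  \<comment> \<open>The letters of an element of \<open>Y\<close> spell active edges: the first
    letter names a branch met by \<open>Y\<close>, and the remaining word lies in the next core
    coset.\<close>
  have walk_to: "walk G (f Y) (rep g) (f K)" if "Y \<in> core K" "g \<in> Y" for Y g
    using that
  proof (induction "rep g" arbitrary: g Y)
    case Nil
    then have "0 \<in> Y" by (metis rep_eq_Nil)
    then have "Y = K" using Nil K coset_zero by (auto simp: core_def)
    then show ?case using Nil(1) by (simp flip: Nil(1))
  next
    case (Cons x w)
    have Yc: "Y \<in> cosets K" using Cons.prems by (simp add: core_def)
    have gx: "g \<in> branch x" using Cons(2)[symmetric] by (simp add: mem_branch)
    then have act: "active Y x" using core_active Cons.prems by blast
    have "reduced_word (x # w)" using reduced_rep[of g] Cons(2) by simp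
    then have rw: "reduced_word w" by (simp add: reduced_Cons)
    have "g = gen x + el w" using Cons(2) el_Cons by (metis el_rep)
    then have "- gen x + g = el w" by (simp flip: add.assoc)
    then have "el w \<in> step x Y" using Cons.prems(2) by (simp add: mem_translate) (metis add_minus_cancel)
    moreover have "step x Y \<in> core K" using active_core_step[OF Yc act] .
    ultimately have "walk G (f (step x Y)) w (f K)"
      using Cons(1)[of "el w" "step x Y"] rw by (simp add: rep_el_reduced)
    moreover have "transition G (f Y) x (f (step x Y))" using trans act Yc by blast
    ultimately show ?case using Cons(2) by (metis walk.simps(2))
  qed
  have walk_from: "q = f (translate (- el w) Y)" if "walk G (f Y) w q" "Y \<in> core K" for w Y q
    using that
  proof (induction w arbitrary: Y)
    case (Cons x w)
    then obtain m Z where Z: "Z \<in> cosets K" "active Z x" "f Y = f Z" "m = f (step x Z)" "walk G m w q"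
      using trans by auto
    then have "Z = Y" using inj Cons.prems(2) active_core by (metis inj_onD)
    have "q = f (translate (- el w) (step x Y))"
      using Cons.IH[of "step x Y"] Z active_core_step unfolding \<open>Z = Y\<close> by blast
    moreover have "- el w + - gen x = - el (x # w)" by (simp only: el_Cons[of x w] minus_add)
    ultimately show ?case by simp
  qed simp
  have conn: "\<exists>w. walk G p w q" if pq: "p \<in> verts G" "q \<in> verts G" for p q
  proof -
    have ex: "\<exists>w. walk G p w (f K)" if "p \<in> verts G" for p
    proof -
      obtain Y where "Y \<in> core K" "p = f Y" using \<open>p \<in> verts G\<close> by (auto simp: G_def)
      moreover from this obtain g where "g \<in> Y" using cosets_nonempty[OF K, of Y] by (auto simp: core_def)
      ultimately show ?thesis using walk_to by blast
    qed
    then obtain u v where "walk G p u (f K)" "walk G q v (f K)" using ex[OF pq(1)] ex[OF pq(2)] by blast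
    then have "walk G p (u @ inv_word v) q" by (auto simp: walk_append walk_inv_word)
    then show ?thesis by blast
  qed
  have "reduced_agraph G"
    unfolding reduced_agraph_def
  proof (intro conjI allI impI ballI)
    show "is_agraph G"
    proof -
      have "p \<in> verts G \<and> q \<in> verts G" if "(p, a, q) \<in> edges G" for p a q
      proof -
        have "verts G = f ` core K" by (simp add: G_def)
        then show ?thesis using that active_core active_core_step unfolding edge by blast
      qed
      moreover have "finite (verts G)" "finite (edges G)" using fin finE by (simp_all add: G_def)
      ultimately show ?thesis unfolding is_agraph_def by blast
    qed
    show "\<exists>w. walk G p w q" if "p \<in> verts G" "q \<in> verts G" for p q using conn that by blast
  next
    fix p a q q' assume *: "(p, a, q) \<in> edges G \<and> (p, a, q') \<in> edges G"
    then show "q = q'" unfolding edge using inj active_core by (metis inj_onD)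
  next
    fix p p' a q assume *: "(p, a, q) \<in> edges G \<and> (p', a, q) \<in> edges G"
    then obtain Y Z where YZ: "Y \<in> cosets K" "active Y (a, True)" "Z \<in> cosets K" "active Z (a, True)"
      "p = f Y" "p' = f Z" "f (step (a, True) Y) = f (step (a, True) Z)"
      unfolding edge by metis
    then have "step (a, True) Y = step (a, True) Z" using inj active_core_step by (metis inj_onD)
    then have "Y = Z" by (simp only: translate_eq_iff)
    then show "p = p'" using YZ by simp
  qed
  moreover have "f K \<in> verts G" using subgrp_core[OF K] by (simp add: G_def)
  moreover have "2 \<le> valency G v" if v: "v \<in> verts G" "v \<noteq> f K" for v
  proof -
    obtain Y where Y: "Y \<in> core K" "v = f Y" using v(1) by (auto simp: G_def)
    then have Yc: "Y \<in> cosets K" by (simp add: core_def)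
    have "0 \<notin> Y" using coset_zero[OF K Yc] v Y by auto
    then obtain x y a b where ab: "x \<noteq> y" "a \<in> Y" "a \<in> branch x" "b \<in> Y" "b \<in> branch y"
      using Y unfolding core_def by blast
    then have "active Y x" "active Y y" using core_active Y by blast+
    then have "transition G v x (f (step x Y))" "transition G v y (f (step y Y))"
      using Y Yc trans by blast+
    moreover have "finite (edges G)" using finE by (simp add: G_def)
    ultimately show ?thesis using valency_ge_2 ab(1) by blast
  qed
  moreover have "rep ` K = {w. reduced_word w \<and> walk G (f K) w (f K)}"
  proof -
    have "w \<in> rep ` K" if w: "reduced_word w" "walk G (f K) w (f K)" for w
    proof -
      have "f K = f (translate (- el w) K)" using walk_from[OF w(2) subgrp_core[OF K]] .
      moreover have "translate (- el w) K \<in> core K"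
      proof -
        have "Y \<in> core K \<Longrightarrow> walk G (f Y) w q \<Longrightarrow> translate (- el w) Y \<in> core K" for Y q w
        proof (induction w arbitrary: Y)
          case (Cons x w)
          then obtain m Z where Z: "Z \<in> cosets K" "active Z x" "f Y = f Z" "m = f (step x Z)" "walk G m w q"
            using trans by auto
          then have "Z = Y" using inj Cons.prems(1) active_core by (metis inj_onD)
          have "translate (- el w) (step x Y) \<in> core K"
            using Cons.IH[of "step x Y"] Z active_core_step unfolding \<open>Z = Y\<close> by blast
          moreover have "- el w + - gen x = - el (x # w)" by (simp only: el_Cons[of x w] minus_add)
          ultimately show ?case by simp
        qed simp
        then show ?thesis using subgrp_core[OF K] w(2) by blast
      qed
      ultimately have "K = translate (- el w) K" using inj subgrp_core[OF K] by (metis inj_onD)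
      then have "0 \<in> translate (- el w) K" using K by (simp add: subgrp_def)
      then have "el w \<in> K" by (simp add: mem_translate)
      then show ?thesis using rep_el_reduced[OF w(1)] by (metis imageI)
    qed
    moreover have "walk G (f K) (rep g) (f K)" if "g \<in> K" for g
      using walk_to[OF subgrp_core[OF K] that] .
    ultimately show ?thesis by auto
  qed
  ultimately have "stallings_graph (rep ` K) G (f K)" by (auto simp: stallings_graph_def)
  then show ?thesis by blast
qed

text \<open>The bijection with the core is available for every Stallings graph of \<open>K\<close>,
  so it gives the uniqueness demanded by the definite description as well as the value.\<close>

theorem subgroup_size_eq:
  fixes K :: "'a::finite fg set"
  assumes K: "subgrp K" and fin: "finite (core K)"
  shows "subgroup_size (rep ` K) = card (core K)"
  unfolding subgroup_size_def
proof (rule the_equality)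
  have card: "card (verts G) = card (core K)" if "stallings_graph (rep ` K) G v0" for G v0
  proof -
    interpret stallings G K v0
      using K that by unfold_locales (auto simp: stallings_graph_def)
    show ?thesis using bij_view by (rule bij_betw_same_card)
  qed
  then show "\<exists>G v0. stallings_graph (rep ` K) G v0 \<and> card (core K) = card (verts G)"
    using stallings_graph_exists[OF K fin] by metis
  show "n = card (core K)" if "\<exists>G v0. stallings_graph (rep ` K) G v0 \<and> n = card (verts G)" for n
    using that card by blast
qed

section \<open>Finitely generated subgroups\<close>

text \<open>Closure under right multiplication by single generators presents each element as a walk,
  which is the form needed to find a generator step that crosses the boundary of a set.\<close>

inductive_set generated :: "'a fg set \<Rightarrow> 'a fg set" for B where
  zero: "0 \<in> generated B"
| plus: "h \<in> generated B \<Longrightarrow> b \<in> B \<Longrightarrow> h + b \<in> generated B"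
| minus: "h \<in> generated B \<Longrightarrow> b \<in> B \<Longrightarrow> h + - b \<in> generated B"

lemma generated_add: "h \<in> generated B \<Longrightarrow> g \<in> generated B \<Longrightarrow> g + h \<in> generated B"
proof (induction rule: generated.induct)
  case (plus h b)
  then show ?case using generated.plus[of "g + h" B b] by (simp add: add.assoc)
next
  case (minus h b)
  then show ?case using generated.minus[of "g + h" B b] by (simp only: add.assoc)
qed simp

lemma generated_base: "b \<in> B \<Longrightarrow> b \<in> generated B" "b \<in> B \<Longrightarrow> - b \<in> generated B"
  using generated.plus[OF generated.zero] generated.minus[OF generated.zero] by force+

lemma generated_uminus: "h \<in> generated B \<Longrightarrow> - h \<in> generated B"
proof (induction rule: generated.induct)
  case (plus h b)
  then show ?case using generated_add[of "- h" B "- b"] generated_base(2)[of b B] by (simp only: minus_add)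
next
  case (minus h b)
  then show ?case using generated_add[of "- h" B b] generated_base(1)[of b B] by (simp only: minus_add minus_minus)
qed (simp add: generated.zero)

lemma subgrp_generated: "subgrp (generated B)"
  by (simp add: subgrp_def generated.zero generated_add generated_uminus)

lemma coset_eq_translate: "subgrp K \<Longrightarrow> Y \<in> cosets K \<Longrightarrow> z \<in> Y \<Longrightarrow> Y = translate z K"
  by (rule cosets_disjoint[of K _ _ z]) (auto simp: cosets_def mem_translate subgrp_def)

lemma coset_add:
  assumes "subgrp K" "Y \<in> cosets K" "z \<in> Y" "s \<in> K"
  shows "z + s \<in> Y"
  using coset_eq_translate[OF assms(1-3)] assms(4) by (simp add: mem_translate flip: add.assoc)

text \<open>Any two elements of a coset are joined by right multiplications with generators and
  their inverses; a walk from inside \<open>U\<close> to outside must change sides at one of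
  them.\<close>

lemma coset_crossing:
  assumes Y: "Y \<in> cosets (generated B)" and "Y \<inter> U \<noteq> {}" "Y - U \<noteq> {}"
  shows "\<exists>z\<in>Y. \<exists>b\<in>B. (z \<in> U) \<noteq> (z + b \<in> U)"
proof (rule ccontr)
  assume neg: "\<not> ?thesis"
  obtain g h where gh: "g \<in> Y" "g \<in> U" "h \<in> Y" "h \<notin> U" using assms by blast
  have "g + s \<in> U" if "s \<in> generated B" for s
    using that
  proof (induction rule: generated.induct)
    case (plus s b)
    have "g + s \<in> Y" using coset_add[OF subgrp_generated Y gh(1) plus(1)] .
    then have "g + s + b \<in> U" using plus neg by blast
    then show ?case by (simp only: add.assoc)
  next
    case (minus s b)
    have "g + (s + - b) \<in> Y"
      using coset_add[OF subgrp_generated Y gh(1)] generated.minus[OF minus(1,2)] by blast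
    moreover have "g + (s + - b) + b = g + s" by (simp add: add.assoc)
    ultimately show ?case using minus neg by metis
  qed (simp add: gh)
  moreover have "- g + h \<in> generated B" using coset_diff[OF subgrp_generated Y] gh by blast
  ultimately have "g + (- g + h) \<in> U" by blast
  then show False using gh by simp
qed

text \<open>For \<open>U = branch x\<close> these are the sources of all \<open>x\<close>-edges of
  the Stallings graph, including those on a tail at the distinguished vertex, which
  \<open>Split\<close> does not count.\<close>

definition crossing :: "'a fg set \<Rightarrow> 'a fg set \<Rightarrow> 'a fg set set" where
  "crossing K U = {Y \<in> cosets K. Y \<inter> U \<noteq> {} \<and> Y - U \<noteq> {}}"

lemma Split_subset_crossing: "Split K U \<subseteq> crossing K U"
  unfolding Split_def crossing_def using finite.emptyI by fastforce

text \<open>A crossing coset contains an element at which some generator changes sides, and any one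
  of its elements determines the coset. Only finitely many such elements exist.\<close>

lemma finite_crossing:
  assumes "finite B" "almost_invariant U"
  shows "finite (crossing (generated B) U)"
proof -
  have "crossing (generated B) U \<subseteq>
      (\<lambda>z. translate z (generated B)) ` (\<Union>b\<in>B. {z. (z \<in> U) \<noteq> (z + b \<in> U)})"
  proof
    fix Y assume "Y \<in> crossing (generated B) U"
    then have Y: "Y \<in> cosets (generated B)" "Y \<inter> U \<noteq> {}" "Y - U \<noteq> {}" by (auto simp: crossing_def)
    then obtain z b where "z \<in> Y" "b \<in> B" "(z \<in> U) \<noteq> (z + b \<in> U)" using coset_crossing by blast
    moreover from this have "Y = translate z (generated B)"
      using coset_eq_translate[OF subgrp_generated Y(1)] by blast
    ultimately show "Y \<in> (\<lambda>z. translate z (generated B)) ` (\<Union>b\<in>B. {z. (z \<in> U) \<noteq> (z + b \<in> U)})"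
      by blast
  qed
  moreover have "finite (\<Union>b\<in>B. {z. (z \<in> U) \<noteq> (z + b \<in> U)})"
    using assms by (auto simp: almost_invariant_def)
  ultimately show ?thesis by (meson finite_imageI finite_subset)
qed

lemma finite_Split: "finite B \<Longrightarrow> almost_invariant U \<Longrightarrow> finite (Split (generated B) U)"
  using Split_subset_crossing finite_crossing finite_subset by blast

lemma core_subset_crossing: "subgrp K \<Longrightarrow> core K \<subseteq> insert K (\<Union>x. crossing K (branch x))"
proof
  fix Y assume K: "subgrp K" and Y: "Y \<in> core K"
  show "Y \<in> insert K (\<Union>x. crossing K (branch x))"
  proof (cases "0 \<in> Y")
    case True
    then show ?thesis using coset_zero[OF K] Y by (auto simp: core_def)
  next
    case False
    obtain g where "g \<in> Y" using cosets_nonempty[OF K] Y by (auto simp: core_def)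
    then obtain x where "g \<in> branch x" using False branch_cases by metis
    then have "active Y x" using core_active[OF Y \<open>g \<in> Y\<close>] by blast
    moreover have "Y \<in> cosets K" using Y by (simp add: core_def)
    ultimately show ?thesis unfolding active_def crossing_def by blast
  qed
qed

lemma finite_core:
  fixes B :: "'a::finite fg set"
  assumes "finite B"
  shows "finite (core (generated B))"
  using finite_subset[OF core_subset_crossing[OF subgrp_generated]] finite_crossing[OF assms almost_invariant_branch]
  by (metis finite finite_UN_I finite_insert)

section \<open>Edges and vertices\<close>

text \<open>
  A set \<open>c\<close> of edges of the Stallings graph is viewed as a cochain with values in \<open>bool\<close>, added by
  exclusive or; \<open>chi c Y w\<close> is the value of \<open>c\<close> on the path labelled \<open>w\<close> starting at \<open>Y\<close>.
\<close>

definition edge_val :: "('a \<times> 'a fg set) set \<Rightarrow> 'a fg set \<Rightarrow> 'a letter \<Rightarrow> bool" where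
  "edge_val c Y x = (if snd x then (fst x, Y) \<in> c else (fst x, step x Y) \<in> c)"

fun chi :: "('a \<times> 'a fg set) set \<Rightarrow> 'a fg set \<Rightarrow> 'a word \<Rightarrow> bool" where
  "chi c Y [] = False"
| "chi c Y (x # w) = (edge_val c Y x \<noteq> chi c (step x Y) w)"

lemma edge_val_bar: "edge_val c (step x Y) (bar x) = edge_val c Y x"
proof -
  have "fst (bar x) = fst x" "snd (bar x) = (\<not> snd x)" by (cases x, simp)+
  then show ?thesis unfolding edge_val_def by (metis step_step(1))
qed

text \<open>A step and its reversal use the same edge, and its value cancels under exclusive or.
  Hence \<open>chi\<close> depends only on the group element spelled by the word.\<close>

lemma chi_push: "chi c Y (push x w) = chi c Y (x # w)"
proof (cases w)
  case (Cons y v)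
  show ?thesis
  proof (cases "y = bar x")
    case True
    then have "chi c Y (x # w) = (edge_val c Y x \<noteq> (edge_val c (step x Y) (bar x) \<noteq> chi c (step (bar x) (step x Y)) v))"
      using Cons by simp
    also have "\<dots> = chi c Y v" unfolding edge_val_bar step_step by blast
    finally show ?thesis using True Cons by simp
  qed (use Cons in simp)
qed simp

lemma chi_reduce: "chi c Y (reduce w) = chi c Y w"
proof (induction w arbitrary: Y)
  case (Cons x w)
  have "reduce (x # w) = push x (reduce w)" by (simp add: reduce_def)
  then show ?case using Cons by (simp add: chi_push)
qed (simp add: reduce_def)

lemma chi_append: "chi c Y (u @ v) = (chi c Y u \<noteq> chi c (translate (- el u) Y) v)"
proof (induction u arbitrary: Y)
  case (Cons x u)
  have "translate (- el u) (step x Y) = translate (- el (x # u)) Y"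
    unfolding translate_translate by (simp only: el_Cons[of x u] minus_add)
  then show ?case using Cons by auto
qed simp

definition chi_at :: "('a \<times> 'a fg set) set \<Rightarrow> 'a fg set \<Rightarrow> 'a fg \<Rightarrow> bool" where
  "chi_at c Y g = chi c Y (rep g)"

lemma chi_at_plus: "chi_at c Y (g + h) = (chi_at c Y g \<noteq> chi_at c (translate (- g) Y) h)"
  by (simp add: chi_at_def rep_plus chi_reduce chi_append)

lemma chi_at_gen: "chi_at c Y (gen x) = edge_val c Y x"
  by (simp add: chi_at_def)

lemma subgrp_translate: "subgrp K \<Longrightarrow> g \<in> K \<Longrightarrow> translate (- g) K = K"
  using coset_eq_translate[OF _ subgrp_cosets, of K "- g"] by (auto simp: subgrp_def)

text \<open>The rank of the fundamental group of a graph is at most the number of generators.\<close>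

lemma edges_le_verts:
  fixes B :: "'a::finite fg set"
  assumes B: "finite B"
  shows "(\<Sum>a\<in>UNIV. card (crossing (generated B) (branch (a, True)))) \<le> card (core (generated B)) + card B"
proof -
  define K where "K = generated B"
  have K: "subgrp K" unfolding K_def by (rule subgrp_generated)
  define E where "E = (SIGMA a:UNIV. crossing K (branch (a, True)))"
  have fincr: "finite (crossing K (branch x))" for x
    unfolding K_def using B almost_invariant_branch by (rule finite_crossing)
  have finE: "finite E" and cardE: "card E = (\<Sum>a\<in>UNIV. card (crossing K (branch (a, True))))"
    unfolding E_def using fincr by auto
  \<comment> \<open>\<open>u Y\<close> labels a chosen walk from the base coset \<open>K\<close> to
    \<open>Y\<close>.\<close>
  define u where "u Y = (SOME g. translate (- g) K = Y)" for Y
  have u: "translate (- u Y) K = Y" if "Y \<in> cosets K" for Y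
  proof -
    have "\<exists>g. translate (- g) K = Y" using that by (auto simp: cosets_def) (metis minus_minus)
    then show ?thesis unfolding u_def by (rule someI_ex)
  qed
  \<comment> \<open>A cochain is determined by its values on the generating loops and on one walk to
    each vertex. Counting subsets then replaces a dimension count over the field with two elements:
    there are at most as many cochains as pairs of subsets of \<open>B\<close> and of
    \<open>core K\<close>.\<close>
  define \<Phi> where "\<Phi> c = ({b \<in> B. chi_at c K b}, {Y \<in> core K. chi_at c K (u Y)})" for c
  have inj: "inj_on \<Phi> (Pow E)"
  proof
    fix c c' assume c: "c \<in> Pow E" "c' \<in> Pow E" and eq: "\<Phi> c = \<Phi> c'"
    have eqB: "chi_at c K b = chi_at c' K b" if "b \<in> B" for b
      using eq that unfolding \<Phi>_def by blast
    have eqV: "chi_at c K (u Y) = chi_at c' K (u Y)" if "Y \<in> core K" for Y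
      using eq that unfolding \<Phi>_def by blast
    \<comment> \<open>Elements of \<open>K\<close> label loops at the base coset, so evaluation is
      additive on them and generators suffice.\<close>
    have chiK: "chi_at d K (g + h) = (chi_at d K g \<noteq> chi_at d K h)" if "g \<in> K" for d g h
      unfolding chi_at_plus subgrp_translate[OF K that] ..
    have neg: "chi_at d K (- b) = chi_at d K b" if "b \<in> K" for d b
      using chiK[OF that, of d "- b"] by (simp add: chi_at_def[of _ _ 0])
    have eqK: "chi_at c K g = chi_at c' K g" if "g \<in> K" for g
      using that unfolding K_def
    proof (induction rule: generated.induct)
      case zero
      then show ?case by (simp add: chi_at_def)
    next
      case (plus h b)
      then show ?case using chiK[of h] eqB unfolding K_def by simp
    next
      case (minus h b)
      then show ?case
        using chiK[of h _ "- b"] neg[of b] eqB generated_base(1)[of b B] unfolding K_def by metis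
    qed
    have "(a, Y) \<in> c \<longleftrightarrow> (a, Y) \<in> c'" if aY: "(a, Y) \<in> E" for a Y
    proof -
      define x where "x = (a, True)"
      have Y: "Y \<in> cosets K" "active Y x"
        using aY unfolding E_def crossing_def active_def x_def by auto
      define Z where "Z = step x Y"
      have core: "Y \<in> core K" "Z \<in> core K"
        using active_core[OF Y] active_core_step[OF Y] by (simp_all add: Z_def)
      \<comment> \<open>The loop that reaches \<open>Y\<close>, crosses the edge in question and
        returns from \<open>Z\<close> along its chosen walk.\<close>
      define k where "k = u Y + gen x + - u Z"
      have Zc: "Z \<in> cosets K" using core by (simp add: core_def)
      have "translate (- k) K = translate (u Z + - gen x + - u Y) K"
        unfolding k_def by (simp only: minus_add minus_minus add.assoc)
      also have "\<dots> = translate (u Z) (translate (- gen x) (translate (- u Y) K))"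
        by (simp only: translate_translate add.assoc)
      also have "\<dots> = translate (u Z) (translate (- u Z) K)"
        unfolding u[OF Y(1)] Z_def[symmetric] u[OF Zc] ..
      also have "\<dots> = K" by (simp only: translate_translate right_minus translate_zero)
      finally have "0 \<in> translate (- k) K" using K by (simp add: subgrp_def)
      then have kK: "k \<in> K" by (simp add: mem_translate)
      have "k + u Z = u Y + gen x" by (simp add: k_def add.assoc)
      then have "(chi_at d K k \<noteq> chi_at d K (u Z)) = (chi_at d K (u Y) \<noteq> edge_val d Y x)" for d
        using chiK[OF kK, of d "u Z"] chi_at_plus[of d K "u Y" "gen x"] unfolding u[OF Y(1)] chi_at_gen
        by metis
      from this[of c] this[of c'] have "edge_val c Y x = edge_val c' Y x"
        using eqK[OF kK] eqV core by auto
      then show ?thesis by (simp add: edge_val_def x_def)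
    qed
    then show "c = c'" using c by auto
  qed
  have finC: "finite (core K)" unfolding K_def using B by (rule finite_core)
  have "card (Pow E) = card (\<Phi> ` Pow E)" using inj by (simp add: card_image)
  also have "\<dots> \<le> card (Pow B \<times> Pow (core K))"
    by (rule card_mono) (use B finC in \<open>auto simp: \<Phi>_def\<close>)
  finally have "2 ^ card E \<le> (2::nat) ^ (card B + card (core K))"
    using finE B finC by (simp add: card_Pow card_cartesian_product power_add)
  then have "card E \<le> card B + card (core K)" by simp
  then show ?thesis using cardE by (simp add: K_def)
qed

section \<open>Half-trees\<close>

lemma infinite_branch: "infinite (branch x)"
proof -
  have red: "reduced_word (replicate n x)" for n
    by (induction n) (auto simp: reduced_Cons)
  have "range (\<lambda>n. el (replicate (Suc n) x)) \<subseteq> branch x"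
    using mem_branch_rep red[of "Suc _"] unfolding replicate_Suc by blast
  moreover have "inj (\<lambda>n. el (replicate (Suc n) x))"
  proof
    fix m n assume "el (replicate (Suc m) x) = el (replicate (Suc n) x)"
    then have "rep (el (replicate (Suc m) x)) = rep (el (replicate (Suc n) x))" by (rule arg_cong)
    then have "replicate (Suc m) x = replicate (Suc n) x" unfolding rep_el_reduced[OF red] .
    then show "m = n" by (metis length_replicate nat.inject)
  qed
  ultimately show ?thesis by (meson finite_subset range_inj_infinite)
qed

lemma infinite_Compl_branch: "infinite (- branch x)"
  by (simp add: Compl_branch infinite_branch)

lemma infinite_subtree: "infinite (subtree v)"
proof (cases "v = 0")
  case True
  then show ?thesis using infinite_branch by (metis finite_subset subset_UNIV subtree_zero)
next
  case False
  then show ?thesis using subtree_eq_translate_branch infinite_branch finite_translate by metis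
qed

text \<open>A translated half-tree either is a half-tree at the root or points away from the root,
  hence is a subtree, or contains the root, hence is the complement of a subtree.\<close>

lemma half_tree_cases:
  obtains (zero) "g = 0"
  | (subtree) z w where "rep g = z # w" "translate g (branch y) = subtree (g + gen y)"
      "rep (g + gen y) = z # w @ [y]"
  | (Compl) z w where "rep g = z # w" "translate g (branch y) = - subtree g"
proof -
  have ?thesis if g: "rep g = z # w" for z w
  proof (cases "y \<in> children g")
    case True
    then show ?thesis using subtree[OF g] g translate_branch_subtree rep_child by fastforce
  next
    case False
    have "g \<noteq> 0" using g by auto
    then have y: "last (rep g) = bar y" using False unfolding children_def by auto
    define h where "h = g + gen y"
    have h: "rep h = butlast (rep g)" using y \<open>g \<noteq> 0\<close> by (simp add: h_def rep_plus_gen)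
    have "bar y \<in> children h"
    proof (cases "rep h" rule: rev_cases)
      case Nil
      then show ?thesis by (simp add: children_def)
    next
      case (snoc v s)
      then have "rep g = (v @ [s]) @ [bar y]"
        using h y g by (metis append_butlast_last_id list.distinct(1))
      then have "reduced_word ((v @ [s]) @ [bar y])" by (metis reduced_rep)
      then have "y \<noteq> s" unfolding reduced_append by auto
      then show ?thesis using snoc by (simp add: children_def)
    qed
    then have "translate h (branch (bar y)) = subtree (h + gen (bar y))"
      by (rule translate_branch_subtree)
    moreover have "h + gen (bar y) = g" by (simp add: h_def gen_bar add.assoc)
    moreover have "translate g (- branch y) = translate h (branch (bar y))"
      by (simp add: Compl_branch h_def)
    ultimately have "translate g (branch y) = - subtree g"
      by (metis double_compl translate_Compl)
    then show ?thesis using Compl g by blast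
  qed
  then show ?thesis using zero by (metis neq_Nil_conv rep_eq_Nil)
qed

lemma subtree_subset_branch: "rep g = z # w \<Longrightarrow> subtree g \<subseteq> branch z"
  by (auto simp: subtree_def mem_branch prefix_def)

lemma branch_disjoint: "x \<noteq> y \<Longrightarrow> branch x \<inter> branch y = {}"
  using branch_unique by blast

lemma half_tree_dichotomy:
  "(\<exists>z. translate g (branch y) \<subseteq> branch z) \<or> (\<exists>z. - branch z \<subseteq> translate g (branch y))"
proof (cases rule: half_tree_cases[where g = g and y = y])
  case zero
  then show ?thesis unfolding zero translate_zero by blast
next
  case (subtree z w)
  then show ?thesis using subtree_subset_branch[OF subtree(3)] by metis
next
  case (Compl z w)
  then show ?thesis using subtree_subset_branch[of g] by blast
qed

lemma third_letter:
  assumes "CARD('a::finite) \<ge> 2"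
  obtains w :: "'a::finite letter" where "w \<noteq> x" "w \<noteq> y"
proof -
  have "card {x, y} \<le> 2" by (simp add: card_insert_if)
  moreover have "card (UNIV :: 'a letter set) \<ge> 4" using assms by simp
  ultimately have "{x, y} \<noteq> UNIV" by fastforce
  then obtain w where "w \<notin> {x, y}" by blast
  then show ?thesis using that by blast
qed

text \<open>In rank at least 2 two different half-trees differ by a set containing a whole branch or
  subtree: a third letter always leads into the difference.\<close>

lemma half_tree_unique:
  assumes card: "CARD('a::finite) \<ge> 2" and eq: "branch x =* translate g (branch (y :: 'a::finite letter))"
  shows "g = 0 \<and> x = y"
proof (cases rule: half_tree_cases[where g = g and y = y])
  case zero
  have "x = y"
  proof (rule ccontr)
    assume "x \<noteq> y"
    then have "branch x - branch y = branch x" using branch_disjoint by blast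
    then show False using eq zero infinite_branch[of x] by (simp add: aeq_def)
  qed
  with zero show ?thesis by simp
next
  case (subtree z w)
  define B where "B = subtree (g + gen y)"
  have Bz: "B \<subseteq> branch z" unfolding B_def using subtree(3) by (intro subtree_subset_branch) simp
  have fin: "finite (branch x - B)" "finite (B - branch x)" using eq subtree by (auto simp: aeq_def B_def)
  show ?thesis
  proof (cases "z = x")
    case False
    then have "B - branch x = B" using Bz branch_disjoint by blast
    then show ?thesis using fin infinite_subtree unfolding B_def by metis
  next
    case True
    obtain s where s: "s \<noteq> bar x" "s \<noteq> hd (w @ [y])" using third_letter[OF card] by blast
    have "reduced_word [x, s]" using s by (simp add: reduced_Cons)
    then have r: "rep (el [x, s]) = [x, s]" by (rule rep_el_reduced)
    have "subtree (el [x, s]) \<inter> B = {}"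
    proof -
      have "False" if "prefix [x, s] (rep h)" "prefix (z # w @ [y]) (rep h)" for h
        using that s(2) by (cases w) (auto simp: prefix_def)
      then show ?thesis unfolding B_def subtree_def r subtree(3) by blast
    qed
    moreover have "subtree (el [x, s]) \<subseteq> branch x" using r by (rule subtree_subset_branch)
    ultimately have "subtree (el [x, s]) \<subseteq> branch x - B" by blast
    then show ?thesis using fin(1) infinite_subtree finite_subset by blast
  qed
next
  case (Compl z w)
  have fin: "finite (branch x \<inter> subtree g)" "finite (- branch x - subtree g)"
    using eq Compl by (auto simp: aeq_def Diff_eq Int_commute)
  have sub: "subtree g \<subseteq> branch z" using Compl(1) by (rule subtree_subset_branch)
  show ?thesis
  proof (cases "z = x")
    case True
    then have "branch x \<inter> subtree g = subtree g" using sub by blast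
    then show ?thesis using fin infinite_subtree by metis
  next
    case False
    obtain s where s: "s \<noteq> x" "s \<noteq> z" using third_letter[OF card] by blast
    then have "branch s \<subseteq> - branch x - subtree g" using sub branch_unique by blast
    then show ?thesis using fin infinite_branch finite_subset by blast
  qed
qed

section \<open>Images under automorphisms\<close>

text \<open>The vertices with at least two infinite directions, that is, the core without the tail
  at the distinguished vertex. Unlike \<open>core\<close>, this notion is insensitive to finite
  changes of the half-trees.\<close>

definition spread :: "'a fg set \<Rightarrow> 'a fg set set" where
  "spread K = {Y \<in> cosets K. \<exists>x y. x \<noteq> y \<and> infinite (Y \<inter> branch x) \<and> infinite (Y \<inter> branch y)}"

lemma spread_subset_core: "spread K \<subseteq> core K"
proof
  fix Y assume "Y \<in> spread K"
  then obtain x y where xy: "Y \<in> cosets K" "x \<noteq> y" "infinite (Y \<inter> branch x)" "infinite (Y \<inter> branch y)"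
    unfolding spread_def by blast
  then have "Y \<inter> branch x \<noteq> {}" "Y \<inter> branch y \<noteq> {}" by (metis finite.emptyI)+
  then show "Y \<in> core K" unfolding core_def using xy by blast
qed

lemma nsplit_bar: "nsplit K (branch (bar x)) = nsplit K (branch x)"
  using nsplit_translate[of K "gen x" "branch (bar x)"] by (simp add: Split_Compl flip: Compl_branch)

text \<open>Double counting: each such vertex has two directions whose edges are split, and each
  edge is seen once from each of its ends, by \<open>nsplit_bar\<close>.\<close>

lemma card_spread_le:
  fixes K :: "'a::finite fg set"
  assumes fin: "\<And>x. finite (Split K (branch x))"
  shows "card (spread K) \<le> (\<Sum>a\<in>UNIV. nsplit K (branch (a, True)))"
proof (cases "finite (spread K)")
  case True
  have sub: "Y \<in> Split K (branch x)" if "Y \<in> cosets K" "infinite (Y \<inter> branch x)" "infinite (Y \<inter> branch y)" "x \<noteq> y"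
    for Y x y
  proof -
    have "Y \<inter> branch y \<subseteq> Y - branch x" using that(4) branch_unique by blast
    then have "infinite (Y - branch x)" using that(3) finite_subset by blast
    then show ?thesis using that by (simp add: Split_def)
  qed
  have two: "2 \<le> card {x. Y \<in> Split K (branch x)}" if "Y \<in> spread K" for Y
  proof -
    obtain x y where xy: "x \<noteq> y" "infinite (Y \<inter> branch x)" "infinite (Y \<inter> branch y)" "Y \<in> cosets K"
      using \<open>Y \<in> spread K\<close> unfolding spread_def by blast
    then have "Y \<in> Split K (branch x)" "Y \<in> Split K (branch y)"
      using sub[of Y x y] sub[of Y y x] by simp_all
    with xy(1) have "{x, y} \<subseteq> {x. Y \<in> Split K (branch x)}" "card {x, y} = 2" by simp_all
    then show ?thesis by (metis card_mono finite)
  qed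
  have "2 * card (spread K) = (\<Sum>Y\<in>spread K. 2)" by simp
  also have "\<dots> \<le> (\<Sum>Y\<in>spread K. card {x. Y \<in> Split K (branch x)})"
    using two by (intro sum_mono)
  also have "\<dots> = (\<Sum>x\<in>UNIV. card {Y \<in> spread K. Y \<in> Split K (branch x)})"
    using sum.swap_restrict[OF True finite[of UNIV], of "\<lambda>_ _. 1 :: nat" "\<lambda>Y x. Y \<in> Split K (branch x)"]
    by simp
  also have "\<dots> \<le> (\<Sum>x\<in>UNIV. nsplit K (branch x))"
    using fin by (intro sum_mono card_mono) auto
  also have "\<dots> = (\<Sum>a\<in>UNIV. \<Sum>b\<in>UNIV. nsplit K (branch (a, b)))"
    by (simp add: sum.cartesian_product)
  also have "\<dots> = (\<Sum>a\<in>UNIV. 2 * nsplit K (branch (a, True)))"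
  proof (rule sum.cong)
    fix a
    show "(\<Sum>b\<in>UNIV. nsplit K (branch (a, b))) = 2 * nsplit K (branch (a, True))"
      using nsplit_bar[of K "(a, True)"] by (simp add: UNIV_bool)
  qed simp
  also have "\<dots> = 2 * (\<Sum>a\<in>UNIV. nsplit K (branch (a, True)))" by (simp add: sum_distrib_left)
  finally show ?thesis by simp
qed simp

locale automorphism =
  fixes f :: "'a::finite fg \<Rightarrow> 'a fg"
  assumes bij: "bij f" and f_add: "f (g + h) = f g + f h"
begin

lemma inj: "inj f" and surj: "surj f"
  using bij by (auto simp: bij_def)

abbreviation \<psi> :: "'a fg \<Rightarrow> 'a fg" where
  "\<psi> \<equiv> inv_into UNIV f"

lemma f_zero [simp]: "f 0 = 0"
  using f_add[of 0 0] by (metis add.right_neutral add_left_imp_eq)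

lemma f_uminus: "f (- g) = - f g"
  using f_add[of "- g" g] by (simp add: eq_neg_iff_add_eq_0)

lemma inv_add: "\<psi> (g + h) = \<psi> g + \<psi> h"
  by (rule injD[OF inj]) (simp add: f_add surj surj_f_inv_f)

lemma f_inv [simp]: "f (\<psi> g) = g" "\<psi> (f g) = g"
  using bij by (simp_all add: bij_is_surj surj_f_inv_f bij_is_inj inv_f_f)

lemma f_eq_zero [simp]: "f g = 0 \<longleftrightarrow> g = 0"
  by (metis f_zero f_inv(2))

lemma image_generated: "f ` generated B = generated (f ` B)"
proof
  have "f g \<in> generated (f ` B)" if "g \<in> generated B" for g
    using that
  proof (induction rule: generated.induct)
    case zero
    then show ?case by (simp add: generated.zero)
  next
    case (plus h b)
    then show ?case unfolding f_add by (intro generated.plus) auto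
  next
    case (minus h b)
    then show ?case unfolding f_add f_uminus by (intro generated.minus) auto
  qed
  then show "f ` generated B \<subseteq> generated (f ` B)" by blast
  have "g \<in> f ` generated B" if "g \<in> generated (f ` B)" for g
    using that
  proof (induction rule: generated.induct)
    case zero
    then show ?case using f_zero generated.zero by (metis imageI)
  next
    case (plus h b)
    then show ?case using generated.plus f_add by (metis (no_types, lifting) imageE imageI)
  next
    case (minus h b)
    then show ?case using generated.minus f_add f_uminus by (metis (no_types, lifting) imageE imageI)
  qed
  then show "generated (f ` B) \<subseteq> f ` generated B" by blast
qed

lemma image_translate: "f ` translate g A = translate (f g) (f ` A)"
  by (simp add: translate_def image_image f_add)

lemma vimage_translate: "f -` translate g U = translate (\<psi> g) (f -` U)"
proof (rule Set.set_eqI)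
  fix h
  have "f (- \<psi> g + h) = - g + f h" by (simp only: f_add f_uminus f_inv)
  then show "h \<in> f -` translate g U \<longleftrightarrow> h \<in> translate (\<psi> g) (f -` U)"
    by (simp only: vimage_eq mem_translate)
qed

lemma cosets_image: "cosets (f ` K) = image f ` cosets K"
proof -
  have "cosets (f ` K) = (\<lambda>g. translate g (f ` K)) ` range f"
    by (simp only: cosets_def surj)
  also have "\<dots> = image f ` cosets K"
    by (simp only: cosets_def image_image image_translate)
  finally show ?thesis .
qed

text \<open>An automorphism carries cosets of \<open>K\<close> to cosets of its image and preserves
  infinitude, so cutting the image by \<open>U\<close> amounts to cutting \<open>K\<close> by the
  preimage of \<open>U\<close>.\<close>

lemma Split_image: "Split (f ` K) U = image f ` Split K (f -` U)"
proof -
  have "f ` Z \<in> Split (f ` K) U \<longleftrightarrow> Z \<in> Split K (f -` U)" if "Z \<in> cosets K" for Z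
  proof -
    have "f ` Z \<inter> U = f ` (Z \<inter> f -` U)" "f ` Z - U = f ` (Z - f -` U)" by auto
    moreover have "finite (f ` A) \<longleftrightarrow> finite A" for A
      by (rule finite_image_iff) (rule inj_on_subset[OF inj subset_UNIV])
    moreover have "f ` Z \<in> cosets (f ` K)" using that by (simp add: cosets_image)
    ultimately show ?thesis using that by (simp only: Split_def mem_Collect_eq)
  qed
  moreover have "Split (f ` K) U \<subseteq> image f ` cosets K"
    using cosets_image by (auto simp: Split_def)
  moreover have "Split K (f -` U) \<subseteq> cosets K" by (auto simp: Split_def)
  ultimately show ?thesis by blast
qed

lemma nsplit_image: "nsplit (f ` K) U = nsplit K (f -` U)"
proof -
  have "inj_on (image f) A" for A
    using inj by (simp add: inj_on_def inj_image_eq_iff)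
  then show ?thesis unfolding Split_image by (rule card_image)
qed

lemma almost_invariant_vimage:
  assumes "almost_invariant U"
  shows "almost_invariant (f -` U)"
proof -
  have *: "{g. (g \<in> f -` U) \<noteq> (g + h \<in> f -` U)} = f -` {g. (g \<in> U) \<noteq> (g + f h \<in> U)}" for h
    by (auto simp: f_add)
  show ?thesis
    using assms inj finite_vimageI unfolding almost_invariant_def * by blast
qed

section \<open>Pulled back half-trees and the growth of the number of edges\<close>

definition cutset :: "'a letter \<Rightarrow> 'a fg set" where
  "cutset x = f -` branch x"

lemma Compl_cutset: "- cutset x = translate (\<psi> (gen x)) (cutset (bar x))"
  by (simp add: cutset_def vimage_translate flip: vimage_Compl Compl_branch)
    (simp add: Compl_branch vimage_translate)

lemma infinite_cutset: "infinite (cutset x)" "infinite (- cutset x)"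
  unfolding cutset_def vimage_Compl[symmetric]
  using finite_vimage_iff[OF bij] infinite_branch infinite_Compl_branch by blast+

lemma cutset_disjoint: "x \<noteq> y \<Longrightarrow> cutset x \<inter> cutset y = {}"
  using branch_disjoint[of x y] by (simp add: cutset_def flip: vimage_Int)

lemma UN_cutset: "(\<Union>x. cutset x) = - {0}"
  by (auto simp: cutset_def branch_def)

lemma finite_mixed_cutset: "finite (mixed (cutset x))"
  unfolding cutset_def by (intro finite_mixed almost_invariant_vimage almost_invariant_branch)

lemma cutset_translate_imp:
  assumes card: "CARD('a) \<ge> 2" and "cutset x =* translate h (cutset y)"
  shows "x = y"
proof -
  have "f ` cutset x = branch x" "f ` translate h (cutset y) = translate (f h) (branch y)"
    using surj by (simp_all add: cutset_def image_translate)
  moreover have "f ` cutset x =* f ` translate h (cutset y)"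
    using assms(2) inj unfolding aeq_def by (simp flip: image_set_diff)
  ultimately have "branch x =* translate (f h) (branch y)" by simp
  then show ?thesis using half_tree_unique[OF card] by blast
qed

text \<open>Letters in \<open>S\<close>, whose cut sets are half-trees, reproduce edge numbers of
  the original graph, each at most once. Every other letter contributes at least \<open>L\<close>
  and so gains \<open>card B + 1\<close> over an original edge number; the image graph can hide at
  most \<open>card B\<close> edges through its rank.\<close>

lemma growth:
  assumes card: "CARD('a) \<ge> 2" and B: "finite B" and gap: "gap (generated B) L"
    and L: "\<And>x. nsplit (generated B) (branch x) + card B + 1 \<le> L"
    and x0: "\<nexists>g y. cutset x0 =* translate g (branch y)"
  shows "(\<Sum>a\<in>UNIV. nsplit (generated B) (branch (a, True))) < card (core (f ` generated B))"
proof -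
  interpret gap "generated B" L by (rule gap)
  define m where "m a = nsplit (generated B) (branch (a, True))" for a
  define M where "M a = nsplit (generated B) (cutset (a, True))" for a
  have m: "nsplit (generated B) (branch y) = m (fst y)" for y
    using nsplit_bar[of "generated B" "(fst y, True)"] by (cases y, cases "snd y") (auto simp: m_def)
  define S where "S = {a. \<exists>g y. cutset (a, True) =* translate g (branch y)}"
  define y where "y a = (SOME y. \<exists>g. cutset (a, True) =* translate g (branch y))" for a
  have y: "\<exists>g. cutset (a, True) =* translate g (branch (y a))" if "a \<in> S" for a
    unfolding y_def by (rule someI_ex) (use that in \<open>auto simp: S_def\<close>)
  have "fst x0 \<notin> S"
  proof
    assume "fst x0 \<in> S"
    then obtain g z where gz: "cutset (fst x0, True) =* translate g (branch z)" by (auto simp: S_def)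
    show False
    proof (cases "snd x0")
      case True
      then show ?thesis using gz x0 by (metis prod.collapse)
    next
      case False
      then have b: "bar x0 = (fst x0, True)" by (cases x0) simp
      have "- cutset x0 =* translate (\<psi> (gen x0) + g) (branch z)"
        using aeq_translate[OF gz, of "\<psi> (gen x0)"] unfolding Compl_cutset b by simp
      then have "cutset x0 =* translate (\<psi> (gen x0) + g) (- branch z)"
        using aeq_Compl unfolding translate_Compl by fastforce
      then show ?thesis using x0 unfolding Compl_branch translate_translate by blast
    qed
  qed
  \<comment> \<open>If two letters used the same half-tree up to translation and complement, their
    cut sets would be translates of each other up to complement, contradicting uniqueness of
    half-trees after applying \<open>f\<close>.\<close>
  have inj: "inj_on (\<lambda>a. fst (y a)) S"
  proof
    fix a b assume ab: "a \<in> S" "b \<in> S" "fst (y a) = fst (y b)"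
    obtain g h where gh: "cutset (a, True) =* translate g (branch (y a))" "cutset (b, True) =* translate h (branch (y b))"
      using y ab by blast
    consider "y a = y b" | "y a = bar (y b)" using ab(3) by (cases "y a", cases "y b") auto
    then show "a = b"
    proof cases
      case 1
      have "translate (g + - h) (cutset (b, True)) =* translate (g + - h + h) (branch (y b))"
        using aeq_translate[OF gh(2), of "g + - h"] by (simp only: translate_translate)
      then have "translate (g + - h) (cutset (b, True)) =* translate g (branch (y a))"
        by (simp only: add.assoc left_minus add_0_right 1)
      then have "cutset (a, True) =* translate (g + - h) (cutset (b, True))"
        using gh(1) aeq_sym aeq_trans by blast
      then show ?thesis using cutset_translate_imp[OF card] by blast
    next
      case 2
      define k where "k = g + - gen (y b) + - h"
      have "translate k (- cutset (b, True)) =* translate k (- translate h (branch (y b)))"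
        using aeq_translate[OF aeq_Compl[OF gh(2)]] .
      also have "translate k (- translate h (branch (y b))) = translate (k + h + gen (y b)) (branch (y a))"
        by (simp only: translate_Compl[symmetric] translate_translate Compl_branch 2[symmetric] add.assoc)
      also have "k + h + gen (y b) = g" by (simp only: k_def add.assoc left_minus add_0_right)
      finally have "translate k (- cutset (b, True)) =* translate g (branch (y a))" .
      then have "cutset (a, True) =* translate (k + \<psi> (gen (b, True))) (cutset (bar (b, True)))"
        using gh(1) aeq_sym aeq_trans unfolding Compl_cutset translate_translate by blast
      then have "(a, True) = bar (b, True)" by (rule cutset_translate_imp[OF card])
      then show ?thesis by simp
    qed
  qed
  define T where "T = (\<lambda>a. fst (y a)) ` S"
  have MS: "M a = m (fst (y a))" if "a \<in> S" for a
  proof -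
    obtain g where "cutset (a, True) =* translate g (branch (y a))" using y \<open>a \<in> S\<close> by blast
    then show ?thesis unfolding M_def using Split_aeq m nsplit_translate by metis
  qed
  have MU: "L \<le> M a" if "a \<notin> S" for a
  proof -
    have 1: "finite (mixed (cutset (a, True)))" by (rule finite_mixed_cutset)
    have 2: "finite (Split (generated B) (cutset (a, True)))"
      unfolding cutset_def by (intro finite_Split[OF B] almost_invariant_vimage almost_invariant_branch)
    show ?thesis
      using small_cut[OF 1 2 infinite_cutset] card that unfolding M_def S_def by simp
  qed
  \<comment> \<open>The letters outside \<open>S\<close> are matched with the equally many letters
    whose original edge numbers were not reproduced.\<close>
  have cardT: "card (- T) = card (- S)"
    unfolding T_def Compl_eq_Diff_UNIV using card_image[OF inj] by (simp add: card_Diff_subset)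
  have neS: "1 \<le> card (- S)"
    using \<open>fst x0 \<notin> S\<close> by (metis ComplI One_nat_def Suc_leI card_gt_0_iff empty_iff finite)
  have "(\<Sum>a\<in>- T. m a + (card B + 1)) \<le> (\<Sum>a\<in>- T. L)"
    using L unfolding m_def by (intro sum_mono) (simp add: add.assoc)
  also have "\<dots> = (\<Sum>a\<in>- S. L)" by (simp add: cardT)
  also have "\<dots> \<le> (\<Sum>a\<in>- S. M a)" using MU by (intro sum_mono) auto
  finally have 1: "(\<Sum>a\<in>- T. m a) + card (- S) * (card B + 1) \<le> (\<Sum>a\<in>- S. M a)"
    by (simp only: sum.distrib sum_constant cardT of_nat_id distrib_left)
  have "card B + 1 \<le> card (- S) * (card B + 1)"
    using mult_le_mono1[OF neS, of "card B + 1"] by (simp only: mult_1)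
  with 1 have 2: "(\<Sum>a\<in>- T. m a) + (card B + 1) \<le> (\<Sum>a\<in>- S. M a)" by linarith
  have "(\<Sum>a\<in>T. m a) = (\<Sum>a\<in>S. M a)"
    unfolding T_def using MS by (simp add: sum.reindex[OF inj])
  moreover have "(\<Sum>a\<in>UNIV. g a) = (\<Sum>a\<in>S. g a) + (\<Sum>a\<in>- S. g a)" for g :: "'a \<Rightarrow> nat" and S
    using sum.subset_diff[of S UNIV g] by (simp add: Compl_eq_Diff_UNIV add.commute)
  ultimately have "(\<Sum>a\<in>UNIV. m a) + (card B + 1) \<le> (\<Sum>a\<in>UNIV. M a)"
    using 2 by (metis (no_types, lifting) add.assoc add_le_cancel_left)
  also have "(\<Sum>a\<in>UNIV. M a) = (\<Sum>a\<in>UNIV. nsplit (f ` generated B) (branch (a, True)))"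
    by (simp add: M_def nsplit_image cutset_def)
  also have "\<dots> \<le> (\<Sum>a\<in>UNIV. card (crossing (f ` generated B) (branch (a, True))))"
    unfolding image_generated
    using Split_subset_crossing finite_crossing[OF finite_imageI[OF B] almost_invariant_branch]
    by (intro sum_mono card_mono) auto
  also have "\<dots> \<le> card (core (f ` generated B)) + card (f ` B)"
    unfolding image_generated using edges_le_verts[OF finite_imageI[OF B]] .
  also have "card (f ` B) \<le> card B" using B by (rule card_image_le)
  finally show ?thesis by (simp add: m_def)
qed

text \<open>The cut sets partition the tree without 1. If all of them are half-trees, they are the
  branches at a common vertex \<open>v\<close>, up to finite sets; the task is to locate
  \<open>v\<close>.\<close>

lemma rigid:
  assumes card: "CARD('a) \<ge> 2" and half: "\<And>x. \<exists>g y. cutset x =* translate g (branch y)"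
  obtains v a where "bij a" "\<And>x. cutset x =* translate v (branch (a x))"
proof -
  \<comment> \<open>Below a vertex of \<open>T\<close> no single cut set is almost everything. The
    vertex sought is a deepest one, so that each of its children falls almost entirely into one cut
    set.\<close>
  define T where "T = {v. \<forall>x. infinite (subtree v - cutset x)}"
  have z: "0 \<in> T" using infinite_cutset by (simp add: T_def flip: Compl_eq_Diff_UNIV)
  have "T \<subseteq> (\<Union>x. mixed (cutset x))"
  proof
    fix v assume v: "v \<in> T"
    have "\<exists>x. infinite (subtree v \<inter> cutset x)"
    proof (rule ccontr)
      assume "\<not> ?thesis"
      then have "\<forall>x. finite (subtree v \<inter> cutset x)" by blast
      then have "finite (insert 0 (\<Union>x. subtree v \<inter> cutset x))"
        by (intro finite.insertI finite_UN_I finite) blast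
      moreover have "subtree v \<subseteq> insert 0 (\<Union>x. subtree v \<inter> cutset x)" using UN_cutset by blast
      ultimately show False using infinite_subtree finite_subset by blast
    qed
    then show "v \<in> (\<Union>x. mixed (cutset x))" using v unfolding T_def mixed_def by blast
  qed
  then have finT: "finite T" using finite_mixed_cutset by (meson finite finite_UN_I finite_subset)
  then have "Max ((\<lambda>v. length (rep v)) ` T) \<in> (\<lambda>v. length (rep v)) ` T"
    using z by (intro Max_in) auto
  then obtain v where v: "v \<in> T" and vmax: "length (rep v) = Max ((\<lambda>v. length (rep v)) ` T)"
    by (elim imageE) simp
  have max: "length (rep w) \<le> length (rep v)" if "w \<in> T" for w
    unfolding vmax using finT that by (intro Max_ge) auto
  have "\<exists>x. finite (translate v (branch c) - cutset x)" if "c \<in> children v" for c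
    using max[of "v + gen c"] rep_child[OF that] translate_branch_subtree[OF that] by (auto simp: T_def)
  then obtain X where X: "\<And>c. c \<in> children v \<Longrightarrow> finite (translate v (branch c) - cutset (X c))"
    by metis
  have sub: "finite A" if "A \<subseteq> C \<union> D" "finite C" "finite D" for A C D :: "'a fg set"
    using that by (meson finite_UnI finite_subset)
  have main: "cutset (X c) =* translate v (branch c)" if c: "c \<in> children v" for c
  proof -
    obtain g y where gy: "cutset (X c) =* translate g (branch y)" using half by blast
    \<comment> \<open>\<open>P\<close> is the same half-tree seen from \<open>v\<close>. If it lies
      in one branch at \<open>v\<close>, that branch must be \<open>c\<close> and equality
      follows.\<close>
    define P where "P = translate (- v + g) (branch y)"
    have vP: "translate v P = translate g (branch y)"
      unfolding P_def translate_translate by (simp flip: add.assoc)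
    consider z where "P \<subseteq> branch z" | z where "- branch z \<subseteq> P"
      using half_tree_dichotomy unfolding P_def by blast
    then show ?thesis
    proof cases
      case 1
      then have sub1: "translate v P \<subseteq> translate v (branch z)" by (auto simp: translate_def)
      have "finite (translate v (branch c) - translate v (branch z))"
        by (rule sub[of _ "translate v (branch c) - cutset (X c)" "cutset (X c) - translate v P"])
          (use sub1 X[OF c] gy vP in \<open>auto simp: aeq_def\<close>)
      then have "finite (branch c - branch z)" by (simp flip: translate_Diff)
      then have "z = c"
        using branch_disjoint[of c z] infinite_branch[of c] by (metis Diff_triv)
      have "finite (cutset (X c) - translate v (branch c))"
        by (rule sub[of _ "cutset (X c) - translate v P" "{}"])
          (use sub1 gy vP \<open>z = c\<close> in \<open>auto simp: aeq_def\<close>)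
      then show ?thesis using X[OF c] by (simp add: aeq_def)
    next
      case 2
      then have "translate v (- branch z) \<subseteq> translate v P" by (auto simp: translate_def)
      then have "translate v (- branch z) - cutset (X c) \<subseteq> translate v P - cutset (X c)" by blast
      moreover have "finite (translate v P - cutset (X c))" using gy vP by (simp add: aeq_def)
      ultimately have fin: "finite (translate v (- branch z) - cutset (X c))" by (rule finite_subset)
      \<comment> \<open>Otherwise the cut set of \<open>X c\<close> contains almost everything
        outside one branch \<open>z\<close>. If \<open>z\<close> points to the root, this
        contradicts \<open>v \<in> T\<close>; if \<open>z\<close> is a child, at most two cut sets
        cover almost the whole tree and a third would be finite.\<close>
      show ?thesis
      proof (cases "z \<in> children v")
        case False
        then have "branches (children v) \<subseteq> - branch z"
          by (auto simp: branches_def branch_def)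
        then have "translate v (branches (children v)) \<subseteq> translate v (- branch z)"
          by (auto simp: translate_def)
        then have "subtree v - cutset (X c) \<subseteq> {v} \<union> (translate v (- branch z) - cutset (X c))"
          unfolding subtree_eq[of v] by blast
        then have "finite (subtree v - cutset (X c))"
          by (rule sub) (use fin in simp_all)
        then show ?thesis using v unfolding T_def by blast
      next
        case True
        have U: "h \<in> translate v (- branch z) \<or> h \<in> translate v (branch z)" for h
          by (simp add: translate_Compl)
        have "X z \<noteq> X c"
        proof
          assume "X z = X c"
          then have "- cutset (X c) \<subseteq>
              (translate v (- branch z) - cutset (X c)) \<union> (translate v (branch z) - cutset (X z))"
            using U by (metis ComplD DiffI UnCI subsetI)
          then have "finite (- cutset (X c))" using fin X[OF True] by (rule sub)
          then show False using infinite_cutset by blast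
        qed
        obtain x where x: "x \<noteq> X c" "x \<noteq> X z" using third_letter[OF card] by blast
        have "cutset x \<subseteq>
            (translate v (- branch z) - cutset (X c)) \<union> (translate v (branch z) - cutset (X z))"
        proof
          fix h assume "h \<in> cutset x"
          then have "h \<notin> cutset (X c)" "h \<notin> cutset (X z)"
            using cutset_disjoint[OF x(1)] cutset_disjoint[OF x(2)] by (simp_all add: disjoint_iff)
          then show "h \<in> (translate v (- branch z) - cutset (X c)) \<union> (translate v (branch z) - cutset (X z))"
            using U[of h] by simp
        qed
        then have "finite (cutset x)" using fin X[OF True] by (rule sub)
        then show ?thesis using infinite_cutset by blast
      qed
    qed
  qed
  have inj: "inj_on X (children v)"
  proof
    fix c d assume cd: "c \<in> children v" "d \<in> children v" "X c = X d"
    then have "translate v (branch c) =* translate v (branch d)"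
      using main aeq_sym aeq_trans by metis
    then have "translate (- v) (translate v (branch c)) =* translate (- v) (translate v (branch d))"
      by (rule aeq_translate)
    then have "branch c =* translate 0 (branch d)" by simp
    then show "c = d" using half_tree_unique[OF card] by blast
  qed
  obtain X' where X': "inj X'" "\<And>c. cutset (X' c) =* translate v (branch c)"
  proof (cases "v = 0")
    case True
    then have "children v = UNIV" by (simp add: children_def)
    then show ?thesis using that inj main by simp
  next
    case False
    define b where "b = bar (last (rep v))"
    have ch: "children v = - {b}" using False by (auto simp: children_def b_def)
    have "card (X ` children v) < card (UNIV :: 'a letter set)"
      using card_image[OF inj] card_children[OF False] card by simp
    \<comment> \<open>The direction towards the root is not a child, and exactly one letter is left
      for it. Its cut set is what remains after the others are removed.\<close>
    then obtain r where r: "r \<notin> X ` children v" by (metis UNIV_eq_I less_irrefl)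
    have surj: "X ` (- {b}) = - {r}"
    proof (rule card_subset_eq)
      show "X ` (- {b}) \<subseteq> - {r}" using r ch by auto
      show "card (X ` (- {b})) = card (- {r})"
        using card_image[OF inj] ch by (simp add: Compl_eq_Diff_UNIV card_Diff_subset)
    qed simp
    have "finite (cutset r - translate v (branch b))"
    proof (rule finite_subset)
      show "cutset r - translate v (branch b) \<subseteq> insert v (\<Union>c\<in>- {b}. translate v (branch c) - cutset (X c))"
      proof
        fix h assume h: "h \<in> cutset r - translate v (branch b)"
        show "h \<in> insert v (\<Union>c\<in>- {b}. translate v (branch c) - cutset (X c))"
        proof (cases "- v + h" rule: branch_cases)
          case 1
          then have "h = v" by (metis add.right_neutral add_minus_cancel)
          then show ?thesis by simp
        next
          case (2 c)
          then have hc: "h \<in> translate v (branch c)" by (simp add: mem_translate)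
          then have "c \<noteq> b" using h by blast
          then have "X c \<noteq> r" using surj by blast
          then have "h \<notin> cutset (X c)" using h cutset_disjoint by blast
          then show ?thesis using hc \<open>c \<noteq> b\<close> by blast
        qed
      qed
      show "finite (insert v (\<Union>c\<in>- {b}. translate v (branch c) - cutset (X c)))"
        using X ch by simp
    qed
    moreover have "finite (translate v (branch b) - cutset r)"
    proof (rule finite_subset)
      show "translate v (branch b) - cutset r \<subseteq> insert 0 (\<Union>c\<in>- {b}. cutset (X c) - translate v (branch c))"
      proof
        fix h assume h: "h \<in> translate v (branch b) - cutset r"
        show "h \<in> insert 0 (\<Union>c\<in>- {b}. cutset (X c) - translate v (branch c))"
        proof (cases "h = 0")
          case False
          then obtain x where x: "h \<in> cutset x" using UN_cutset by blast
          then have "x \<noteq> r" using h by blast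
          then obtain c where c: "c \<noteq> b" "x = X c" using surj by blast
          have "branch c \<inter> branch b = {}" using c(1) by (rule branch_disjoint)
          moreover have "- v + h \<in> branch b" using h by (simp add: mem_translate)
          ultimately have "h \<notin> translate v (branch c)" unfolding mem_translate by blast
          with x c show ?thesis by blast
        qed simp
      qed
      show "finite (insert 0 (\<Union>c\<in>- {b}. cutset (X c) - translate v (branch c)))"
        using main ch by (simp add: aeq_def)
    qed
    ultimately have "cutset r =* translate v (branch b)" by (simp add: aeq_def)
    then have 1: "cutset ((X(b := r)) c) =* translate v (branch c)" for c
      using main ch by (cases "c = b") simp_all
    have "inj (X(b := r))"
      using inj surj ch by (auto simp: inj_on_def)
    then show ?thesis using that 1 by blast
  qed
  then have bijX: "bij X'" by (metis bij_betw_def finite_UNIV_inj_surj finite)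
  have "cutset x =* translate v (branch (inv_into UNIV X' x))" for x
    using X'(2)[of "inv_into UNIV X' x"] bijX by (simp add: bij_is_surj surj_f_inv_f)
  then show ?thesis using that bij_imp_bij_inv[OF bijX] by blast
qed

end

section \<open>Automorphisms all of whose cut sets are half-trees\<close>

context automorphism
begin

text \<open>The cut set of \<open>bar x\<close> is a translate, by the preimage of \<open>x\<close>,
  of the complement of the cut set of \<open>x\<close>. Comparing the two corresponding half-trees
  at \<open>v\<close> determines both the letter and the translation.\<close>

lemma rigid_conj:
  assumes card: "CARD('a) \<ge> 2" and V: "\<And>x. cutset x =* translate v (branch (a x))"
  shows "a (bar x) = bar (a x)" "\<psi> (gen x) = v + gen (a x) + - v"
proof -
  define p where "p = \<psi> (gen x)"
  have "- cutset x = translate p (cutset (bar x))" unfolding p_def by (rule Compl_cutset)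
  then have "cutset (bar x) = translate (- p) (- cutset x)" by simp
  also have "\<dots> =* translate (- p) (- translate v (branch (a x)))"
    by (rule aeq_translate[OF aeq_Compl[OF V]])
  also have "translate (- p) (- translate v (branch (a x))) =
      translate (- p + v + gen (a x)) (branch (bar (a x)))"
    by (simp only: translate_Compl[symmetric] Compl_branch translate_translate add.assoc)
  finally have "translate v (branch (a (bar x))) =* translate (- p + v + gen (a x)) (branch (bar (a x)))"
    using V[of "bar x"] aeq_sym aeq_trans by blast
  from aeq_translate[OF this, of "- v"]
  have "branch (a (bar x)) =* translate (- v + (- p + v + gen (a x))) (branch (bar (a x)))"
    unfolding translate_translate left_minus translate_zero .
  from half_tree_unique[OF card this]
  have 1: "- v + (- p + v + gen (a x)) = 0" and 2: "a (bar x) = bar (a x)" by blast+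
  show "a (bar x) = bar (a x)" by (rule 2)
  from 1 have "- p + v + gen (a x) = v" by (metis add.right_neutral add_minus_cancel)
  then have "v + gen (a x) = p + v" by (metis add.assoc minus_add_cancel add_minus_cancel)
  then have "p = v + gen (a x) + - v" by (simp add: add.assoc)
  then show "\<psi> (gen x) = v + gen (a x) + - v" by (simp only: p_def)
qed

text \<open>The inverse automorphism is a letter permutation followed by conjugation with
  \<open>v\<close>. The permutation commutes with \<open>bar\<close>, so it keeps words reduced and
  preserves their length; conjugating \<open>f\<close> by \<open>f v\<close> removes the inner
  part.\<close>

lemma rigid_length:
  assumes card: "CARD('a) \<ge> 2" and a: "bij a" and V: "\<And>x. cutset x =* translate v (branch (a x))"
  shows "length (rep (f v + f h + - f v)) = length (rep h)"
proof -
  have el: "\<psi> (el w) = v + el (map a w) + - v" for w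
  proof (induction w)
    case Nil
    have "\<psi> 0 = 0" by (metis f_inv(2) f_zero)
    then show ?case by simp
  next
    case (Cons x w)
    have "\<psi> (el (x # w)) = \<psi> (gen x) + \<psi> (el w)"
      by (simp only: el_Cons[of x w] inv_add)
    also have "\<dots> = v + gen (a x) + (- v + (v + (el (map a w) + - v)))"
      unfolding Cons rigid_conj(2)[OF card V] by (simp only: add.assoc)
    also have "\<dots> = v + (gen (a x) + el (map a w)) + - v"
      by (simp only: add.assoc minus_add_cancel)
    also have "gen (a x) + el (map a w) = el (map a (x # w))"
      by (simp only: list.map el_Cons[of "a x" "map a w"])
    finally show ?case .
  qed
  have red: "reduced_word (map a w)" if "reduced_word w" for w
    using that
  proof (induction w)
    case (Cons x w)
    have "a y \<noteq> bar (a x)" if "y \<noteq> bar x" for y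
      using that a rigid_conj(1)[OF card V, of x] by (metis bij_def injD)
    then show ?case using Cons by (auto simp: reduced_Cons hd_map)
  qed simp
  define g where "g = f (v + h + - v)"
  have "\<psi> g = v + el (map a (rep g)) + - v" using el[of "rep g"] by simp
  moreover have "\<psi> g = v + h + - v" by (simp only: g_def f_inv)
  ultimately have "h = el (map a (rep g))" by (metis add.assoc add_left_imp_eq add_right_imp_eq)
  then have "rep h = map a (rep g)" using red[OF reduced_rep[of g]] by (simp only: rep_el_reduced)
  then have "length (rep h) = length (rep g)" by simp
  then show ?thesis by (simp only: g_def f_add f_uminus)
qed

text \<open>Finite changes do not affect infinite directions, so translation by \<open>v\<close>
  followed by \<open>f\<close> sends \<open>spread\<close> into \<open>spread\<close>. The
  hypothesis that the whole core is spread makes this an injection of the core.\<close>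

lemma rigid_core:
  assumes B: "finite B" and a: "bij a" and V: "\<And>x. cutset x =* translate v (branch (a x))"
    and spread: "core (generated B) \<subseteq> spread (generated B)"
  shows "card (core (generated B)) \<le> card (core (f ` generated B))"
proof -
  have "f ` translate v Z \<in> spread (f ` generated B)" if Z: "Z \<in> spread (generated B)" for Z
  proof -
    obtain x y where xy: "x \<noteq> y" "infinite (Z \<inter> branch x)" "infinite (Z \<inter> branch y)" "Z \<in> cosets (generated B)"
      using Z unfolding spread_def by blast
    have inf: "infinite (f ` translate v Z \<inter> branch (inv_into UNIV a x))" if "infinite (Z \<inter> branch x)" for x
    proof -
      define x' where "x' = inv_into UNIV a x"
      have "a x' = x" using a by (simp add: x'_def bij_is_surj surj_f_inv_f)
      then have "cutset x' =* translate v (branch x)" using V[of x'] by simp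
      moreover have "infinite (translate v Z \<inter> translate v (branch x))"
        using that by (simp flip: translate_Int)
      ultimately have "infinite (translate v Z \<inter> cutset x')" using aeq_finite_Int by blast
      moreover have "f ` translate v Z \<inter> branch x' = f ` (translate v Z \<inter> cutset x')"
        by (auto simp: cutset_def)
      moreover have "finite (f ` A) \<longleftrightarrow> finite A" for A
        by (rule finite_image_iff) (rule inj_on_subset[OF inj subset_UNIV])
      ultimately have "infinite (f ` translate v Z \<inter> branch x')" by metis
      then show ?thesis unfolding x'_def .
    qed
    have "inv_into UNIV a x \<noteq> inv_into UNIV a y"
      using xy(1) a by (metis bij_is_surj surj_f_inv_f)
    moreover have "f ` translate v Z \<in> cosets (f ` generated B)"
      using xy(4) by (simp add: cosets_image)
    ultimately show ?thesis unfolding spread_def using inf[OF xy(2)] inf[OF xy(3)] by blast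
  qed
  then have "(\<lambda>Z. f ` translate v Z) ` core (generated B) \<subseteq> core (f ` generated B)"
    using spread spread_subset_core by blast
  moreover have "finite (core (f ` generated B))"
    unfolding image_generated using B by (intro finite_core finite_imageI)
  moreover have "inj_on (\<lambda>Z. f ` translate v Z) (core (generated B))"
    using inj by (simp add: inj_on_def inj_image_eq_iff)
  ultimately show ?thesis by (metis card_image card_mono)
qed

end

section \<open>Passage to automorphisms of the group of reduced words\<close>

lemma inverse_free_group: "inv\<^bsub>free_group\<^esub> (rep g) = rep (- g)"
proof (rule group.inv_equality[OF group_free_group])
  show "rep (- g) \<otimes>\<^bsub>free_group\<^esub> rep g = \<one>\<^bsub>free_group\<^esub>"
    by (simp add: free_group_def flip: rep_plus)
qed (simp_all add: free_group_def)

lemma mult_free_group: "rep g \<otimes>\<^bsub>free_group\<^esub> rep h = rep (g + h)"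
  by (simp add: free_group_def rep_plus)

lemma carrier_free_group: "carrier free_group = range rep"
  unfolding free_group_def by (auto simp: image_iff) (metis rep_Fg_reduced)

lemma generate_free_group:
  "generate free_group (rep ` B) = rep ` generated B"
proof
  have "w \<in> rep ` generated B" if "w \<in> generate free_group (rep ` B)" for w
    using that
  proof (induction rule: generate.induct)
    case one
    have "\<one>\<^bsub>free_group\<^esub> = rep 0" by (simp add: free_group_def)
    then show ?case using generated.zero by blast
  next
    case (incl h)
    then show ?case using generated_base by blast
  next
    case (inv h)
    then obtain b where "b \<in> B" "h = rep b" by blast
    then show ?case using generated_base(2)[of b B] by (simp add: inverse_free_group)
  next
    case (eng h1 h2)
    then obtain g1 g2 where "h1 = rep g1" "h2 = rep g2" "g1 \<in> generated B" "g2 \<in> generated B" by blast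
    then show ?case by (simp add: mult_free_group generated_add)
  qed
  then show "generate free_group (rep ` B) \<subseteq> rep ` generated B" by blast
  have "rep g \<in> generate free_group (rep ` B)" if "g \<in> generated B" for g
    using that
  proof (induction rule: generated.induct)
    case zero
    have "rep 0 = \<one>\<^bsub>free_group\<^esub>" by (simp add: free_group_def)
    then show ?case using generate.one by metis
  next
    case (plus h b)
    then show ?case unfolding mult_free_group[symmetric] by (intro generate.eng) (auto intro: generate.incl)
  next
    case (minus h b)
    then show ?case unfolding mult_free_group[symmetric] inverse_free_group[symmetric]
      by (intro generate.eng) (auto intro: generate.inv)
  qed
  then show "rep ` generated B \<subseteq> generate free_group (rep ` B)" by blast
qed

text \<open>Either all cut sets are half-trees and the automorphism preserves length up to an inner
  one, or some cut set is not and the edge count exceeds what the vertices of \<open>H\<close>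
  require.\<close>

theorem minimality_criterion:
  fixes B :: "'a::finite fg set"
  assumes card: "CARD('a) \<ge> 2" and B: "finite B" and gap: "gap (generated B) L"
    and L: "\<And>x. nsplit (generated B) (branch x) + card B + 1 \<le> L"
    and spread: "core (generated B) \<subseteq> spread (generated B)"
  shows "strictly_whitehead_minimal (rep ` generated B)"
proof -
  define H where "H = generated B"
  have sizeH: "subgroup_size (rep ` H) = card (core H)"
    unfolding H_def using B by (intro subgroup_size_eq subgrp_generated finite_core)
  have "subgroup_size (rep ` H) \<le> subgroup_size (\<phi> ` rep ` H) \<and>
      (\<not> length_preserving_upto_inner \<phi> \<longrightarrow> subgroup_size (rep ` H) < subgroup_size (\<phi> ` rep ` H))"
    if \<phi>: "\<phi> \<in> auto free_group" for \<phi>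
  proof -
    define f where "f g = Fg (\<phi> (rep g))" for g
    have bijb: "bij_betw \<phi> (range rep) (range rep)" and hom: "\<phi> \<in> hom free_group free_group"
      using \<phi> by (auto simp: auto_def Bij_def carrier_free_group)
    have "\<phi> (rep g) \<in> range rep" for g using bijb by (auto simp: bij_betw_def)
    then have rep_f: "rep (f g) = \<phi> (rep g)" for g
      unfolding f_def by (metis rep_Fg_reduced reduced_rep rangeE)
    have "f (g + h) = f g + f h" for g h
    proof -
      have "rep (f (g + h)) = \<phi> (rep g \<otimes>\<^bsub>free_group\<^esub> rep h)" by (simp only: rep_f mult_free_group)
      also have "\<dots> = \<phi> (rep g) \<otimes>\<^bsub>free_group\<^esub> \<phi> (rep h)"
        using hom by (auto simp: hom_def carrier_free_group)
      also have "\<dots> = rep (f g + f h)" by (simp only: mult_free_group flip: rep_f)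
      finally show ?thesis by (simp only: rep_inject)
    qed
    moreover have "bij f"
    proof (rule bijI)
      show "inj f"
      proof
        fix g h assume "f g = f h"
        then have "\<phi> (rep g) = \<phi> (rep h)" by (metis rep_f)
        then show "g = h" using bijb by (auto simp: bij_betw_def inj_on_def rep_inject)
      qed
      have "h \<in> range f" for h
      proof -
        have "rep h \<in> \<phi> ` range rep" using bijb by (simp add: bij_betw_def)
        then obtain g where "rep h = \<phi> (rep g)" by blast
        then show ?thesis by (metis rangeI rep_f rep_inject)
      qed
      then show "surj f" by blast
    qed
    ultimately interpret automorphism f by unfold_locales
    have img: "\<phi> ` rep ` H = rep ` f ` H" by (simp add: image_image rep_f)
    have size: "subgroup_size (\<phi> ` rep ` H) = card (core (f ` H))"
      unfolding img unfolding H_def image_generated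
      using B by (intro subgroup_size_eq subgrp_generated finite_core finite_imageI)
    show ?thesis
    proof (cases "\<forall>x. \<exists>g y. cutset x =* translate g (branch y)")
      case True
      then obtain v a where a: "bij a" and V: "\<And>x. cutset x =* translate v (branch (a x))"
        using rigid[OF card] by blast
      have "rep (f v) \<otimes>\<^bsub>free_group\<^esub> \<phi> (rep h) \<otimes>\<^bsub>free_group\<^esub> inv\<^bsub>free_group\<^esub> (rep (f v)) =
          rep (f v + f h + - f v)" for h
        by (simp only: inverse_free_group mult_free_group flip: rep_f)
      then have "length_preserving_upto_inner \<phi>"
        unfolding length_preserving_upto_inner_def length_preserving_def carrier_free_group
        using rigid_length[OF card a V] by (intro bexI[of _ "rep (f v)"]) auto
      moreover have "card (core H) \<le> card (core (f ` H))"
        unfolding H_def by (rule rigid_core[OF B a V spread])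
      ultimately show ?thesis using size sizeH by simp
    next
      case False
      then obtain x0 where x0: "\<nexists>g y. cutset x0 =* translate g (branch y)" by blast
      have "card (core H) \<le> card (spread H)"
        unfolding H_def using spread spread_subset_core finite_core[OF B] finite_subset
        by (intro card_mono) blast+
      also have "\<dots> \<le> (\<Sum>a\<in>UNIV. nsplit H (branch (a, True)))"
        unfolding H_def by (intro card_spread_le finite_Split[OF B] almost_invariant_branch)
      also have "\<dots> < card (core (f ` H))"
        unfolding H_def by (rule growth[OF card B gap L x0])
      finally show ?thesis using size sizeH by simp
    qed
  qed
  then show ?thesis unfolding strictly_whitehead_minimal_def H_def by blast
qed

section \<open>Subgroups generated by cyclically reduced words\<close>

lemma cyclically_reducedD: "cyclically_reduced h \<Longrightarrow> reduced_word h"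
  by (simp add: cyclically_reduced_def)

lemma reduced_power:
  assumes "cyclically_reduced h"
  shows "reduced_word (concat (replicate m h))"
proof (cases "h = []")
  case True
  then show ?thesis by (metis concat_replicate_trivial reduced_Nil)
next
  case False
  have h: "reduced_word h" "hd h \<noteq> bar (last h)"
    using assms False by (auto simp: cyclically_reduced_def reduced_append)
  have "hd (h @ w) = hd h" for w using False by simp
  then show ?thesis
    by (induction m) (use h False in \<open>auto simp: reduced_append replicate_app_Cons_same[symmetric] hd_concat\<close>)
qed

definition vert :: "'a fg set \<Rightarrow> 'a word \<Rightarrow> nat \<Rightarrow> 'a fg set" where
  "vert K h j = translate (- el (take j h)) K"

text \<open>At position \<open>j\<close> of the closed walk \<open>h\<close> the outgoing direction
  is \<open>h ! j\<close> and the incoming edge points back along the \<open>bar\<close> of the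
  preceding letter. Prefixing \<open>h\<close> makes the last letter the predecessor at
  \<open>j = 0\<close>.\<close>

definition turn :: "'a letter set \<Rightarrow> 'a word \<Rightarrow> nat \<Rightarrow> bool" where
  "turn S h j \<longleftrightarrow> (h ! j \<in> S) \<noteq> (bar (last (h @ take j h)) \<in> S)"

definition turns :: "'a letter set \<Rightarrow> 'a word \<Rightarrow> nat" where
  "turns S h = card {j. j < length h \<and> turn S h j}"

lemma infinite_elements:
  fixes w :: "nat \<Rightarrow> 'a word"
  assumes "\<And>m. reduced_word (w m)" "\<And>m. el (w m) \<in> Y" "strict_mono (\<lambda>m. length (w m))"
    and "\<And>m. w m \<noteq> []" "\<And>m. hd (w m) = x"
  shows "infinite (Y \<inter> branch x)"
proof -
  have "el (w m) \<in> Y \<inter> branch x" for m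
    using assms rep_el_reduced[OF assms(1)] by (simp add: branch_def flip: rep_eq_Nil)
  moreover have "inj (\<lambda>m. el (w m))"
  proof
    fix m n assume "el (w m) = el (w n)"
    then have "rep (el (w m)) = rep (el (w n))" by (rule arg_cong)
    then have "length (w m) = length (w n)" by (simp add: rep_el_reduced assms(1))
    then show "m = n" using strict_mono_eq[OF assms(3)] by blast
  qed
  ultimately show ?thesis by (metis finite_subset image_subsetI range_inj_infinite)
qed

text \<open>From a vertex on the loop \<open>h\<close> one can go around forever forwards or
  backwards. Cyclic reducedness keeps these words reduced and makes their first letters
  differ.\<close>

lemma vert_infinite:
  assumes h: "cyclically_reduced h" "h \<noteq> []" "el h \<in> K" "subgrp K" and j: "j < length h"
  shows "infinite (vert K h j \<inter> branch (h ! j))"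
    and "infinite (vert K h j \<inter> branch (bar (last (h @ take j h))))"
    and "h ! j \<noteq> bar (last (h @ take j h))"
proof -
  define p where "p m = concat (replicate m h)" for m
  have p_Suc: "p (Suc m) = h @ p m" "p (Suc m) = p m @ h" for m
    unfolding p_def by (simp, simp add: replicate_append_same[symmetric])
  have len: "length (p m) = m * length h" for m by (induction m) (simp_all add: p_def)
  have red: "reduced_word (p m)" for m unfolding p_def using h(1) by (rule reduced_power)
  have pK: "el (p m) \<in> K" for m
    by (induction m) (use h in \<open>auto simp: p_Suc(1) el_append p_def[of 0] subgrp_def\<close>)
  have th: "take j h @ drop j h = h" by simp
  have dr: "drop j h \<noteq> []" "hd (drop j h) = h ! j" using j by (simp_all add: hd_drop_conv_nth)
  have sm: "strict_mono (\<lambda>m. a + m * length h)" for a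
    using h(2) by (intro strict_monoI) simp
  show "infinite (vert K h j \<inter> branch (h ! j))"
  proof (rule infinite_elements)
    show "reduced_word (drop j h @ p m)" for m
    proof -
      have "reduced_word (take j h @ (drop j h @ p m))"
        using red[of "Suc m"] unfolding p_Suc(1) by (metis th append_assoc)
      then show ?thesis unfolding reduced_append by blast
    qed
    show "el (drop j h @ p m) \<in> vert K h j" for m
    proof -
      have "el (take j h) + el (drop j h @ p m) = el (p (Suc m))"
        unfolding p_Suc(1) el_append[symmetric] by (metis th append_assoc)
      then show ?thesis using pK by (simp add: vert_def mem_translate)
    qed
    show "strict_mono (\<lambda>m. length (drop j h @ p m))" using sm by (simp add: len)
  qed (use dr in simp_all)
  have redb: "reduced_word (p m @ take j h)" for m
  proof -
    have "reduced_word ((p m @ take j h) @ drop j h)"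
      using red[of "Suc m"] unfolding p_Suc(2) by simp
    then show ?thesis unfolding reduced_append[of "p m @ take j h" "drop j h"] by blast
  qed
  show "infinite (vert K h j \<inter> branch (bar (last (h @ take j h))))"
  proof (rule infinite_elements)
    show "reduced_word (inv_word (p (Suc m) @ take j h))" for m
      unfolding reduced_inv_word by (rule redb)
    show "el (inv_word (p (Suc m) @ take j h)) \<in> vert K h j" for m
    proof -
      have "el (inv_word (p (Suc m) @ take j h)) = - el (take j h) + - el (p (Suc m))"
        by (simp only: el_inv_word el_append minus_add)
      moreover have "- el (p (Suc m)) \<in> K" using pK h(4) by (simp add: subgrp_def)
      ultimately show ?thesis by (simp only: vert_def mem_translate minus_minus add_minus_cancel)
    qed
    show "strict_mono (\<lambda>m. length (inv_word (p (Suc m) @ take j h)))"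
      using sm[of "length h + j"] j by (simp add: len algebra_simps)
    show "inv_word (p (Suc m) @ take j h) \<noteq> []" for m using h(2) by (simp add: p_Suc)
    have "last (p (Suc m) @ take j h) = last (h @ take j h)" for m
      using h(2) by (cases "take j h = []") (simp_all add: p_Suc(2))
    then show "hd (inv_word (p (Suc m) @ take j h)) = bar (last (h @ take j h))" for m
      using h(2) hd_inv_word[of "p (Suc m) @ take j h"] by (simp add: p_Suc)
  qed
  have "reduced_word ((h @ take j h) @ drop j h)" using red[of 2] by (simp add: p_def numeral_2_eq_2)
  then show "h ! j \<noteq> bar (last (h @ take j h))"
    using h(2) dr unfolding reduced_append[of "h @ take j h" "drop j h"] by simp
qed

lemma vert_cosets: "vert K h j \<in> cosets K"
  by (auto simp: vert_def cosets_def)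

lemma word_crossing:
  assumes "(z \<in> branch x) \<noteq> (z + el h \<in> branch x)"
  obtains j where "j < length h" "z + el (take j h) = 0 \<and> h ! j = x \<or>
    z + el (take (Suc j) h) = 0 \<and> h ! j = bar x"
proof -
  have "\<exists>j<length h. (z + el (take j h) \<in> branch x) \<noteq> (z + el (take (Suc j) h) \<in> branch x)"
  proof (rule ccontr)
    assume neg: "\<not> ?thesis"
    have "j \<le> length h \<Longrightarrow> (z + el (take j h) \<in> branch x) = (z \<in> branch x)" for j
      by (induction j) (use neg in auto)
    from this[of "length h"] assms show False by simp
  qed
  then obtain j where j: "j < length h"
    "(z + el (take j h) \<in> branch x) \<noteq> (z + el (take (Suc j) h) \<in> branch x)" by blast
  have suc: "z + el (take (Suc j) h) = z + el (take j h) + gen (h ! j)"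
    using j(1) by (simp add: take_Suc_conv_app_nth el_append add.assoc)
  have "z + el (take j h) = 0 \<and> h ! j = x \<or> z + el (take j h) = gen x \<and> h ! j = bar x"
    using branch_step j(2) unfolding suc by blast
  then show ?thesis using that j(1) suc by (auto simp: gen_bar)
qed

locale words =
  fixes hs :: "'a::finite word list"
  assumes cyc: "\<And>h. h \<in> set hs \<Longrightarrow> cyclically_reduced h"
    and ne: "\<And>h. h \<in> set hs \<Longrightarrow> h \<noteq> []" and hs_ne: "hs \<noteq> []"
begin

definition B :: "'a fg set" where "B = el ` set hs"

abbreviation H :: "'a fg set" where "H \<equiv> generated B"

lemma finite_B: "finite B"
  by (simp add: B_def)

lemma card_B: "card B \<le> length hs"
  unfolding B_def by (metis card_image_le card_length finite_set le_trans)

lemma el_H: "h \<in> set hs \<Longrightarrow> el h \<in> H"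
  by (auto simp: B_def intro: generated_base)

lemma vert_eq: "Y \<in> cosets H \<Longrightarrow> z \<in> Y \<Longrightarrow> z + el (take j h) = 0 \<Longrightarrow> Y = vert H h j"
  unfolding vert_def using coset_eq_translate[OF subgrp_generated] by (metis eq_neg_iff_add_eq_0)

lemma crossing_vert:
  assumes "Y \<in> cosets H" "Y \<inter> branch x \<noteq> {}" "Y - branch x \<noteq> {}"
  obtains h j where "h \<in> set hs" "j < length h"
    "Y = vert H h j \<and> h ! j = x \<or> Y = vert H h (Suc j) \<and> h ! j = bar x"
proof -
  obtain z h where zh: "z \<in> Y" "h \<in> set hs" "(z \<in> branch x) \<noteq> (z + el h \<in> branch x)"
    using coset_crossing[OF assms] unfolding B_def by blast
  then obtain j where "j < length h" "z + el (take j h) = 0 \<and> h ! j = x \<or>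
      z + el (take (Suc j) h) = 0 \<and> h ! j = bar x"
    using word_crossing by blast
  then show ?thesis using that zh vert_eq[OF assms(1)] by blast
qed

lemma vert_length: "h \<in> set hs \<Longrightarrow> vert H h (length h) = H"
  using subgrp_translate[OF subgrp_generated el_H] by (simp add: vert_def)

lemma vert_zero: "vert H h 0 = H"
  by (simp add: vert_def)

lemma core_vert:
  assumes "Y \<in> core H"
  obtains h j where "h \<in> set hs" "j < length h" "Y = vert H h j"
proof -
  have Yc: "Y \<in> cosets H" using assms by (simp add: core_def)
  have "\<exists>h\<in>set hs. \<exists>j<length h. Y = vert H h j"
  proof (cases "Y = H")
    case True
    obtain h where h: "h \<in> set hs" using hs_ne by (metis last_in_set)
    then have "0 < length h" "Y = vert H h 0" using ne True vert_zero by simp_all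
    then show ?thesis using h by blast
  next
    case False
    then have "0 \<notin> Y" using coset_zero[OF subgrp_generated Yc] by blast
    obtain g where g: "g \<in> Y" using cosets_nonempty[OF subgrp_generated Yc] by blast
    then obtain x where "g \<in> branch x" using \<open>0 \<notin> Y\<close> branch_cases by metis
    then have "Y \<inter> branch x \<noteq> {}" "Y - branch x \<noteq> {}"
      using core_active[OF assms g] by (simp_all add: active_def)
    then obtain h j where hj: "h \<in> set hs" "j < length h"
      "Y = vert H h j \<and> h ! j = x \<or> Y = vert H h (Suc j) \<and> h ! j = bar x"
      using crossing_vert[OF Yc] by metis
    have "Suc j \<noteq> length h" if "Y = vert H h (Suc j)"
      using that False vert_length hj(1) by metis
    then show ?thesis using hj by (metis Suc_lessI)
  qed
  then show ?thesis using that by blast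
qed

text \<open>Every core vertex lies on the loop of some generator, and such a loop has two infinite
  directions at each of its vertices.\<close>

lemma core_subset_spread: "core H \<subseteq> spread H"
proof
  fix Y assume "Y \<in> core H"
  then obtain h j where hj: "h \<in> set hs" "j < length h" "Y = vert H h j" by (rule core_vert)
  then show "Y \<in> spread H"
    using vert_infinite[OF cyc ne el_H subgrp_generated, of h j] vert_cosets
    unfolding spread_def by blast
qed

lemma vert_Split:
  assumes "h \<in> set hs" "j < length h" "turn S h j"
  shows "vert H h j \<in> Split H (branches S)"
proof -
  define x y where "x = h ! j" and "y = bar (last (h @ take j h))"
  have inf: "infinite (vert H h j \<inter> branch x)" "infinite (vert H h j \<inter> branch y)"
    unfolding x_def y_def using vert_infinite[OF cyc ne el_H subgrp_generated] assms by blast+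
  have "branch z \<subseteq> branches S \<or> branch z \<inter> branches S = {}" for z
    by (auto simp: branch_def branches_def)
  have 1: "infinite (vert H h j \<inter> branches S)" if "z \<in> S" "infinite (vert H h j \<inter> branch z)" for z
  proof -
    have "vert H h j \<inter> branch z \<subseteq> vert H h j \<inter> branches S"
      using that(1) by (auto simp: branch_def branches_def)
    then show ?thesis using that(2) finite_subset by blast
  qed
  have 2: "infinite (vert H h j - branches S)" if "z \<notin> S" "infinite (vert H h j \<inter> branch z)" for z
  proof -
    have "vert H h j \<inter> branch z \<subseteq> vert H h j - branches S"
      using that(1) by (auto simp: branch_def branches_def)
    then show ?thesis using that(2) finite_subset by blast
  qed
  have "(x \<in> S) \<noteq> (y \<in> S)" using assms(3) by (simp add: turn_def x_def y_def)
  then show ?thesis unfolding Split_def using inf 1 2 vert_cosets by blast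
qed

text \<open>Each edge of the graph is traversed by some letter occurrence in the generators, so the
  total length bounds the number of edges.\<close>

lemma sum_nsplit_le: "(\<Sum>a\<in>UNIV. nsplit H (branch (a, True))) \<le> (\<Sum>i<length hs. length (hs ! i))"
proof -
  \<comment> \<open>The edge read at position \<open>j\<close> of generator \<open>i\<close>,
    recorded by its source; for an inverse letter the source is the vertex after the step.\<close>
  define F where "F = (\<lambda>(i, j). (fst (hs ! i ! j),
    if snd (hs ! i ! j) then vert H (hs ! i) j else vert H (hs ! i) (Suc j)))"
  have fin: "finite (crossing H (branch x))" for x
    using finite_B almost_invariant_branch by (rule finite_crossing)
  have "(SIGMA a:UNIV. crossing H (branch (a, True))) \<subseteq> F ` (SIGMA i:{..<length hs}. {..<length (hs ! i)})"
  proof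
    fix e assume "e \<in> (SIGMA a:UNIV. crossing H (branch (a, True)))"
    then obtain a Y where e: "e = (a, Y)" and Y: "Y \<in> cosets H" "Y \<inter> branch (a, True) \<noteq> {}" "Y - branch (a, True) \<noteq> {}"
      by (auto simp: crossing_def)
    obtain h j where hj: "h \<in> set hs" "j < length h"
      "Y = vert H h j \<and> h ! j = (a, True) \<or> Y = vert H h (Suc j) \<and> h ! j = bar (a, True)"
      using crossing_vert[OF Y] .
    then obtain i where i: "i < length hs" "hs ! i = h" by (metis in_set_conv_nth)
    then have "e = F (i, j)" using hj e by (auto simp: F_def)
    then show "e \<in> F ` (SIGMA i:{..<length hs}. {..<length (hs ! i)})" using i hj by blast
  qed
  then have "card (SIGMA a:UNIV. crossing H (branch (a, True))) \<le>
      card (SIGMA i:{..<length hs}. {..<length (hs ! i)})"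
    by (rule surj_card_le[rotated]) simp
  then have "(\<Sum>a\<in>UNIV. card (crossing H (branch (a, True)))) \<le> (\<Sum>i<length hs. length (hs ! i))"
    using fin by simp
  moreover have "(\<Sum>a\<in>UNIV. nsplit H (branch (a, True))) \<le> (\<Sum>a\<in>UNIV. card (crossing H (branch (a, True))))"
    by (intro sum_mono card_mono fin Split_subset_crossing)
  ultimately show ?thesis by linarith
qed

end

section \<open>Small cancellation between the generators\<close>

text \<open>Cancellation stops at the longest common prefix of the inverse of \<open>R\<close> and
  \<open>w\<close>, which is shorter than \<open>t\<close>. Hence at least \<open>t\<close> letters
  at the end of \<open>w\<close> survive.\<close>

lemma reduce_cancel:
  fixes R w :: "'a word"
  assumes "reduced_word R" "reduced_word w" "t \<le> length R" "2 * t \<le> length w"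
    and "take t (inv_word R) \<noteq> take t w"
  shows "t \<le> length (reduce (R @ w)) \<and> take t (inv_word (reduce (R @ w))) = take t (inv_word w)"
proof -
  obtain ps xs ys where ps: "inv_word R = ps @ xs" "w = ps @ ys" "xs = [] \<or> ys = [] \<or> hd xs \<noteq> hd ys"
    using longest_common_prefix[of "inv_word R" w] by (metis list.sel(1) neq_Nil_conv)
  have "length ps < t"
  proof (rule ccontr)
    assume "\<not> length ps < t"
    then have "take t (inv_word R) = take t w" unfolding ps by simp
    with assms(5) show False by blast
  qed
  have "length ps + length xs = length R" using arg_cong[OF ps(1), of length] by simp
  then have ne: "xs \<noteq> []" "t \<le> length ys" "ys \<noteq> []"
    using \<open>length ps < t\<close> assms(3,4) ps(2) by auto
  have R: "R = inv_word xs @ inv_word ps" using arg_cong[OF ps(1), of inv_word] by simp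
  have red: "reduced_word (inv_word xs @ ys)"
    using assms(1,2) ne ps(3) unfolding R ps(2) reduced_append by (auto simp: last_inv_word)
  have "reduce (R @ w) = reduce (inv_word xs @ (inv_word ps @ ps) @ ys)" by (simp add: R ps(2))
  also have "\<dots> = reduce (inv_word xs @ reduce (reduce (inv_word ps @ ps) @ ys))"
    by (simp only: reduce_reduce_append reduce_append_reduce)
  also have "\<dots> = inv_word xs @ ys"
    unfolding reduce_inv_word_append using red by (simp add: reduce_append_reduce reduce_reduced)
  finally show ?thesis using ne by (simp add: ps(2))
qed

text \<open>Pairs of an index and a sign serve as letters of a second free group, so that formal
  products of generators are again words that can be reduced.\<close>

definition symbol_word :: "'a word list \<Rightarrow> nat letter \<Rightarrow> 'a word" where
  "symbol_word hs \<sigma> = (if snd \<sigma> then hs ! fst \<sigma> else inv_word (hs ! fst \<sigma>))"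

lemma symbol_word_bar: "symbol_word hs (bar \<sigma>) = inv_word (symbol_word hs \<sigma>)"
  by (cases \<sigma>) (simp add: symbol_word_def)

locale separated = words +
  fixes t :: nat
  assumes long: "\<And>h. h \<in> set hs \<Longrightarrow> 2 * t \<le> length h"
    and sep: "\<And>\<sigma> \<tau>. fst \<sigma> < length hs \<Longrightarrow> fst \<tau> < length hs \<Longrightarrow> \<sigma> \<noteq> \<tau> \<Longrightarrow>
      take t (symbol_word hs \<sigma>) \<noteq> take t (symbol_word hs \<tau>)"
begin

definition val :: "nat word \<Rightarrow> 'a fg" where
  "val P = sum_list (map (\<lambda>\<sigma>. el (symbol_word hs \<sigma>)) P)"

definition valid :: "nat word \<Rightarrow> bool" where
  "valid P \<longleftrightarrow> (\<forall>\<sigma>\<in>set P. fst \<sigma> < length hs)"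

lemma val_simps [simp]:
  "val [] = 0" "val (\<sigma> # P) = el (symbol_word hs \<sigma>) + val P" "val (P @ Q) = val P + val Q"
  by (simp_all add: val_def)

lemma val_push: "val (push \<sigma> P) = el (symbol_word hs \<sigma>) + val P"
proof (cases P)
  case (Cons \<tau> Q)
  show ?thesis
  proof (cases "\<tau> = bar \<sigma>")
    case True
    then have "el (symbol_word hs \<sigma>) + val P = el (symbol_word hs \<sigma>) + (- el (symbol_word hs \<sigma>) + val Q)"
      by (simp add: Cons symbol_word_bar el_inv_word)
    also have "\<dots> = val Q" by (simp only: add_minus_cancel)
    finally show ?thesis using True Cons by simp
  qed (use Cons in simp)
qed simp

lemma val_reduce: "val (reduce P) = val P"
  by (induction P) (simp_all add: reduce_def val_push)

lemma valid_push: "valid P \<Longrightarrow> fst \<sigma> < length hs \<Longrightarrow> valid (push \<sigma> P)"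
  unfolding valid_def by (cases P) auto

lemma valid_reduce: "valid P \<Longrightarrow> valid (reduce P)"
proof (induction P)
  case (Cons \<sigma> P)
  have "reduce (\<sigma> # P) = push \<sigma> (reduce P)" by (simp add: reduce_def)
  moreover have v: "valid P" "fst \<sigma> < length hs" using Cons.prems by (simp_all add: valid_def)
  ultimately show ?case using valid_push[OF Cons.IH[OF v(1)] v(2)] by simp
qed (simp add: reduce_def)

lemma H_val:
  assumes "g \<in> H"
  obtains P where "reduced_word P" "valid P" "val P = g"
proof -
  have "\<exists>P. valid P \<and> val P = g"
    using assms
  proof (induction rule: generated.induct)
    case zero
    show ?case by (rule exI[of _ "[]"]) (simp add: valid_def)
  next
    case (plus h b)
    then obtain P i where "valid P" "val P = h" "i < length hs" "b = el (hs ! i)"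
      unfolding B_def by (metis imageE in_set_conv_nth)
    then show ?case
      by (intro exI[of _ "P @ [(i, True)]"]) (simp add: valid_def symbol_word_def)
  next
    case (minus h b)
    then obtain P i where "valid P" "val P = h" "i < length hs" "b = el (hs ! i)"
      unfolding B_def by (metis imageE in_set_conv_nth)
    then show ?case
      by (intro exI[of _ "P @ [(i, False)]"]) (simp add: valid_def symbol_word_def el_inv_word)
  qed
  then show ?thesis using that val_reduce valid_reduce reduced_reduce by metis
qed

lemma symbol_word_props:
  assumes "fst \<sigma> < length hs"
  shows "reduced_word (symbol_word hs \<sigma>)" "2 * t \<le> length (symbol_word hs \<sigma>)"
  using cyclically_reducedD[OF cyc] long nth_mem[OF assms] by (auto simp: symbol_word_def)

text \<open>
  Starting inside the generator \<open>hs ! i\<close> at distance at least \<open>t\<close> from both of its ends, a reduced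
  product of generators cannot cancel completely: the last \<open>t\<close> letters remember the last factor.
\<close>

lemma product_invariant:
  fixes P :: "nat word"
  assumes i: "i < length hs" and j: "t \<le> j" "j + t \<le> length (hs ! i)"
    and P: "reduced_word P" "valid P"
  defines "g \<equiv> - el (take j (hs ! i)) + val P"
    and "\<sigma> \<equiv> if P = [] then (i, True) else bar (last P)"
  shows "t \<le> length (rep g) \<and> take t (inv_word (rep g)) = take t (symbol_word hs \<sigma>)"
  using P unfolding g_def \<sigma>_def
proof (induction P rule: rev_induct)
  case Nil
  have red: "reduced_word (take j (hs ! i))"
    using i cyc cyclically_reducedD reduced_take nth_mem by blast
  then have "rep (- el (take j (hs ! i))) = inv_word (take j (hs ! i))"
    by (simp add: rep_uminus rep_el_reduced)
  then show ?case using j by (simp add: symbol_word_def min_def)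
next
  case (snoc \<tau> P)
  have redh: "reduced_word (hs ! i)" using i cyc cyclically_reducedD nth_mem by blast
  have \<tau>: "fst \<tau> < length hs" and vP: "valid P" and rP: "reduced_word P"
    and red: "P \<noteq> [] \<Longrightarrow> \<tau> \<noteq> bar (last P)"
    using snoc.prems by (auto simp: valid_def reduced_append)
  show ?case
  proof (cases "P = [] \<and> \<tau> = (i, True)")
    \<comment> \<open>The first factor may continue the generator in which the walk starts. It then
      cancels the \<open>j\<close> letters already read, and the remainder still has at least
      \<open>t\<close> letters.\<close>
    case True
    have th: "take j (hs ! i) @ drop j (hs ! i) = hs ! i" by simp
    have "- el (take j (hs ! i)) + el (hs ! i) = - el (take j (hs ! i)) + (el (take j (hs ! i)) + el (drop j (hs ! i)))"
      by (simp only: el_append[symmetric] th)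
    also have "\<dots> = el (drop j (hs ! i))" by (simp only: minus_add_cancel)
    finally have "rep (- el (take j (hs ! i)) + el (hs ! i)) = drop j (hs ! i)"
      using reduced_drop[OF redh] by (simp only: rep_el_reduced)
    moreover have "inv_word (hs ! i) = inv_word (drop j (hs ! i)) @ inv_word (take j (hs ! i))"
      by (metis th inv_word_simps(3))
    ultimately show ?thesis using True j by (simp add: symbol_word_def)
  next
    case False
    define g where "g = - el (take j (hs ! i)) + val P"
    define \<sigma> where "\<sigma> = (if P = [] then (i, True) else bar (last P))"
    have IH: "t \<le> length (rep g)" "take t (inv_word (rep g)) = take t (symbol_word hs \<sigma>)"
      using snoc.IH[OF rP vP] unfolding g_def \<sigma>_def by blast+
    have "fst \<sigma> < length hs"
    proof (cases "P = []")
      case False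
      then have "fst (last P) < length hs" using vP by (simp add: valid_def)
      then show ?thesis using False by (cases "last P") (simp add: \<sigma>_def)
    qed (use i in \<open>simp add: \<sigma>_def\<close>)
    moreover have "\<sigma> \<noteq> \<tau>" using False red by (auto simp: \<sigma>_def)
    ultimately have "take t (inv_word (rep g)) \<noteq> take t (symbol_word hs \<tau>)"
      using sep \<tau> IH(2) by metis
    note c = reduce_cancel[OF reduced_rep symbol_word_props(1)[OF \<tau>] IH(1) symbol_word_props(2)[OF \<tau>] this]
    have "- el (take j (hs ! i)) + val (P @ [\<tau>]) = g + el (symbol_word hs \<tau>)"
      by (simp add: g_def add.assoc)
    moreover have "rep (g + el (symbol_word hs \<tau>)) = reduce (rep g @ symbol_word hs \<tau>)"
      by (simp add: rep_plus rep_el reduce_append_reduce)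
    ultimately show ?thesis using c by (simp add: symbol_word_bar)
  qed
qed

text \<open>Equal vertices yield a reduced product of generators joining two prefixes. By the
  invariant it is empty or ends with the inverse of \<open>hs ! i'\<close>; removing that factor
  leads to the other side of the position, where the invariant forces a cancellation excluded by
  reducedness.\<close>

lemma vert_inj:
  assumes i: "i < length hs" and j: "t \<le> j" "j + t \<le> length (hs ! i)"
    and i': "i' < length hs" and j': "t \<le> j'" "j' + t \<le> length (hs ! i')"
    and eq: "vert H (hs ! i) j = vert H (hs ! i') j'"
  shows "i = i' \<and> j = j'"
proof -
  define u u' where "u = take j (hs ! i)" and "u' = take j' (hs ! i')"
  have redu: "reduced_word u" "reduced_word u'" and redh': "reduced_word (hs ! i')"
    using i i' cyc cyclically_reducedD reduced_take nth_mem unfolding u_def u'_def by blast+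
  have "0 \<in> H" by (rule generated.zero)
  then have "- el u' \<in> vert H (hs ! i') j'" by (simp add: vert_def u'_def mem_translate)
  then have "- el u' \<in> vert H (hs ! i) j" by (simp only: eq)
  then have "el u + - el u' \<in> H"
    by (simp only: vert_def u_def[symmetric] mem_translate minus_minus)
  then obtain P where P: "reduced_word P" "valid P" "val P = el u + - el u'" by (rule H_val)
  have uP: "- el u + val P = - el u'" unfolding P(3) by (simp only: minus_add_cancel)
  have tu': "take t u' = take t (hs ! i')" using j' by (simp add: u'_def min_def)
  have inv: "take t (symbol_word hs (if P = [] then (i, True) else bar (last P))) = take t u'"
    using product_invariant[OF i j P(1,2)] uP redu(2)
    by (simp add: u_def[symmetric] rep_uminus rep_el_reduced)
  define \<sigma> where "\<sigma> = (if P = [] then (i, True) else bar (last P))"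
  have "\<sigma> = (i', True)"
  proof (rule ccontr)
    assume "\<sigma> \<noteq> (i', True)"
    moreover have "fst \<sigma> < length hs"
    proof (cases "P = []")
      case False
      then have "fst (last P) < length hs" using P(2) by (simp add: valid_def)
      then show ?thesis using False by (cases "last P") (simp add: \<sigma>_def)
    qed (use i in \<open>simp add: \<sigma>_def\<close>)
    ultimately have "take t (symbol_word hs \<sigma>) \<noteq> take t (symbol_word hs (i', True))"
      using sep i' by simp
    then show False using inv tu' by (simp add: \<sigma>_def symbol_word_def)
  qed
  show ?thesis
  proof (cases "P = []")
    case True
    then have "i = i'" using \<open>\<sigma> = (i', True)\<close> by (simp add: \<sigma>_def)
    have "el u = el u'" using uP True by simp
    then have "u = u'" using redu by (metis rep_el_reduced)
    then have "length u = length u'" by simp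
    then show ?thesis using \<open>i = i'\<close> j j' by (simp add: u_def u'_def)
  next
    case False
    then obtain Q where Q: "P = Q @ [(i', False)]"
      using \<open>\<sigma> = (i', True)\<close> by (cases P rule: rev_cases) (auto simp: \<sigma>_def bar_eq_swap)
    have Qv: "reduced_word Q" "valid Q" and Ql: "Q \<noteq> [] \<Longrightarrow> (i', False) \<noteq> bar (last Q)"
      using P(1,2) unfolding Q by (auto simp: reduced_append valid_def)
    define v where "v = drop j' (hs ! i')"
    have h': "hs ! i' = u' @ v" by (simp add: u'_def v_def)
    have "val P = val Q + - el (hs ! i')" by (simp add: Q symbol_word_def el_inv_word)
    then have "- el u + (val Q + - el (hs ! i')) = - el u'" using uP by (simp only:)
    then have "- el u + val Q + - el (hs ! i') = - el u'" by (simp only: add.assoc)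
    then have "- el u + val Q = - el u' + el (hs ! i')" by (metis add.assoc add.right_neutral left_minus)
    also have "\<dots> = el v" unfolding h' el_append by (simp only: minus_add_cancel)
    finally have uQ: "- el u + val Q = el v" .
    have redv: "reduced_word v" unfolding v_def using redh' by (rule reduced_drop)
    define \<rho> where "\<rho> = (if Q = [] then (i, True) else bar (last Q))"
    have "take t (symbol_word hs \<rho>) = take t (inv_word v)"
      using product_invariant[OF i j Qv] uQ redv
      by (simp add: u_def[symmetric] \<rho>_def rep_el_reduced)
    also have "\<dots> = take t (symbol_word hs (i', False))"
    proof -
      have "t \<le> length v" using j' by (simp add: v_def)
      then show ?thesis by (simp add: symbol_word_def h')
    qed
    finally have eq\<rho>: "take t (symbol_word hs \<rho>) = take t (symbol_word hs (i', False))" .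
    have "fst \<rho> < length hs"
    proof (cases "Q = []")
      case False
      then have "fst (last Q) < length hs" using Qv(2) by (simp add: valid_def)
      then show ?thesis using False by (cases "last Q") (simp add: \<rho>_def)
    qed (use i in \<open>simp add: \<rho>_def\<close>)
    then have "\<rho> = (i', False)" using sep[of \<rho> "(i', False)"] i' eq\<rho> by auto
    then show ?thesis using Ql by (cases "Q = []") (auto simp: \<rho>_def)
  qed
qed

text \<open>Distinct positions at distance at least \<open>t\<close> from the ends give distinct
  split cosets; at most \<open>2 * t\<close> turns are discarded per generator.\<close>

lemma nsplit_ge: "(\<Sum>i<length hs. turns S (hs ! i)) \<le> nsplit H (branches S) + 2 * t * length hs"
proof -
  define J where "J i = {j. j < length (hs ! i) \<and> turn S (hs ! i) j}" for i
  define J' where "J' i = {j \<in> J i. t \<le> j \<and> j + t \<le> length (hs ! i)}" for i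
  have fin: "finite (J i)" for i by (simp add: J_def)
  have J: "turns S (hs ! i) \<le> card (J' i) + 2 * t" if "i < length hs" for i
  proof -
    have "2 * t \<le> length (hs ! i)" using long that by simp
    then have "J i \<subseteq> J' i \<union> ({..<t} \<union> {length (hs ! i) - t..<length (hs ! i)})"
      by (auto simp: J_def J'_def)
    then have "card (J i) \<le> card (J' i \<union> ({..<t} \<union> {length (hs ! i) - t..<length (hs ! i)}))"
      using fin by (intro card_mono) (auto simp: J'_def)
    also have "\<dots> \<le> card (J' i) + (card {..<t} + card {length (hs ! i) - t..<length (hs ! i)})"
      by (meson add_left_mono card_Un_le le_trans)
    also have "\<dots> \<le> card (J' i) + 2 * t" by simp
    finally show ?thesis by (simp add: turns_def J_def)
  qed
  have finJ: "finite (J' i)" for i using fin by (simp add: J'_def)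
  have "(\<Sum>i<length hs. turns S (hs ! i)) \<le> (\<Sum>i<length hs. card (J' i) + 2 * t)"
    using J by (intro sum_mono) simp
  also have "\<dots> = (\<Sum>i<length hs. card (J' i)) + 2 * t * length hs"
    by (simp add: sum.distrib)
  also have "(\<Sum>i<length hs. card (J' i)) = card (SIGMA i:{..<length hs}. J' i)"
    using finJ by simp
  also have "\<dots> \<le> nsplit H (branches S)"
  proof (rule card_inj_on_le[of "\<lambda>(i, j). vert H (hs ! i) j"])
    show "inj_on (\<lambda>(i, j). vert H (hs ! i) j) (SIGMA i:{..<length hs}. J' i)"
      unfolding inj_on_def J'_def using vert_inj by auto
    show "(\<lambda>(i, j). vert H (hs ! i) j) ` (SIGMA i:{..<length hs}. J' i) \<subseteq> Split H (branches S)"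
      unfolding J'_def J_def using vert_Split by auto
    show "finite (Split H (branches S))"
      using finite_B almost_invariant_branches by (rule finite_Split)
  qed
  finally show ?thesis by simp
qed

end

text \<open>The frequency with which the two directions at a vertex of a long random reduced word are separated by \<open>S\<close>.\<close>

definition turn_freq :: "'a::finite letter set \<Rightarrow> real" where
  "turn_freq S = real (card S) * (2 * real CARD('a) - real (card S)) / (real CARD('a) * (2 * real CARD('a) - 1))"

section \<open>Turn frequencies and the gap inequalities\<close>

lemma turn_freq_singleton:
  assumes "CARD('a::finite) \<ge> 2"
  shows "turn_freq {x :: 'a letter} = 1 / real CARD('a)"
  using assms by (simp add: turn_freq_def)

text \<open>With \<open>s = card S\<close> the frequency is proportional to the concave function
  \<open>s * (2 r - s)\<close>, which on the allowed range is smallest at the endpoints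
  \<open>2\<close> and \<open>2 r - 2\<close>.\<close>

lemma turn_freq_ge:
  fixes S :: "'a::finite letter set"
  assumes r: "CARD('a) \<ge> 2" and S: "2 \<le> card S" "card S + 2 \<le> CARD('a letter)"
  shows "1 / real CARD('a) + (2 * real CARD('a) - 3) / (real CARD('a) * (2 * real CARD('a) - 1)) \<le> turn_freq S"
proof -
  define r s where "r = real CARD('a)" and "s = real (card S)"
  have rs: "r \<ge> 2" "s \<ge> 2" "s \<le> 2 * r - 2" using assms by (simp_all add: r_def s_def)
  have "0 \<le> (s - 2) * (2 * r - 2 - s)" using rs by simp
  then have "4 * r - 4 \<le> s * (2 * r - s)" by (simp add: algebra_simps)
  then have "(4 * r - 4) / (r * (2 * r - 1)) \<le> s * (2 * r - s) / (r * (2 * r - 1))"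
    using rs by (intro divide_right_mono) auto
  moreover have "1 / r + (2 * r - 3) / (r * (2 * r - 1)) = (4 * r - 4) / (r * (2 * r - 1))"
    using rs by (simp add: field_simps)
  ultimately show ?thesis by (simp add: turn_freq_def r_def s_def)
qed

text \<open>Turn counts give lower bounds for all vertex cuts. An upper bound for one letter follows
  by subtracting the lower bounds of the others from the total edge count, which is at most
  \<open>N\<close>.\<close>

lemma (in separated) minimal:
  fixes \<epsilon> :: real
  defines "r \<equiv> real CARD('a)" and "N \<equiv> real (\<Sum>i<length hs. length (hs ! i))"
  assumes card: "CARD('a) \<ge> 2"
    and turns: "\<And>S. S \<noteq> {} \<Longrightarrow> S \<noteq> UNIV \<Longrightarrow> (turn_freq S - \<epsilon>) * N \<le> real (\<Sum>i<length hs. turns S (hs ! i))"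
    and t: "real (2 * t * length hs) \<le> \<epsilon> * N" and k: "real (length hs + 1) \<le> \<epsilon> * N"
    and eps: "(4 * r + 1) * \<epsilon> \<le> (2 * r - 3) / (r * (2 * r - 1))"
  shows "strictly_whitehead_minimal (rep ` H)"
proof -
  have r: "r \<ge> 2" using card by (simp add: r_def)
  have N: "N \<ge> 0" by (simp only: N_def of_nat_0_le_iff)
  define m where "m x = real (nsplit H (branch x))" for x
  define M where "M S = real (nsplit H (branches S))" for S
  have lower: "(turn_freq S - 2 * \<epsilon>) * N \<le> M S" if "S \<noteq> {}" "S \<noteq> UNIV" for S
  proof -
    have "real (\<Sum>i<length hs. turns S (hs ! i)) \<le> real (nsplit H (branches S) + 2 * t * length hs)"
      using nsplit_ge by (rule of_nat_mono)
    also have "\<dots> = M S + real (2 * t * length hs)" by (simp only: M_def of_nat_add)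
    finally show ?thesis using turns[OF that] t by (simp only: left_diff_distrib)
  qed
  have lower1: "(1 / r - 2 * \<epsilon>) * N \<le> m x" for x
  proof -
    have "{x} \<noteq> (UNIV :: 'a letter set)"
    proof -
      obtain w where "w \<noteq> x" using third_letter[OF card] by blast
      then show ?thesis by blast
    qed
    from lower[OF _ this] show ?thesis
      unfolding turn_freq_singleton[OF card] M_def m_def r_def branch_branches by simp
  qed
  have upper1: "m (a, True) \<le> (1 / r + 2 * (r - 1) * \<epsilon>) * N" for a
  proof -
    have "(\<Sum>b\<in>UNIV. m (b, True)) \<le> N"
      unfolding m_def N_def of_nat_sum[symmetric] by (rule of_nat_mono) (rule sum_nsplit_le)
    moreover have "(\<Sum>b\<in>UNIV. m (b, True)) = m (a, True) + (\<Sum>b\<in>UNIV - {a}. m (b, True))"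
      by (rule sum.remove) simp_all
    moreover have "real (card (UNIV - {a})) * ((1 / r - 2 * \<epsilon>) * N) \<le> (\<Sum>b\<in>UNIV - {a}. m (b, True))"
      using lower1 by (intro sum_bounded_below) auto
    moreover have "real (card (UNIV - {a})) = r - 1" using card by (simp add: r_def card_Diff_subset of_nat_diff)
    ultimately have "m (a, True) \<le> N - (r - 1) * ((1 / r - 2 * \<epsilon>) * N)" by simp
    also have "\<dots> = (1 / r + 2 * (r - 1) * \<epsilon>) * N" using r by (simp add: field_simps)
    finally show ?thesis .
  qed
  have upper: "m x \<le> (1 / r + 2 * (r - 1) * \<epsilon>) * N" for x
  proof (cases "snd x")
    case True
    then show ?thesis using upper1[of "fst x"] by (metis prod.collapse)
  next
    case False
    then have "bar x = (fst x, True)" by (cases x) simp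
    then have "m x = m (fst x, True)" using nsplit_bar[of H x] by (simp add: m_def)
    then show ?thesis using upper1 by simp
  qed
  \<comment> \<open>Two upper bounds cost \<open>4 * (r - 1)\<close> times
    \<open>\<epsilon> * N\<close>, two lower bounds cost \<open>2\<close> each, and the number of
    generators costs \<open>1\<close>; this adds up to the factor \<open>4 * r + 1\<close>.\<close>
  have main: "nsplit H (branch z) + length hs + 1 + nsplit H (branch x) \<le> nsplit H (branches S) + nsplit H (branch y)"
    if S: "2 \<le> card S" "card S + 2 \<le> CARD('a letter)" for S x y z
  proof -
    have ne: "S \<noteq> {}" "S \<noteq> UNIV" using S by auto
    have q: "1 / r + (2 * r - 3) / (r * (2 * r - 1)) \<le> turn_freq S"
      unfolding r_def by (rule turn_freq_ge[OF card S])
    have "(4 * r + 1) * \<epsilon> * N \<le> (turn_freq S - 1 / r) * N"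
      using eps q N by (intro mult_right_mono) auto
    moreover have "2 * ((c + 2 * (r - 1) * \<epsilon>) * N) + \<epsilon> * N \<le>
        (turn_freq S - 2 * \<epsilon>) * N + (c - 2 * \<epsilon>) * N"
      if "(4 * r + 1) * \<epsilon> * N \<le> (turn_freq S - c) * N" for c
      using that by (simp add: algebra_simps)
    ultimately have "2 * ((1 / r + 2 * (r - 1) * \<epsilon>) * N) + \<epsilon> * N \<le>
        (turn_freq S - 2 * \<epsilon>) * N + (1 / r - 2 * \<epsilon>) * N"
      by blast
    then have "m z + real (length hs + 1) + m x \<le> M S + m y"
      using upper[of z] upper[of x] lower[OF ne] lower1[of y] k by linarith
    then have "real (nsplit H (branch z) + length hs + 1 + nsplit H (branch x)) \<le>
        real (nsplit H (branches S) + nsplit H (branch y))"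
      by (simp add: m_def M_def)
    then show ?thesis by (simp only: of_nat_le_iff)
  qed
  define L where "L = Max (range (\<lambda>x. nsplit H (branch x))) + length hs + 1"
  have Lge: "nsplit H (branch x) + length hs + 1 \<le> L" for x
    unfolding L_def by (simp add: Max_ge)
  obtain z where z: "L = nsplit H (branch z) + length hs + 1"
  proof -
    have "Max (range (\<lambda>x. nsplit H (branch x))) \<in> range (\<lambda>x. nsplit H (branch x))"
      by (rule Max_in) auto
    then obtain z where "Max (range (\<lambda>x. nsplit H (branch x))) = nsplit H (branch z)" by (rule rangeE)
    then show ?thesis using that unfolding L_def by metis
  qed
  have "gap H L"
  proof
    show "finite (Split H (branches S))" for S
      using finite_B almost_invariant_branches by (rule finite_Split)
    show "nsplit H (branch x) \<le> L" for x using Lge[of x] by simp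
    show "L + nsplit H (branch x) \<le> nsplit H (branches S) + nsplit H (branch y)"
      if "2 \<le> card S" "card S + 2 \<le> CARD('a letter)" for S x y
      unfolding z by (rule main[OF that])
  qed
  moreover have "nsplit H (branch x) + card B + 1 \<le> L" for x
    using Lge[of x] card_B by linarith
  ultimately show ?thesis
    using minimality_criterion[OF card finite_B] core_subset_spread by blast
qed

section \<open>Counting reduced words\<close>

text \<open>Words of length \<open>m\<close> that may follow the letter \<open>x\<close>: the
  trajectories of the letter chain started at \<open>x\<close>.\<close>

definition conts :: "'a letter \<Rightarrow> nat \<Rightarrow> 'a word set" where
  "conts x m = {w. length w = m \<and> reduced_word (x # w)}"

lemma conts_0 [simp]: "conts x 0 = {[]}"
  by (auto simp: conts_def)

lemma conts_Suc: "conts x (Suc m) = (\<Union>y\<in>- {bar x}. (#) y ` conts y m)"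
proof (rule Set.set_eqI)
  fix w
  show "w \<in> conts x (Suc m) \<longleftrightarrow> w \<in> (\<Union>y\<in>- {bar x}. (#) y ` conts y m)"
    by (cases w) (auto simp: conts_def reduced_Cons[of x] image_iff)
qed

lemma finite_conts [simp]: "finite (conts (x :: 'a::finite letter) m)"
  by (induction m arbitrary: x) (simp_all add: conts_Suc)

lemma sum_conts_Suc:
  fixes F :: "'a::finite word \<Rightarrow> 'b::comm_monoid_add"
  shows "(\<Sum>w\<in>conts x (Suc m). F w) = (\<Sum>y\<in>- {bar x}. \<Sum>w\<in>conts y m. F (y # w))"
proof -
  have "(\<Sum>w\<in>conts x (Suc m). F w) = (\<Sum>y\<in>- {bar x}. \<Sum>w\<in>(#) y ` conts y m. F w)"
    unfolding conts_Suc by (rule sum.UNION_disjoint) auto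
  also have "\<dots> = (\<Sum>y\<in>- {bar x}. \<Sum>w\<in>conts y m. F (y # w))"
    by (simp add: sum.reindex)
  finally show ?thesis .
qed

lemma card_Compl_letter: "card (- {x :: 'a::finite letter}) = 2 * CARD('a) - 1"
  by (simp add: Compl_eq_Diff_UNIV card_Diff_subset)

lemma card_conts: "card (conts (x :: 'a::finite letter) m) = (2 * CARD('a) - 1) ^ m"
proof -
  have "(\<Sum>w\<in>conts x m. 1 :: nat) = (2 * CARD('a) - 1) ^ m"
  proof (induction m arbitrary: x)
    case (Suc m)
    then show ?case unfolding sum_conts_Suc by (simp add: card_Compl_letter)
  qed simp
  then show ?thesis by simp
qed

section \<open>Large deviations for the turns of a random reduced word\<close>

fun turn_count :: "'a letter set \<Rightarrow> 'a letter \<Rightarrow> 'a word \<Rightarrow> nat" where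
  "turn_count S x [] = 0"
| "turn_count S x (y # w) = of_bool ((y \<in> S) \<noteq> (bar x \<in> S)) + turn_count S y w"

lemma card_turns:
  "card {j. j < length w \<and> (w ! j \<in> S) \<noteq> (bar (last (x # take j w)) \<in> S)} = turn_count S x w"
proof (induction w arbitrary: x)
  case (Cons y w)
  define J where "J = {j. j < length w \<and> (w ! j \<in> S) \<noteq> (bar (last (y # take j w)) \<in> S)}"
  have "{j. j < length (y # w) \<and> ((y # w) ! j \<in> S) \<noteq> (bar (last (x # take j (y # w))) \<in> S)}
      = (if (y \<in> S) \<noteq> (bar x \<in> S) then {0} else {}) \<union> Suc ` J"
  proof (rule Set.set_eqI)
    fix j
    show "j \<in> {j. j < length (y # w) \<and> ((y # w) ! j \<in> S) \<noteq> (bar (last (x # take j (y # w))) \<in> S)}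
      \<longleftrightarrow> j \<in> (if (y \<in> S) \<noteq> (bar x \<in> S) then {0} else {}) \<union> Suc ` J"
      by (cases j) (auto simp: J_def)
  qed
  moreover have "card (Suc ` J) = turn_count S y w"
    using Cons.IH[of y] by (simp add: J_def card_image)
  moreover have "finite J" by (simp add: J_def)
  ultimately show ?case by (simp add: card_insert_if)
qed simp

lemma turns_eq: "h \<noteq> [] \<Longrightarrow> turns S h = turn_count S (last h) h"
  unfolding turns_def turn_def by (simp add: card_turns[symmetric] last_append)

text \<open>Only the turn across the cyclic join is dropped, the one whose predecessor is not
  visible in a chain started at \<open>y\<close>.\<close>

lemma turns_Cons_ge: "turn_count S y w \<le> turns S (y # w)"
  by (simp add: turns_eq)

lemma exp_le_quadratic:
  assumes "\<bar>u\<bar> \<le> (1::real)"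
  shows "exp u \<le> 1 + u + u\<^sup>2"
proof (cases "u \<ge> 0")
  case True
  then show ?thesis using assms exp_bound by simp
next
  case False
  have "1 - u \<le> exp (- u)" using exp_ge_add_one_self[of "- u"] by simp
  then have "exp u \<le> 1 / (1 - u)" using False by (simp add: exp_minus field_simps)
  also have "\<dots> \<le> 1 + u + u\<^sup>2"
  proof -
    have "(1 + u + u\<^sup>2) * (1 - u) = 1 - u ^ 3" by (simp add: algebra_simps power2_eq_square power3_eq_cube)
    moreover have "u ^ 3 \<le> 0" using False mult_nonneg_nonpos[of "u * u" u] by (simp add: power3_eq_cube)
    ultimately show ?thesis using False by (simp add: pos_divide_le_eq)
  qed
  finally show ?thesis .
qed

text \<open>The linear term of the exponential averages to zero, so only the quadratic term survives
  in the bound.\<close>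

lemma sum_exp_le:
  fixes X :: "'b \<Rightarrow> real"
  assumes "finite A" "(\<Sum>y\<in>A. X y) = 0" and X: "\<And>y. y \<in> A \<Longrightarrow> \<bar>X y\<bar> \<le> c" and l: "0 \<le> l" "l * c \<le> 1"
  shows "(\<Sum>y\<in>A. exp (- l * X y)) \<le> real (card A) * exp ((l * c)\<^sup>2)"
proof -
  have "exp (- l * X y) \<le> 1 - l * X y + (l * c)\<^sup>2" if "y \<in> A" for y
  proof -
    have b: "\<bar>- l * X y\<bar> \<le> l * c" using mult_left_mono[OF X[OF that] l(1)] l(1) by (simp add: abs_mult)
    then have "exp (- l * X y) \<le> 1 + - l * X y + (- l * X y)\<^sup>2" using l by (intro exp_le_quadratic) simp
    moreover have "(- l * X y)\<^sup>2 \<le> (l * c)\<^sup>2" using b by (metis abs_ge_zero power2_abs power_mono)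
    ultimately show ?thesis by simp
  qed
  then have "(\<Sum>y\<in>A. exp (- l * X y)) \<le> (\<Sum>y\<in>A. 1 - l * X y + (l * c)\<^sup>2)"
    by (rule sum_mono)
  also have "\<dots> = real (card A) * (1 + (l * c)\<^sup>2)"
    using assms(2) by (simp add: sum.distrib sum_subtractf algebra_simps flip: sum_distrib_left)
  also have "\<dots> \<le> real (card A) * exp ((l * c)\<^sup>2)"
    by (intro mult_left_mono) auto
  finally show ?thesis .
qed

text \<open>
  Along a random reduced word the indicator of a turn separated by \<open>S\<close>, minus its mean, is a
  martingale increment up to the coboundary of \<open>pot S\<close>: this is the solution of the Poisson equation
  of the Markov chain of letters.
\<close>

definition pot_coeff :: "'a::finite letter set \<Rightarrow> real" where
  "pot_coeff S = (let d = 2 * real CARD('a) - 1 in (d + 1 - 2 * real (card S)) * d / (d\<^sup>2 - 1))"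

definition pot :: "'a::finite letter set \<Rightarrow> 'a letter \<Rightarrow> real" where
  "pot S x = pot_coeff S * (of_bool (bar x \<in> S) - of_bool (x \<in> S) / (2 * real CARD('a) - 1))"

definition increment :: "'a::finite letter set \<Rightarrow> 'a letter \<Rightarrow> 'a letter \<Rightarrow> real" where
  "increment S x y = of_bool ((y \<in> S) \<noteq> (bar x \<in> S)) - turn_freq S - pot S x + pot S y"

text \<open>The first identity makes the part of the mean increment that depends on \<open>x\<close>
  vanish; the other two make the constant part vanish.\<close>

lemma pot_coeff_eqs:
  fixes S :: "'a::finite letter set"
  assumes "CARD('a) \<ge> 2"
  defines "d \<equiv> 2 * real CARD('a) - 1" and "s \<equiv> real (card S)"
  shows "pot_coeff S * d - pot_coeff S / d = d + 1 - 2 * s"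
    and "pot_coeff S - pot_coeff S / d = 1 - 2 * s / (d + 1)"
    and "d * turn_freq S = s * (2 - 2 * s / (d + 1))"
proof -
  have d: "d \<ge> 3" using assms by simp
  have "d * d \<ge> 3 * 3" using d by (intro mult_mono) auto
  then have d2: "d\<^sup>2 - 1 > 0" by (simp add: power2_eq_square)
  have a: "pot_coeff S = (d + 1 - 2 * s) * d / (d\<^sup>2 - 1)" unfolding pot_coeff_def d_def s_def Let_def ..
  have cancel: "(x * d / D) * (D / d) = x" if "D \<noteq> 0" for x D using d that by simp
  have "pot_coeff S * d - pot_coeff S / d = pot_coeff S * ((d\<^sup>2 - 1) / d)"
    using d by (simp add: field_simps power2_eq_square)
  also have "\<dots> = d + 1 - 2 * s" unfolding a using d2 by (intro cancel) simp
  finally show 1: "pot_coeff S * d - pot_coeff S / d = d + 1 - 2 * s" .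
  have "(pot_coeff S - pot_coeff S / d) * (d + 1) = pot_coeff S * d - pot_coeff S / d"
    using d by (simp add: field_simps)
  then have "pot_coeff S - pot_coeff S / d = (d + 1 - 2 * s) / (d + 1)"
    using d 1 by (simp add: eq_divide_eq)
  then show "pot_coeff S - pot_coeff S / d = 1 - 2 * s / (d + 1)" using d by (simp add: diff_divide_distrib)
  define r where "r = real CARD('a)"
  have r: "r > 0" "d + 1 = 2 * r" using assms by (simp_all add: r_def)
  have "turn_freq S = s * (2 * r - s) / (r * d)"
    unfolding turn_freq_def r_def s_def d_def ..
  then have "d * turn_freq S = s * (2 * r - s) / r" using d by simp
  also have "\<dots> = s * (2 - 2 * s / (d + 1))" unfolding r(2) using r(1) by (simp add: field_simps)
  finally show "d * turn_freq S = s * (2 - 2 * s / (d + 1))" .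
qed

lemma bij_bar: "bij bar"
  by (rule bij_betw_byWitness[where f' = bar]) auto

lemma sum_increment:
  fixes S :: "'a::finite letter set"
  assumes card: "CARD('a) \<ge> 2"
  shows "(\<Sum>y\<in>- {bar x}. increment S x y) = 0"
proof -
  define d s where "d = 2 * real CARD('a) - 1" and "s = real (card S)"
  define \<alpha> where "\<alpha> = pot_coeff S"
  note eqs = pot_coeff_eqs[OF card, of S, folded d_def s_def \<alpha>_def]
  have d: "d \<ge> 3" using card by (simp add: d_def)
  have cardC: "real (card (- {bar x})) = d"
    using card by (simp add: card_Compl_letter d_def of_nat_diff)
  have minus: "(\<Sum>y\<in>- {bar x}. F y) = (\<Sum>y\<in>UNIV. F y) - F (bar x)" for F :: "'a letter \<Rightarrow> real"
    using sum.remove[of UNIV "bar x" F] by (simp add: Compl_eq_Diff_UNIV)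
  have S1: "(\<Sum>y\<in>UNIV. of_bool (y \<in> S)) = s" by (simp add: s_def sum.If_cases of_bool_def)
  have S2: "(\<Sum>y\<in>UNIV. of_bool (bar y \<in> S)) = s"
    by (rule trans[OF sum.reindex_bij_betw[OF bij_bar, of "\<lambda>y. of_bool (y \<in> S)"] S1])
  have sp: "(\<Sum>y\<in>UNIV. pot S y) = \<alpha> * (s - s / d)"
  proof -
    have "(\<Sum>y\<in>UNIV. pot S y) = \<alpha> * ((\<Sum>y\<in>UNIV. of_bool (bar y \<in> S)) - (\<Sum>y\<in>UNIV. of_bool (y \<in> S)) / d)"
      unfolding pot_def \<alpha>_def[symmetric] d_def[symmetric]
      by (simp only: sum_distrib_left[symmetric] sum_subtractf sum_divide_distrib[symmetric])
    then show ?thesis by (simp only: S1 S2)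
  qed
  have g: "(\<Sum>y\<in>- {bar x}. of_bool ((y \<in> S) \<noteq> (bar x \<in> S))) = s + of_bool (bar x \<in> S) * (d + 1 - 2 * s)"
  proof (cases "bar x \<in> S")
    case True
    have "(\<Sum>y\<in>UNIV. of_bool (y \<notin> S)) = (\<Sum>y\<in>UNIV. 1 - of_bool (y \<in> S) :: real)"
      by (intro sum.cong) auto
    also have "\<dots> = (d + 1) - s" unfolding sum_subtractf S1 by (simp add: d_def)
    finally show ?thesis unfolding minus using True by simp
  next
    case False
    then show ?thesis unfolding minus using S1 by simp
  qed
  have "(\<Sum>y\<in>- {bar x}. increment S x y) =
      (\<Sum>y\<in>- {bar x}. of_bool ((y \<in> S) \<noteq> (bar x \<in> S))) - d * turn_freq S - d * pot S x + (\<Sum>y\<in>- {bar x}. pot S y)"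
    unfolding increment_def by (simp only: sum.distrib sum_subtractf sum_constant cardC)
  also have "\<dots> = s + of_bool (bar x \<in> S) * (d + 1 - 2 * s) - s * (2 - 2 * s / (d + 1)) - d * pot S x
      + \<alpha> * (s - s / d) - pot S (bar x)"
    unfolding g eqs(3) minus[of "pot S"] sp by simp
  \<comment> \<open>The second term in \<open>pot\<close> is chosen so that the contributions of
    \<open>x \<in> S\<close> cancel here and only those of \<open>bar x \<in> S\<close>
    remain.\<close>
  also have "d * pot S x + pot S (bar x) = of_bool (bar x \<in> S) * (\<alpha> * d - \<alpha> / d)"
    unfolding pot_def \<alpha>_def[symmetric] d_def[symmetric] bar_bar using d by (simp add: field_simps)
  then have "d * pot S x = of_bool (bar x \<in> S) * (d + 1 - 2 * s) - pot S (bar x)"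
    unfolding eqs(1) by simp
  also have "\<alpha> * (s - s / d) = s * (\<alpha> - \<alpha> / d)" by (simp add: field_simps)
  finally show ?thesis unfolding eqs(2) by (simp add: algebra_simps)
qed

lemma turn_freq_bounds:
  fixes S :: "'a::finite letter set"
  assumes card: "CARD('a) \<ge> 2"
  shows "0 \<le> turn_freq S" "turn_freq S \<le> 1"
proof -
  define r s where "r = real CARD('a)" and "s = real (card S)"
  have r: "r \<ge> 2" using card by (simp add: r_def)
  have "card S \<le> card (UNIV :: 'a letter set)" by (rule card_mono) auto
  then have "card S \<le> 2 * CARD('a)" by simp
  then have "real (card S) \<le> real (2 * CARD('a))" by (rule of_nat_mono)
  then have s: "0 \<le> s" "s \<le> 2 * r" by (simp_all add: s_def r_def)
  have tf: "turn_freq S = s * (2 * r - s) / (r * (2 * r - 1))" by (simp add: turn_freq_def r_def s_def)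
  show "0 \<le> turn_freq S" unfolding tf using r s by simp
  have "0 \<le> (s - r)\<^sup>2" by simp
  then have "s * (2 * r - s) \<le> r * r" by (simp add: power2_eq_square algebra_simps)
  also have "\<dots> \<le> r * (2 * r - 1)" using r by simp
  finally show "turn_freq S \<le> 1" unfolding tf using r by (simp add: divide_le_eq)
qed

lemma abs_pot_le:
  fixes S :: "'a::finite letter set"
  assumes card: "CARD('a) \<ge> 2"
  shows "\<bar>pot S x\<bar> \<le> 2"
proof -
  define d s where "d = 2 * real CARD('a) - 1" and "s = real (card S)"
  define \<alpha> where "\<alpha> = pot_coeff S"
  note eqs = pot_coeff_eqs[OF card, of S, folded d_def s_def \<alpha>_def]
  have d: "d \<ge> 3" using card by (simp add: d_def)
  have "card S \<le> card (UNIV :: 'a letter set)" by (rule card_mono) auto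
  then have "card S \<le> 2 * CARD('a)" by simp
  then have "real (card S) \<le> real (2 * CARD('a))" by (rule of_nat_mono)
  then have s: "0 \<le> s" "s \<le> d + 1" by (simp_all add: s_def d_def)
  have "2 * s / (d + 1) \<le> 2" "0 \<le> 2 * s / (d + 1)" using s d by (simp_all add: divide_le_eq)
  then have 1: "\<bar>\<alpha> - \<alpha> / d\<bar> \<le> 1" unfolding eqs(2) by (simp add: abs_le_iff)
  have "\<bar>\<alpha> / d\<bar> \<le> \<bar>\<alpha>\<bar> / 3"
  proof -
    have "\<bar>\<alpha>\<bar> / d \<le> \<bar>\<alpha>\<bar> / 3" using d by (intro divide_left_mono) auto
    then show ?thesis using d by (simp add: abs_divide)
  qed
  then have "\<bar>\<alpha>\<bar> \<le> 1 + \<bar>\<alpha>\<bar> / 3" using 1 by linarith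
  then have a: "\<bar>\<alpha>\<bar> \<le> 2" by linarith
  have "\<bar>of_bool (bar x \<in> S) - of_bool (x \<in> S) / d\<bar> \<le> 1" using d by (auto simp: of_bool_def)
  then have "\<bar>\<alpha>\<bar> * \<bar>of_bool (bar x \<in> S) - of_bool (x \<in> S) / d\<bar> \<le> 2 * 1"
    using a by (intro mult_mono) auto
  then show ?thesis unfolding pot_def \<alpha>_def[symmetric] d_def[symmetric] abs_mult by simp
qed

text \<open>The centred indicator contributes at most 1 and each potential at most 2.\<close>

lemma abs_increment_le:
  fixes S :: "'a::finite letter set"
  assumes card: "CARD('a) \<ge> 2"
  shows "\<bar>increment S x y\<bar> \<le> 5"
proof -
  have "\<bar>of_bool ((y \<in> S) \<noteq> (bar x \<in> S)) - turn_freq S\<bar> \<le> 1"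
    using turn_freq_bounds[OF card, of S] by (auto simp: of_bool_def)
  then show ?thesis
    using abs_pot_le[OF card, of S x] abs_pot_le[OF card, of S y] unfolding increment_def by linarith
qed

text \<open>The exponent telescopes into increments. Summing over the next letter multiplies the
  bound by the number of choices and the mean-zero exponential factor, whatever the current letter
  is.\<close>

lemma turn_count_mgf:
  fixes S :: "'a::finite letter set"
  assumes card: "CARD('a) \<ge> 2" and l: "0 \<le> l" "l * 5 \<le> 1"
  shows "(\<Sum>w\<in>conts x m. exp (- l * (real (turn_count S x w) - turn_freq S * real m - pot S x + pot S (last (x # w)))))
    \<le> (real (2 * CARD('a) - 1) * exp ((l * 5)\<^sup>2)) ^ m"
proof (induction m arbitrary: x)
  case (Suc m)
  define D where "D = real (2 * CARD('a) - 1) * exp ((l * 5)\<^sup>2)"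
  define E where "E x w = exp (- l * (real (turn_count S x w) - turn_freq S * real (length w) - pot S x + pot S (last (x # w))))" for x w
  have E_eq: "(\<Sum>w\<in>conts x m. exp (- l * (real (turn_count S x w) - turn_freq S * real m - pot S x + pot S (last (x # w)))))
      = (\<Sum>w\<in>conts x m. E x w)" for x m
    by (intro sum.cong) (auto simp: E_def conts_def)
  have "E x (y # w) = exp (- l * increment S x y) * E y w" for y w
  proof -
    have "- l * (real (turn_count S x (y # w)) - turn_freq S * real (length (y # w)) - pot S x + pot S (last (x # y # w)))
      = - l * increment S x y +
        - l * (real (turn_count S y w) - turn_freq S * real (length w) - pot S y + pot S (last (y # w)))"
      by (simp add: increment_def algebra_simps)
    then show ?thesis unfolding E_def exp_add[symmetric] by (simp only:)
  qed
  then have "(\<Sum>w\<in>conts x (Suc m). E x w) = (\<Sum>y\<in>- {bar x}. exp (- l * increment S x y) * (\<Sum>w\<in>conts y m. E y w))"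
    unfolding sum_conts_Suc by (simp add: sum_distrib_left)
  also have "\<dots> \<le> (\<Sum>y\<in>- {bar x}. exp (- l * increment S x y) * D ^ m)"
    using Suc.IH unfolding E_eq D_def by (intro sum_mono mult_left_mono) auto
  also have "\<dots> = (\<Sum>y\<in>- {bar x}. exp (- l * increment S x y)) * D ^ m"
    by (simp add: sum_distrib_right)
  also have "\<dots> \<le> (real (card (- {bar x})) * exp ((l * 5)\<^sup>2)) * D ^ m"
  proof (rule mult_right_mono)
    show "(\<Sum>y\<in>- {bar x}. exp (- l * increment S x y)) \<le> real (card (- {bar x})) * exp ((l * 5)\<^sup>2)"
      by (rule sum_exp_le[OF _ sum_increment[OF card] abs_increment_le[OF card] l]) simp
    have "0 \<le> D" unfolding D_def by (intro mult_nonneg_nonneg of_nat_0_le_iff) simp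
    then show "0 \<le> D ^ m" by simp
  qed
  also have "\<dots> = D ^ Suc m" by (simp add: card_Compl_letter D_def)
  finally show ?case unfolding E_eq D_def .
qed simp

text \<open>A Chernoff bound. The choice \<open>l = \<epsilon> / 50\<close> minimizes
  \<open>25 * l\<^sup>2 - l * \<epsilon>\<close>, with minimum
  \<open>- \<epsilon>\<^sup>2 / 100\<close>; the slack \<open>+ 1\<close> will absorb the first
  letter of the word.\<close>

lemma card_few_turns:
  fixes S :: "'a::finite letter set"
  assumes card: "CARD('a) \<ge> 2" and \<epsilon>: "0 < \<epsilon>" "\<epsilon> \<le> 1"
  shows "real (card {w \<in> conts x m. real (turn_count S x w) \<le> (turn_freq S - \<epsilon>) * real m + 1})
    \<le> real (2 * CARD('a) - 1) ^ m * exp (1 - \<epsilon>\<^sup>2 / 100 * real m)"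
proof -
  define A where "A = {w \<in> conts x m. real (turn_count S x w) \<le> (turn_freq S - \<epsilon>) * real m + 1}"
  define l where "l = \<epsilon> / 50"
  define E where "E w = exp (- l * (real (turn_count S x w) - turn_freq S * real m - pot S x + pot S (last (x # w))))" for w
  have l: "0 \<le> l" "l * 5 \<le> 1" using \<epsilon> by (simp_all add: l_def)
  have "exp (l * (\<epsilon> * real m - 5)) \<le> E w" if "w \<in> A" for w
  proof -
    have "real (turn_count S x w) - turn_freq S * real m - pot S x + pot S (last (x # w)) \<le> 5 - \<epsilon> * real m"
      using that abs_pot_le[OF card, of S x] abs_pot_le[OF card, of S "last (x # w)"]
      by (simp add: A_def left_diff_distrib abs_le_iff del: last.simps)
    then have "l * (real (turn_count S x w) - turn_freq S * real m - pot S x + pot S (last (x # w))) \<le> l * (5 - \<epsilon> * real m)"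
      using l(1) by (rule mult_left_mono)
    then show ?thesis unfolding E_def by (simp add: algebra_simps del: last.simps)
  qed
  then have "real (card A) * exp (l * (\<epsilon> * real m - 5)) \<le> (\<Sum>w\<in>A. E w)"
    by (intro sum_bounded_below) auto
  also have "\<dots> \<le> (\<Sum>w\<in>conts x m. E w)"
    by (intro sum_mono2) (auto simp: A_def E_def)
  also have "\<dots> \<le> (real (2 * CARD('a) - 1) * exp ((l * 5)\<^sup>2)) ^ m"
    unfolding E_def by (rule turn_count_mgf[OF card l])
  also have "\<dots> = real (2 * CARD('a) - 1) ^ m * exp ((l * 5)\<^sup>2 * real m)"
    by (simp add: power_mult_distrib exp_of_nat2_mult)
  finally have "real (card A) * exp (l * (\<epsilon> * real m - 5)) * exp (- (l * (\<epsilon> * real m - 5)))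
      \<le> real (2 * CARD('a) - 1) ^ m * exp ((l * 5)\<^sup>2 * real m) * exp (- (l * (\<epsilon> * real m - 5)))"
    by (intro mult_right_mono) auto
  then have "real (card A) \<le> real (2 * CARD('a) - 1) ^ m * exp ((l * 5)\<^sup>2 * real m - l * (\<epsilon> * real m - 5))"
    by (simp add: mult.assoc flip: exp_add)
  also have "(l * 5)\<^sup>2 * real m - l * (\<epsilon> * real m - 5) = \<epsilon> / 10 - \<epsilon>\<^sup>2 / 100 * real m"
    by (simp add: l_def power2_eq_square field_simps)
  also have "real (2 * CARD('a) - 1) ^ m * exp (\<epsilon> / 10 - \<epsilon>\<^sup>2 / 100 * real m) \<le>
      real (2 * CARD('a) - 1) ^ m * exp (1 - \<epsilon>\<^sup>2 / 100 * real m)"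
    using \<epsilon> by (intro mult_left_mono zero_le_power of_nat_0_le_iff) simp
  finally show ?thesis unfolding A_def .
qed

section \<open>Counting words by length and by prefix\<close>

lemma sum_power_lt: "2 \<le> d \<Longrightarrow> (\<Sum>m<n. d ^ m) < (d :: nat) ^ n"
proof (induction n)
  case (Suc n)
  then have "(\<Sum>m<Suc n. d ^ m) < 2 * d ^ n" by simp
  also have "\<dots> \<le> d ^ Suc n" using Suc.prems by simp
  finally show ?case .
qed simp

lemma card_reduced_le:
  assumes card: "CARD('a::finite) \<ge> 2"
  shows "card {w :: 'a word. reduced_word w \<and> length w \<le> M} \<le> 2 * CARD('a) * (2 * CARD('a) - 1) ^ M"
proof -
  define d where "d = 2 * CARD('a) - 1"
  have d: "2 \<le> d" using card by (simp add: d_def)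
  have "{w :: 'a word. reduced_word w \<and> length w \<le> M} \<subseteq> {[]} \<union> (\<Union>m\<in>{..<M}. \<Union>y\<in>UNIV. (#) y ` conts y m)"
  proof
    fix w :: "'a word" assume "w \<in> {w. reduced_word w \<and> length w \<le> M}"
    then show "w \<in> {[]} \<union> (\<Union>m\<in>{..<M}. \<Union>y\<in>UNIV. (#) y ` conts y m)"
      by (cases w) (auto simp: conts_def image_iff Suc_le_eq)
  qed
  then have "card {w :: 'a word. reduced_word w \<and> length w \<le> M} \<le>
      card ({[]} \<union> (\<Union>m\<in>{..<M}. \<Union>y\<in>UNIV. (#) y ` (conts y m :: 'a word set)))"
    by (rule card_mono[rotated]) auto
  also have "\<dots> \<le> 1 + card (\<Union>m\<in>{..<M}. \<Union>y\<in>UNIV. (#) y ` (conts y m :: 'a word set))"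
    by (rule order_trans[OF card_Un_le]) simp
  also have "card (\<Union>m\<in>{..<M}. \<Union>y\<in>UNIV. (#) y ` (conts y m :: 'a word set)) \<le>
      (\<Sum>m<M. card (\<Union>y\<in>UNIV. (#) y ` (conts y m :: 'a word set)))"
    by (rule card_UN_le) simp
  also have "\<dots> \<le> (\<Sum>m<M. 2 * CARD('a) * d ^ m)"
  proof (rule sum_mono)
    fix m
    have "card (\<Union>y\<in>UNIV. (#) y ` (conts y m :: 'a word set)) \<le> (\<Sum>y\<in>UNIV. card ((#) y ` (conts y m :: 'a word set)))"
      by (rule card_UN_le) simp
    also have "\<dots> = 2 * CARD('a) * d ^ m"
      by (simp add: card_image card_conts d_def)
    finally show "card (\<Union>y\<in>UNIV. (#) y ` (conts y m :: 'a word set)) \<le> 2 * CARD('a) * d ^ m" .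
  qed
  also have "1 + (\<Sum>m<M. 2 * CARD('a) * d ^ m) \<le> 2 * CARD('a) * d ^ M"
  proof -
    have "2 * CARD('a) * (\<Sum>m<M. d ^ m) + 2 * CARD('a) \<le> 2 * CARD('a) * d ^ M"
      using mult_le_mono2[OF Suc_leI[OF sum_power_lt[OF d, of M]], of "2 * CARD('a)"] by simp
    then show ?thesis using card by (simp add: sum_distrib_left)
  qed
  finally show ?thesis by (simp add: d_def)
qed

lemma card_prefix_le:
  fixes p :: "'a::finite word"
  assumes card: "CARD('a) \<ge> 2" and t: "1 \<le> t" "t \<le> n"
  shows "card {h. reduced_word h \<and> length h \<le> n \<and> t \<le> length h \<and> take t h = p} \<le> (2 * CARD('a) - 1) ^ (n - t + 1)"
proof (cases "length p = t")
  case True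
  then have p: "p \<noteq> []" using t by auto
  have "{h. reduced_word h \<and> length h \<le> n \<and> t \<le> length h \<and> take t h = p} \<subseteq>
      (\<Union>m\<in>{..<n - t + 1}. (@) p ` conts (last p) m)"
  proof
    fix h assume "h \<in> {h. reduced_word h \<and> length h \<le> n \<and> t \<le> length h \<and> take t h = p}"
    then have h: "reduced_word h" "length h \<le> n" "t \<le> length h" "take t h = p" by auto
    have hp: "h = p @ drop t h" using h(4) by (metis append_take_drop_id)
    then have "reduced_word (butlast p @ (last p # drop t h))" using h(1) p by (metis append_butlast_last_id append.assoc append_Cons append_Nil)
    then have "reduced_word (last p # drop t h)" unfolding reduced_append by blast
    then have "drop t h \<in> conts (last p) (length h - t)" by (simp add: conts_def)
    moreover have "length h - t \<in> {..<n - t + 1}" using h by auto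
    ultimately show "h \<in> (\<Union>m\<in>{..<n - t + 1}. (@) p ` conts (last p) m)" using hp by blast
  qed
  then have "card {h. reduced_word h \<and> length h \<le> n \<and> t \<le> length h \<and> take t h = p} \<le>
      card (\<Union>m\<in>{..<n - t + 1}. (@) p ` conts (last p) m)"
    by (rule card_mono[rotated]) auto
  also have "\<dots> \<le> (\<Sum>m<n - t + 1. card ((@) p ` conts (last p) m))" by (rule card_UN_le) simp
  also have "\<dots> = (\<Sum>m<n - t + 1. (2 * CARD('a) - 1) ^ m)"
    by (simp add: card_image inj_on_def card_conts)
  also have "\<dots> \<le> (2 * CARD('a) - 1) ^ (n - t + 1)"
    using card by (intro less_imp_le sum_power_lt) simp
  finally show ?thesis .
next
  case False
  then have "{h. reduced_word h \<and> length h \<le> n \<and> t \<le> length h \<and> take t h = p} = {}" by auto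
  then show ?thesis by (metis card.empty le0)
qed

definition cyc_words :: "nat \<Rightarrow> 'a word set" where
  "cyc_words n = {h. cyclically_reduced h \<and> length h \<le> n}"

lemma finite_cyc_words [simp]: "finite (cyc_words n :: 'a::finite word set)"
proof -
  have "finite {w :: 'a word. length w \<le> n}"
    using finite_lists_length_le[of "UNIV :: 'a letter set" n] by simp
  then show ?thesis by (rule finite_subset[rotated]) (auto simp: cyc_words_def)
qed

text \<open>The first letter is fixed, followed by an arbitrary reduced continuation of length
  \<open>n - 2\<close>; one last letter can always be chosen that cancels on neither side.\<close>

lemma card_cyc_words_ge:
  assumes card: "CARD('a::finite) \<ge> 2" and n: "2 \<le> n"
  shows "(2 * CARD('a) - 1) ^ (n - 2) \<le> card (cyc_words n :: 'a word set)"
proof -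
  define x :: "'a letter" where "x = undefined"
  have "\<exists>y. y \<noteq> bar (last (x # w)) \<and> y \<noteq> bar x" for w
    using third_letter[OF card, of "bar (last (x # w))" "bar x"] by metis
  then obtain f where f: "\<And>w. f w \<noteq> bar (last (x # w)) \<and> f w \<noteq> bar x" by metis
  define g where "g w = (x # w) @ [f w]" for w
  have "g w \<in> cyc_words n" if "w \<in> conts x (n - 2)" for w
  proof -
    have w: "reduced_word (x # w)" "length w = n - 2" using that by (auto simp: conts_def)
    have "reduced_word (g w)" unfolding g_def reduced_append[of "x # w"] using w f by simp
    moreover have "hd (g w) = x" "last (g w) = f w" "g w \<noteq> []" by (simp_all add: g_def)
    moreover have "x \<noteq> bar (f w)" using f[of w] by (metis bar_bar)
    ultimately have "cyclically_reduced (g w)" by (simp add: cyclically_reduced_def reduced_append[of "g w" "g w"])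
    then show ?thesis using w n by (simp add: cyc_words_def g_def)
  qed
  moreover have "inj_on g (conts x (n - 2))" by (auto simp: inj_on_def g_def)
  ultimately have "card (conts x (n - 2)) \<le> card (cyc_words n :: 'a word set)"
    by (intro card_inj_on_le) auto
  then show ?thesis by (simp add: card_conts)
qed

text \<open>A bound for coordinate \<open>j\<close> that is uniform in the remaining
  \<open>k - 1\<close> coordinates is summed over these.\<close>

lemma card_coordinate_le:
  fixes C :: "'b set" and D :: real
  assumes C: "finite C" and j: "j < k"
    and D: "\<And>us vs. length us = j \<Longrightarrow> length vs = k - Suc j \<Longrightarrow> set us \<subseteq> C \<Longrightarrow> set vs \<subseteq> C \<Longrightarrow>
      real (card {x \<in> C. P (us @ x # vs)}) \<le> D"
  shows "real (card {xs. set xs \<subseteq> C \<and> length xs = k \<and> P xs}) \<le> D * real (card C) ^ (k - 1)"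
proof -
  define A where "A = {xs. set xs \<subseteq> C \<and> length xs = k \<and> P xs}"
  define R where "R = {vs. set vs \<subseteq> C \<and> length vs = k - 1}"
  define G where "G vs = (\<lambda>x. take j vs @ x # drop j vs) ` {x \<in> C. P (take j vs @ x # drop j vs)}" for vs
  have finR: "finite R" and cardR: "card R = card C ^ (k - 1)"
    unfolding R_def using finite_lists_length_eq[OF C] card_lists_length_eq[OF C] by auto
  have "A \<subseteq> (\<Union>vs\<in>R. G vs)"
  proof
    fix xs assume xs: "xs \<in> A"
    define vs where "vs = take j xs @ drop (Suc j) xs"
    have l: "length xs = k" "set xs \<subseteq> C" "P xs" using xs by (auto simp: A_def)
    have tk: "take j vs = take j xs" "drop j vs = drop (Suc j) xs" using l j by (simp_all add: vs_def)
    have "xs = take j vs @ xs ! j # drop j vs" unfolding tk using l j by (simp add: id_take_nth_drop)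
    moreover have "xs ! j \<in> C" using l j by auto
    moreover have "set vs \<subseteq> C" unfolding vs_def using l(2) set_take_subset set_drop_subset by fastforce
    moreover have "length vs = k - 1" using l j by (simp add: vs_def)
    ultimately have "xs \<in> G vs" "vs \<in> R" using l(3) by (auto simp: G_def R_def)
    then show "xs \<in> (\<Union>vs\<in>R. G vs)" by blast
  qed
  then have "card A \<le> card (\<Union>vs\<in>R. G vs)" using finR C by (intro card_mono) (auto simp: G_def)
  also have "\<dots> \<le> (\<Sum>vs\<in>R. card (G vs))" using finR by (rule card_UN_le)
  finally have "real (card A) \<le> (\<Sum>vs\<in>R. real (card (G vs)))" by (metis of_nat_le_iff of_nat_sum)
  also have "\<dots> \<le> (\<Sum>vs\<in>R. D)"
  proof (rule sum_mono)
    fix vs assume "vs \<in> R"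
    then have vs: "set vs \<subseteq> C" "length vs = k - 1" by (auto simp: R_def)
    have "card (G vs) \<le> card {x \<in> C. P (take j vs @ x # drop j vs)}"
      unfolding G_def using C by (intro card_image_le) simp
    moreover have "real (card {x \<in> C. P (take j vs @ x # drop j vs)}) \<le> D"
      using vs j set_take_subset[of j vs] set_drop_subset[of j vs] by (intro D) auto
    ultimately show "real (card (G vs)) \<le> D" by linarith
  qed
  also have "\<dots> = D * real (card C) ^ (k - 1)" by (simp add: cardR)
  finally show ?thesis by (simp add: A_def)
qed

section \<open>Exponential genericity\<close>

definition bad_words :: "real \<Rightarrow> nat \<Rightarrow> 'a::finite word set" where
  "bad_words \<epsilon> n = {h \<in> cyc_words n. 2 * length h \<le> n \<or>
     (\<exists>S. S \<noteq> {} \<and> S \<noteq> UNIV \<and> real (turns S h) < (turn_freq S - \<epsilon>) * real (length h))}"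

lemma real_card_UN_le:
  "finite I \<Longrightarrow> real (card (\<Union>i\<in>I. F i)) \<le> (\<Sum>i\<in>I. real (card (F i)))"
  using card_UN_le[of I F] by (metis of_nat_le_iff of_nat_sum)

text \<open>Words of length at most \<open>n / 2\<close> are few by counting alone. For the others
  the deviation estimate is summed over all \<open>S\<close>, all lengths and all first
  letters.\<close>

lemma card_bad_words:
  assumes card: "CARD('a::finite) \<ge> 2" and \<epsilon>: "0 < \<epsilon>" "\<epsilon> \<le> 1"
  shows "real (card (bad_words \<epsilon> n :: 'a word set)) \<le>
    real (2 * CARD('a)) * real (2 * CARD('a) - 1) ^ (n div 2) +
    2 ^ (2 * CARD('a)) * real (2 * CARD('a)) * exp 2 * real (2 * CARD('a) - 1) ^ n * exp (- (\<epsilon>\<^sup>2 / 200 * real n))"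
proof -
  define d where "d = 2 * CARD('a) - 1"
  define Short where "Short = {w :: 'a word. reduced_word w \<and> length w \<le> n div 2}"
  define Few where "Few S m y = {w \<in> conts y m. real (turn_count S y w) \<le> (turn_freq S - \<epsilon>) * real m + 1}"
    for S :: "'a letter set" and m y
  \<comment> \<open>\<open>m\<close> is the length after the first letter, so the word has length
    \<open>Suc m\<close>, between \<open>n / 2\<close> and \<open>n\<close>.\<close>
  define I where "I = {m. m < n \<and> n < 2 * Suc m}"
  define Long where "Long = (\<Union>S. \<Union>m\<in>I. \<Union>y. (#) y ` Few S m y)"
  have finI: "finite I" by (simp add: I_def)
  have finF: "finite (Few S m y)" for S m y by (simp add: Few_def)
  have sub: "bad_words \<epsilon> n \<subseteq> Short \<union> Long"
  proof
    fix h :: "'a word" assume h: "h \<in> bad_words \<epsilon> n"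
    then have red: "reduced_word h" and len: "length h \<le> n"
      using cyclically_reducedD by (auto simp: bad_words_def cyc_words_def)
    show "h \<in> Short \<union> Long"
    proof (cases "2 * length h \<le> n")
      case True
      then have "length h \<le> n div 2" by presburger
      then show ?thesis using red by (simp add: Short_def)
    next
      case False
      then obtain S where S: "real (turns S h) < (turn_freq S - \<epsilon>) * real (length h)"
        using h unfolding bad_words_def by blast
      obtain y w where yw: "h = y # w" using False by (cases h) auto
      have "real (turn_count S y w) \<le> real (turns S h)"
        unfolding yw by (rule of_nat_mono) (rule turns_Cons_ge)
      also have "\<dots> \<le> (turn_freq S - \<epsilon>) * real (length w) + (turn_freq S - \<epsilon>)"
        using S by (simp add: yw algebra_simps)
      finally have "w \<in> Few S (length w) y"
        using turn_freq_bounds(2)[OF card, of S] \<epsilon> red by (simp add: Few_def conts_def yw)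
      moreover have "length w \<in> I" using len False by (simp add: I_def yw)
      ultimately have "h \<in> Long" unfolding Long_def yw by blast
      then show ?thesis by simp
    qed
  qed
  \<comment> \<open>Since \<open>m\<close> is about \<open>n / 2\<close> or more, the rate per
    letter is halved from \<open>1 / 100\<close> to \<open>1 / 200\<close>; \<open>exp 2\<close>
    absorbs the rounding.\<close>
  define E where "E = exp 2 * exp (- (\<epsilon>\<^sup>2 / 200 * real n))"
  have Few: "real (card (Few S m y)) \<le> real d ^ m * E" if "m \<in> I" for S m y
  proof -
    have "real n \<le> 2 * real m + 2" using that by (simp add: I_def)
    then have "\<epsilon>\<^sup>2 / 200 * real n \<le> \<epsilon>\<^sup>2 / 200 * (2 * real m + 2)" by (intro mult_left_mono) auto
    also have "\<dots> \<le> \<epsilon>\<^sup>2 / 100 * real m + 1"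
    proof -
      have "\<epsilon>\<^sup>2 \<le> 1" using \<epsilon> by (simp add: power_le_one)
      then show ?thesis by (simp add: field_simps)
    qed
    finally have "exp (1 - \<epsilon>\<^sup>2 / 100 * real m) \<le> E"
      unfolding E_def exp_add[symmetric] exp_le_cancel_iff by linarith
    then have "real d ^ m * exp (1 - \<epsilon>\<^sup>2 / 100 * real m) \<le> real d ^ m * E"
      by (intro mult_left_mono) auto
    then show ?thesis using card_few_turns[OF card \<epsilon>, of y m S] unfolding Few_def d_def by linarith
  qed
  have letters: "real (card (\<Union>y. (#) y ` Few S m y)) \<le> real (2 * CARD('a)) * (real d ^ m * E)" if "m \<in> I" for S m
  proof -
    have "real (card (\<Union>y. (#) y ` Few S m y)) \<le> (\<Sum>y\<in>UNIV. real (card ((#) y ` Few S m y)))"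
      by (rule real_card_UN_le) simp
    also have "\<dots> \<le> (\<Sum>y\<in>(UNIV :: 'a letter set). real d ^ m * E)"
      using Few[OF that] by (intro sum_mono) (simp add: card_image)
    also have "\<dots> = real (2 * CARD('a)) * (real d ^ m * E)" by simp
    finally show ?thesis .
  qed
  have lengths: "real (card (\<Union>m\<in>I. \<Union>y. (#) y ` Few S m y)) \<le> real (2 * CARD('a)) * (real d ^ n * E)" for S
  proof -
    have "real (card (\<Union>m\<in>I. \<Union>y. (#) y ` Few S m y)) \<le> (\<Sum>m\<in>I. real (card (\<Union>y. (#) y ` Few S m y)))"
      using finI by (rule real_card_UN_le)
    also have "\<dots> \<le> (\<Sum>m\<in>I. real (2 * CARD('a)) * (real d ^ m * E))"
      using letters by (intro sum_mono) blast
    also have "\<dots> \<le> (\<Sum>m<n. real (2 * CARD('a)) * (real d ^ m * E))"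
      by (rule sum_mono2) (auto simp: I_def E_def)
    also have "\<dots> = real (2 * CARD('a)) * (real (\<Sum>m<n. d ^ m) * E)"
      by (simp add: sum_distrib_left sum_distrib_right)
    also have "\<dots> \<le> real (2 * CARD('a)) * (real (d ^ n) * E)"
    proof -
      have "(\<Sum>m<n. d ^ m) \<le> d ^ n" using card by (intro less_imp_le sum_power_lt) (simp add: d_def)
      then have "real (\<Sum>m<n. d ^ m) \<le> real (d ^ n)" by (rule of_nat_mono)
      then show ?thesis by (intro mult_left_mono mult_right_mono) (auto simp: E_def)
    qed
    finally show ?thesis by simp
  qed
  have "real (card Long) \<le> (\<Sum>S\<in>UNIV. real (card (\<Union>m\<in>I. \<Union>y. (#) y ` Few S m y)))"
    unfolding Long_def by (rule real_card_UN_le) simp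
  also have "\<dots> \<le> (\<Sum>S\<in>(UNIV :: 'a letter set set). real (2 * CARD('a)) * (real d ^ n * E))"
    using lengths by (intro sum_mono) blast
  also have "\<dots> = real (CARD('a letter set)) * (real (2 * CARD('a)) * (real d ^ n * E))" by simp
  also have "CARD('a letter set) = 2 ^ (2 * CARD('a))" by (simp add: card_UNIV_set)
  finally have L: "real (card Long) \<le> 2 ^ (2 * CARD('a)) * real (2 * CARD('a)) * exp 2 * real d ^ n * exp (- (\<epsilon>\<^sup>2 / 200 * real n))"
    by (simp add: E_def mult.assoc mult.left_commute mult.commute)
  have "card Short \<le> 2 * CARD('a) * d ^ (n div 2)"
    unfolding Short_def d_def by (rule card_reduced_le[OF card])
  then have S: "real (card Short) \<le> real (2 * CARD('a)) * real d ^ (n div 2)"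
    by (metis of_nat_le_iff of_nat_mult of_nat_power)
  have "finite Long" unfolding Long_def by (intro finite_UN_I finite finite_imageI finI finF)
  moreover have "finite Short"
    using finite_subset[of Short "{w. length w \<le> n div 2}"] finite_lists_length_le[of "UNIV :: 'a letter set" "n div 2"]
    by (auto simp: Short_def)
  ultimately have "card (bad_words \<epsilon> n :: 'a word set) \<le> card (Short \<union> Long)"
    using sub by (intro card_mono) auto
  also have "\<dots> \<le> card Short + card Long" by (rule card_Un_le)
  finally have "real (card (bad_words \<epsilon> n :: 'a word set)) \<le> real (card Short) + real (card Long)"
    by (metis of_nat_add of_nat_le_iff)
  then show ?thesis using L S unfolding d_def by linarith
qed

definition clash :: "nat \<Rightarrow> 'a word \<Rightarrow> 'a word \<Rightarrow> bool" where
  "clash t u h \<longleftrightarrow> t \<le> length h \<and>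
     (take t h \<in> {take t u, take t (inv_word u)} \<or> take t (inv_word h) \<in> {take t u, take t (inv_word u)})"

text \<open>Four prefixes matter, coming from \<open>u\<close> or its inverse compared with
  \<open>h\<close> or its inverse; prescribing \<open>t\<close> letters saves a factor exponential
  in \<open>t\<close>.\<close>

lemma card_clash:
  fixes u :: "'a::finite word"
  assumes card: "CARD('a) \<ge> 2" and t: "1 \<le> t" "t \<le> n"
  shows "card {h \<in> cyc_words n. clash t u h} \<le> 4 * (2 * CARD('a) - 1) ^ (n - t + 1)"
proof -
  define F where "F p = {h :: 'a word. reduced_word h \<and> length h \<le> n \<and> t \<le> length h \<and> take t h = p}" for p
  have finF: "finite (F p)" for p
    using finite_subset[of "F p" "{w. length w \<le> n}"] finite_lists_length_le[of "UNIV :: 'a letter set" n]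
    by (auto simp: F_def)
  have F: "card (F p) \<le> (2 * CARD('a) - 1) ^ (n - t + 1)" for p
    unfolding F_def by (rule card_prefix_le[OF card t])
  have F': "card (inv_word ` F p) \<le> (2 * CARD('a) - 1) ^ (n - t + 1)" for p
    using F card_image_le[OF finF] le_trans by blast
  have "{h \<in> cyc_words n. clash t u h} \<subseteq> (F (take t u) \<union> F (take t (inv_word u))) \<union>
      (inv_word ` F (take t u) \<union> inv_word ` F (take t (inv_word u)))"
  proof
    fix h assume h: "h \<in> {h \<in> cyc_words n. clash t u h}"
    have "h \<in> inv_word ` F p" if "take t (inv_word h) = p" for p
    proof
      show "h = inv_word (inv_word h)" by simp
      show "inv_word h \<in> F p"
        using h that cyclically_reducedD by (auto simp: F_def clash_def cyc_words_def)
    qed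
    moreover have "h \<in> F p" if "take t h = p" for p
      using h that cyclically_reducedD by (auto simp: F_def clash_def cyc_words_def)
    ultimately show "h \<in> (F (take t u) \<union> F (take t (inv_word u))) \<union>
      (inv_word ` F (take t u) \<union> inv_word ` F (take t (inv_word u)))"
      using h unfolding clash_def by blast
  qed
  then have "card {h \<in> cyc_words n. clash t u h} \<le> card ((F (take t u) \<union> F (take t (inv_word u))) \<union>
      (inv_word ` F (take t u) \<union> inv_word ` F (take t (inv_word u))))"
    using finF by (intro card_mono) auto
  also have "\<dots> \<le> (card (F (take t u)) + card (F (take t (inv_word u)))) +
      (card (inv_word ` F (take t u)) + card (inv_word ` F (take t (inv_word u))))"
    by (meson add_mono card_Un_le le_trans)
  also have "\<dots> \<le> 4 * (2 * CARD('a) - 1) ^ (n - t + 1)"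
    using F[of "take t u"] F[of "take t (inv_word u)"] F'[of "take t u"] F'[of "take t (inv_word u)"] by linarith
  finally show ?thesis .
qed

lemma good_tuple_minimal:
  fixes hs :: "'a::finite word list"
  defines "r \<equiv> real CARD('a)"
  assumes card: "CARD('a) \<ge> 2" and k: "1 \<le> length hs"
    and \<epsilon>: "0 < \<epsilon>" "(4 * r + 1) * \<epsilon> \<le> (2 * r - 3) / (r * (2 * r - 1))"
    and t: "1 \<le> t" "4 * t \<le> n" "4 * real t \<le> \<epsilon> * real n" and n: "4 \<le> \<epsilon> * real n"
    and hs: "set hs \<subseteq> cyc_words n"
    and good: "\<And>j. j < length hs \<Longrightarrow> hs ! j \<notin> bad_words \<epsilon> n"
    and noclash: "\<And>i j. i < length hs \<Longrightarrow> j < length hs \<Longrightarrow> i \<noteq> j \<Longrightarrow> \<not> clash t (hs ! i) (hs ! j)"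
  shows "strictly_whitehead_minimal (generate free_group (set hs))"
proof -
  have half: "n < 2 * length h" if h: "h \<in> set hs" for h
  proof -
    obtain j where "j < length hs" "h = hs ! j" using h by (metis in_set_conv_nth)
    moreover have "h \<in> cyc_words n" using h hs by blast
    ultimately show ?thesis using good[of j] by (simp add: bad_words_def)
  qed
  have turns: "(turn_freq S - \<epsilon>) * real (length h) \<le> real (turns S h)"
    if h: "h \<in> set hs" and S: "S \<noteq> {}" "S \<noteq> UNIV" for h S
  proof -
    obtain j where "j < length hs" "h = hs ! j" using h by (metis in_set_conv_nth)
    then have "h \<in> cyc_words n" "h \<notin> bad_words \<epsilon> n" using good[of j] hs nth_mem[of j hs] by auto
    then have "\<not> real (turns S h) < (turn_freq S - \<epsilon>) * real (length h)"
      unfolding bad_words_def using S by blast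
    then show ?thesis by simp
  qed
  have cyc: "cyclically_reduced h" if "h \<in> set hs" for h using that hs by (auto simp: cyc_words_def)
  interpret separated hs t
  proof
    show "cyclically_reduced h" if "h \<in> set hs" for h using that by (rule cyc)
    show "h \<noteq> []" if "h \<in> set hs" for h using half[OF that] by auto
    show "hs \<noteq> []" using k by auto
    show "2 * t \<le> length h" if "h \<in> set hs" for h using half[OF that] t by linarith
  next
    fix \<sigma> \<tau> :: "nat letter" assume \<sigma>: "fst \<sigma> < length hs" and \<tau>: "fst \<tau> < length hs" and ne: "\<sigma> \<noteq> \<tau>"
    show "take t (symbol_word hs \<sigma>) \<noteq> take t (symbol_word hs \<tau>)"
    proof (cases "fst \<sigma> = fst \<tau>")
      case False
      have "t \<le> length (hs ! fst \<tau>)" using half[OF nth_mem[OF \<tau>]] t by linarith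
      then show ?thesis using noclash[OF \<sigma> \<tau> False] by (auto simp: clash_def symbol_word_def)
    next
      case True
      \<comment> \<open>A generator and its own inverse already differ in the first letter by cyclic
        reducedness, so no probability is spent on this case.\<close>
      define h where "h = hs ! fst \<sigma>"
      have h: "h \<noteq> []" "cyclically_reduced h" using half[OF nth_mem[OF \<sigma>]] cyc[OF nth_mem[OF \<sigma>]]
        by (auto simp: h_def)
      have "hd h \<noteq> bar (last h)" using h by (simp add: cyclically_reduced_def reduced_append)
      then have "hd (take t h) \<noteq> hd (take t (inv_word h))"
        using h t by (simp add: hd_inv_word hd_take)
      then have "take t h \<noteq> take t (inv_word h)" by metis
      moreover have "snd \<sigma> \<noteq> snd \<tau>" using True ne by (simp add: prod_eq_iff)
      ultimately show ?thesis using True by (auto simp: symbol_word_def h_def)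
    qed
  qed
  define N where "N = real (\<Sum>i<length hs. length (hs ! i))"
  have N_ge: "real (length hs) * (real n / 2) \<le> N"
  proof -
    have "real (length hs) * (real n / 2) = (\<Sum>i<length hs. real n / 2)" by simp
    also have "\<dots> \<le> (\<Sum>i<length hs. real (length (hs ! i)))"
    proof (rule sum_mono)
      fix i assume "i \<in> {..<length hs}"
      then have "n < 2 * length (hs ! i)" using half by simp
      then show "real n / 2 \<le> real (length (hs ! i))" by simp
    qed
    finally show ?thesis by (simp add: N_def)
  qed
  have "strictly_whitehead_minimal (rep ` H)"
  proof (rule minimal[OF card, folded N_def])
    fix S :: "'a letter set" assume S: "S \<noteq> {}" "S \<noteq> UNIV"
    have "(turn_freq S - \<epsilon>) * N = (\<Sum>i<length hs. (turn_freq S - \<epsilon>) * real (length (hs ! i)))"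
      by (simp add: N_def sum_distrib_left)
    also have "\<dots> \<le> (\<Sum>i<length hs. real (turns S (hs ! i)))"
      using turns[OF _ S] by (intro sum_mono) simp
    finally show "(turn_freq S - \<epsilon>) * N \<le> real (\<Sum>i<length hs. turns S (hs ! i))" by simp
  next
    have "real (2 * t * length hs) = real (length hs) * (4 * real t) / 2" by simp
    also have "\<dots> \<le> real (length hs) * (\<epsilon> * real n) / 2"
      using t(3) by (intro divide_right_mono mult_left_mono) auto
    also have "\<dots> = \<epsilon> * (real (length hs) * (real n / 2))" by simp
    also have "\<dots> \<le> \<epsilon> * N" using N_ge \<epsilon> by (intro mult_left_mono) auto
    finally show "real (2 * t * length hs) \<le> \<epsilon> * N" .
  next
    have "real (length hs + 1) \<le> real (length hs) * 4 / 2" using k by simp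
    also have "\<dots> \<le> real (length hs) * (\<epsilon> * real n) / 2"
      using n by (intro divide_right_mono mult_left_mono) auto
    also have "\<dots> = \<epsilon> * (real (length hs) * (real n / 2))" by simp
    also have "\<dots> \<le> \<epsilon> * N" using N_ge \<epsilon> by (intro mult_left_mono) auto
    finally show "real (length hs + 1) \<le> \<epsilon> * N" .
  next
    show "(4 * real CARD('a) + 1) * \<epsilon> \<le> (2 * real CARD('a) - 3) / (real CARD('a) * (2 * real CARD('a) - 1))"
      using \<epsilon>(2) by (simp only: r_def)
  qed
  moreover have "rep ` H = generate free_group (set hs)"
  proof -
    have "rep ` B = set hs"
    proof -
      have "rep (el h) = h" if "h \<in> set hs" for h
        using cyc[OF that] by (intro rep_el_reduced cyclically_reducedD)
      then show ?thesis by (simp add: B_def image_image)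
    qed
    then show ?thesis using generate_free_group[of B] by simp
  qed
  ultimately show ?thesis by simp
qed

theorem theorem4p1:
  fixes k :: nat
  assumes "CARD('a::finite) \<ge> 2" and "k \<ge> 2"
  shows "\<exists>c::real. c > 0 \<and>
    (\<lambda>n. measure_pmf.prob (pmf_of_set (cyclically_reduced_tuples k n :: 'a word list set))
           {hs. \<not> strictly_whitehead_minimal (generate free_group (set hs))})
      \<in> O(\<lambda>n. exp (- c * real n))"
proof -
  define r where "r = real CARD('a)"
  define d where "d = 2 * CARD('a) - 1"
  \<comment> \<open>The largest value for which the gap inequalities still hold.\<close>
  define \<epsilon> where "\<epsilon> = (2 * r - 3) / (r * (2 * r - 1)) / (4 * r + 1)"
  have r: "r \<ge> 2" using assms by (simp add: r_def)
  have d: "d \<ge> 3" using assms by (simp add: d_def)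
  have \<epsilon>0: "0 < \<epsilon>" using r by (simp add: \<epsilon>_def)
  have eps: "(4 * r + 1) * \<epsilon> \<le> (2 * r - 3) / (r * (2 * r - 1))" using r by (simp add: \<epsilon>_def)
  have "1 * (2 * r - 1) \<le> r * (2 * r - 1)" using r by (intro mult_right_mono) auto
  then have "2 * r - 3 \<le> r * (2 * r - 1)" by (rule order_trans[rotated]) simp
  moreover have "0 < r * (2 * r - 1)" using r by simp
  ultimately have "(2 * r - 3) / (r * (2 * r - 1)) \<le> 1" by (simp only: divide_le_eq_1_pos)
  then have "(2 * r - 3) / (r * (2 * r - 1)) \<le> 4 * r + 1" by (rule order_trans) (use r in simp)
  then have \<epsilon>1: "\<epsilon> \<le> 1" unfolding \<epsilon>_def using r by (subst divide_le_eq_1_pos) auto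
  define c where "c = \<epsilon>\<^sup>2 / 200"
  have c: "0 < c" "c \<le> \<epsilon> / 8" "c \<le> 1 / 2"
  proof -
    have "\<epsilon>\<^sup>2 \<le> \<epsilon>" using \<epsilon>0 \<epsilon>1 by (simp add: power2_eq_square mult_le_one)
    then show "c \<le> \<epsilon> / 8" "c \<le> 1 / 2" using \<epsilon>0 \<epsilon>1 unfolding c_def by simp_all
    show "0 < c" using \<epsilon>0 by (simp add: c_def)
  qed
  define p where "p n = measure_pmf.prob (pmf_of_set (cyclically_reduced_tuples k n :: 'a word list set))
           {hs. \<not> strictly_whitehead_minimal (generate free_group (set hs))}" for n
  define K where "K = real k * (2 * r + 2 ^ (2 * CARD('a)) * (2 * r) * exp 2 + 4 * real k * real d * exp 1) * real d ^ 2"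
  \<comment> \<open>From here on \<open>\<epsilon> * n \<ge> 16\<close>, which gives
    \<open>t \<ge> 1\<close> below and the required bound
    \<open>4 \<le> \<epsilon> * n\<close>.\<close>
  define n0 where "n0 = nat \<lceil>16 / \<epsilon>\<rceil>"
  have bound: "p n \<le> K * exp (- c * real n)" if "n \<ge> n0" for n
  proof -
    define C where "C = (cyc_words n :: 'a word set)"
    define A where "A = (cyclically_reduced_tuples k n :: 'a word list set)"
    have A: "A = {hs. set hs \<subseteq> C \<and> length hs = k}"
      by (auto simp: A_def C_def cyclically_reduced_tuples_def cyc_words_def)
    have finC: "finite C" by (simp add: C_def)
    have "16 / \<epsilon> \<le> real n" using \<open>n \<ge> n0\<close> unfolding n0_def by linarith
    then have n16: "16 \<le> \<epsilon> * real n" using \<epsilon>0 by (simp add: divide_le_eq mult.commute)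
    also have "\<dots> \<le> 1 * real n" using \<epsilon>1 by (intro mult_right_mono) auto
    finally have n: "16 \<le> n" by simp
    \<comment> \<open>Linear in \<open>n\<close>, so that clashes are exponentially rare, yet small
      enough that the discarded ends of the generators stay within the tolerance.\<close>
    define t where "t = nat \<lfloor>\<epsilon> * real n / 8\<rfloor>"
    have t_le: "real t \<le> \<epsilon> * real n / 8" and t_ge: "\<epsilon> * real n / 8 - 1 \<le> real t"
      unfolding t_def using n16 by linarith+
    have t1: "1 \<le> t" using t_ge n16 by simp
    have "\<epsilon> * real n \<le> 1 * real n" using \<epsilon>1 by (intro mult_right_mono) auto
    then have "4 * real t \<le> real n" using t_le by simp
    then have t4: "4 * t \<le> n" by linarith
    have "d ^ (n - 2) \<le> card C"
      using card_cyc_words_ge[OF assms(1), of n] n unfolding C_def d_def by linarith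
    then have "real (d ^ (n - 2)) \<le> real (card C)" by (rule of_nat_mono)
    then have cardC: "real d ^ (n - 2) \<le> real (card C)" by (simp only: of_nat_power)
    have "0 < real d ^ (n - 2)" using d by simp
    then have Cpos: "0 < real (card C)" using cardC by linarith
    have finA: "finite A" unfolding A using finC by (rule finite_lists_length_eq)
    have cardA: "card A = card C ^ k" unfolding A using finC by (rule card_lists_length_eq)
    have "0 < card A" using cardA Cpos by simp
    then have neA: "A \<noteq> {}" by auto
    \<comment> \<open>A tuple that is not good has a coordinate to blame: a bad word or one clashing
      with another coordinate. Fixing the others bounds the choices for it.\<close>
    define P where "P j hs \<longleftrightarrow> hs ! j \<in> bad_words \<epsilon> n \<or> (\<exists>i<k. i \<noteq> j \<and> clash t (hs ! i) (hs ! j))"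
      for j and hs :: "'a word list"
    have bad: "A \<inter> {hs. \<not> strictly_whitehead_minimal (generate free_group (set hs))} \<subseteq>
        (\<Union>j<k. {hs. set hs \<subseteq> C \<and> length hs = k \<and> P j hs})"
    proof
      fix hs assume hs: "hs \<in> A \<inter> {hs. \<not> strictly_whitehead_minimal (generate free_group (set hs))}"
      then have l: "set hs \<subseteq> C" "length hs = k" by (auto simp: A)
      have "\<exists>j<k. P j hs"
      proof (rule ccontr)
        assume neg: "\<not> ?thesis"
        have "strictly_whitehead_minimal (generate free_group (set hs))"
        proof (rule good_tuple_minimal[OF assms(1) _ \<epsilon>0 _ t1 t4])
          show "4 * real t \<le> \<epsilon> * real n" "4 \<le> \<epsilon> * real n" using t_le n16 by simp_all
        qed (use neg l assms(2) eps in \<open>auto simp: P_def C_def r_def\<close>)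
        then show False using hs by blast
      qed
      then show "hs \<in> (\<Union>j<k. {hs. set hs \<subseteq> C \<and> length hs = k \<and> P j hs})" using l by blast
    qed
    define D where "D = real (card (bad_words \<epsilon> n :: 'a word set)) + real k * (4 * real d ^ (n - t + 1))"
    have coord: "real (card {x \<in> C. P j (us @ x # vs)}) \<le> D"
      if j: "j < k" "length us = j" "length vs = k - Suc j" for j us vs
    proof -
      have "{x \<in> C. P j (us @ x # vs)} \<subseteq> bad_words \<epsilon> n \<union> (\<Union>u\<in>set (us @ vs). {x \<in> C. clash t u x})"
      proof
        fix x assume x: "x \<in> {x \<in> C. P j (us @ x # vs)}"
        have nth: "(us @ x # vs) ! j = x" using j(2) by (metis nth_append_length)
        show "x \<in> bad_words \<epsilon> n \<union> (\<Union>u\<in>set (us @ vs). {x \<in> C. clash t u x})"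
        proof (cases "x \<in> bad_words \<epsilon> n")
          case False
          then obtain i where i: "i < k" "i \<noteq> j" "clash t ((us @ x # vs) ! i) x"
            using x unfolding P_def by (auto simp: nth)
          have "(us @ x # vs) ! i \<in> set (us @ vs)"
          proof (cases "i < j")
            case True
            then show ?thesis using j by (simp add: nth_append)
          next
            case False
            then have "(us @ x # vs) ! i = vs ! (i - Suc j)" "i - Suc j < length vs"
              using i j by (auto simp: nth_append nth_Cons')
            then show ?thesis by simp
          qed
          then show ?thesis using x i by blast
        qed simp
      qed
      moreover have "finite (bad_words \<epsilon> n :: 'a word set)"
        by (rule finite_subset[OF _ finite_cyc_words[of n]]) (auto simp: bad_words_def)
      ultimately have "card {x \<in> C. P j (us @ x # vs)} \<le> card (bad_words \<epsilon> n \<union> (\<Union>u\<in>set (us @ vs). {x \<in> C. clash t u x}))"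
        using finC by (intro card_mono) auto
      also have "\<dots> \<le> card (bad_words \<epsilon> n :: 'a word set) + card (\<Union>u\<in>set (us @ vs). {x \<in> C. clash t u x})"
        by (rule card_Un_le)
      also have "card (\<Union>u\<in>set (us @ vs). {x \<in> C. clash t u x}) \<le> (\<Sum>u\<in>set (us @ vs). card {x \<in> C. clash t u x})"
        by (rule card_UN_le) simp
      also have "\<dots> \<le> (\<Sum>u\<in>set (us @ vs). 4 * d ^ (n - t + 1))"
        unfolding C_def d_def using t1 t4 by (intro sum_mono card_clash[OF assms(1)]) auto
      also have "\<dots> = card (set (us @ vs)) * (4 * d ^ (n - t + 1))" by simp
      also have "\<dots> \<le> k * (4 * d ^ (n - t + 1))"
        using card_length[of "us @ vs"] j by (intro mult_right_mono) auto
      finally have "card {x \<in> C. P j (us @ x # vs)} \<le>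
          card (bad_words \<epsilon> n :: 'a word set) + k * (4 * d ^ (n - t + 1))"
        by simp
      then have "real (card {x \<in> C. P j (us @ x # vs)}) \<le>
          real (card (bad_words \<epsilon> n :: 'a word set) + k * (4 * d ^ (n - t + 1)))"
        by (rule of_nat_mono)
      then show ?thesis by (simp only: D_def of_nat_add of_nat_mult of_nat_power of_nat_numeral)
    qed
    have "real (card (A \<inter> {hs. \<not> strictly_whitehead_minimal (generate free_group (set hs))})) \<le>
        real (card (\<Union>j<k. {hs. set hs \<subseteq> C \<and> length hs = k \<and> P j hs}))"
      using bad finA unfolding A by (intro of_nat_mono card_mono) (auto elim: rev_finite_subset)
    also have "\<dots> \<le> (\<Sum>j<k. real (card {hs. set hs \<subseteq> C \<and> length hs = k \<and> P j hs}))"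
      by (rule real_card_UN_le) simp
    also have "\<dots> \<le> (\<Sum>j<k. D * real (card C) ^ (k - 1))"
      using coord by (intro sum_mono card_coordinate_le[OF finC]) auto
    also have "\<dots> = real k * D * real (card C) ^ (k - 1)" by simp
    finally have num: "real (card (A \<inter> {hs. \<not> strictly_whitehead_minimal (generate free_group (set hs))})) \<le>
        real k * D * real (card C) ^ (k - 1)" .
    have Ck: "real (card C) ^ k = real (card C) ^ (k - 1) * real (card C)"
      using assms(2) by (cases k) simp_all
    have "p n = real (card (A \<inter> {hs. \<not> strictly_whitehead_minimal (generate free_group (set hs))})) / real (card A)"
      unfolding p_def A_def[symmetric] by (rule measure_pmf_of_set[OF neA finA])
    also have "\<dots> \<le> real k * D * real (card C) ^ (k - 1) / real (card A)"
      using num by (rule divide_right_mono) simp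
    also have "\<dots> = real k * D / real (card C)"
      unfolding cardA of_nat_power Ck using Cpos by simp
    \<comment> \<open>The lower bound for the number of cyclically reduced words loses two letters,
      whence the factor \<open>d ^ 2\<close> in \<open>K\<close>.\<close>
    also have "\<dots> \<le> real k * D / real d ^ (n - 2)"
      using cardC by (intro divide_left_mono mult_pos_pos Cpos \<open>0 < real d ^ (n - 2)\<close>) (auto simp: D_def)
    also have "\<dots> = real k * (D / real d ^ n) * real d ^ 2"
    proof -
      have "n - 2 + 2 = n" using n by simp
      then have "real d ^ n = real d ^ (n - 2) * real d ^ 2" by (metis power_add)
      then show ?thesis using d by simp
    qed
    finally have pn: "p n \<le> real k * (D / real d ^ n) * real d ^ 2" .
    \<comment> \<open>Here \<open>d \<ge> 3\<close> is used in the form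
      \<open>exp 1 \<le> d\<close>.\<close>
    have dec: "real d ^ a / real d ^ n \<le> exp (real a - real n)" if "a \<le> n" for a
    proof -
      have "exp 1 \<le> real d" using exp_le d by linarith
      then have "exp 1 ^ (n - a) \<le> real d ^ (n - a)" by (intro power_mono) auto
      then have "exp (real (n - a)) \<le> real d ^ (n - a)" by (simp add: exp_of_nat_mult[of _ 1, simplified])
      then have "1 / real d ^ (n - a) \<le> 1 / exp (real (n - a))" using d by (intro divide_left_mono) auto
      moreover have "a + (n - a) = n" using that by simp
      then have "real d ^ n = real d ^ a * real d ^ (n - a)" by (metis power_add)
      then have "real d ^ a / real d ^ n = 1 / real d ^ (n - a)" using d by simp
      moreover have "1 / exp (real (n - a)) = exp (real a - real n)"
        using that by (simp add: exp_minus[symmetric] of_nat_diff divide_inverse)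
      ultimately show ?thesis by simp
    qed
    define e where "e = exp (- c * real n)"
    have T1: "real d ^ (n div 2) / real d ^ n \<le> e"
    proof -
      have "real (n div 2) - real n \<le> - (1 / 2) * real n" by linarith
      also have "\<dots> \<le> - c * real n" using c(3) by (intro mult_right_mono) auto
      finally have "exp (real (n div 2) - real n) \<le> e" by (simp add: e_def)
      then show ?thesis using dec[of "n div 2"] by simp
    qed
    have T3: "real d ^ (n - t) / real d ^ n \<le> exp 1 * e"
    proof -
      have "c * real n \<le> \<epsilon> / 8 * real n" using c(2) by (intro mult_right_mono) auto
      then have "real (n - t) - real n \<le> 1 + - c * real n" using t_ge t4 by (simp add: of_nat_diff)
      then have "exp (real (n - t) - real n) \<le> exp 1 * e" unfolding e_def exp_add[symmetric] by simp
      then show ?thesis using dec[of "n - t"] by simp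
    qed
    have "D \<le> 2 * r * real d ^ (n div 2) + 2 ^ (2 * CARD('a)) * (2 * r) * exp 2 * real d ^ n * e +
        real k * (4 * real d ^ (n - t + 1))"
      using card_bad_words[OF assms(1) \<epsilon>0 \<epsilon>1, of n] unfolding D_def d_def r_def e_def c_def by simp
    then have "D / real d ^ n \<le> (2 * r * real d ^ (n div 2) + 2 ^ (2 * CARD('a)) * (2 * r) * exp 2 * real d ^ n * e +
        real k * (4 * real d ^ (n - t + 1))) / real d ^ n"
      by (rule divide_right_mono) simp
    also have "\<dots> = 2 * r * (real d ^ (n div 2) / real d ^ n) + 2 ^ (2 * CARD('a)) * (2 * r) * exp 2 * e +
        4 * real k * real d * (real d ^ (n - t) / real d ^ n)"
      using d by (simp add: add_divide_distrib)
    also have "\<dots> \<le> 2 * r * e + 2 ^ (2 * CARD('a)) * (2 * r) * exp 2 * e + 4 * real k * real d * (exp 1 * e)"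
      using T1 T3 r by (intro add_mono mult_left_mono) auto
    also have "\<dots> = (2 * r + 2 ^ (2 * CARD('a)) * (2 * r) * exp 2 + 4 * real k * real d * exp 1) * e"
      by (simp add: algebra_simps)
    finally have "real k * (D / real d ^ n) * real d ^ 2 \<le>
        real k * ((2 * r + 2 ^ (2 * CARD('a)) * (2 * r) * exp 2 + 4 * real k * real d * exp 1) * e) * real d ^ 2"
      by (intro mult_right_mono mult_left_mono) auto
    then show ?thesis using pn unfolding K_def e_def by (simp add: mult_ac)
  qed
  have "p \<in> O(\<lambda>n. exp (- c * real n))"
  proof (rule bigoI[where c = K])
    show "\<forall>\<^sub>F n in sequentially. norm (p n) \<le> K * norm (exp (- c * real n))"
      using eventually_ge_at_top[of n0]
    proof eventually_elim
      case (elim n)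
      have "0 \<le> p n" by (simp add: p_def)
      then show ?case using bound[OF elim] by simp
    qed
  qed
  then show ?thesis using c(1) unfolding p_def by blast
qed

end
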